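(* (Case $(n,n')=(2,2)$.) There exists a constant $C>0$ such that for all $\lambda,\nu\in(i\mathbb{R})^2$ with $\lambda_1+\lambda_2=\nu_1+\nu_2=0$ and all $s\in\frac12+i\mathbb{R}$, $$|G_{\lambda,\nu}(s)|=C\cdot\big|\ell^{\mathrm{mod}}_{\lambda,\nu,s}(\phi_\lambda\otimes\phi_\nu\otimes f_{s-\frac12})\big|.$$
   Context: Let $G=\mathrm{GL}(2,\mathbb{R})$ and $K_G=\mathrm{O}(2)$ with Haar measure of total mass $1$. Representations. For $\lambda\in\mathbb{C}^2$ let $I_\lambda$ be the space of $u\in C^\infty(G)$ with $u\big(\begin{pmatrix}a&b\\0&d\end{pmatrix}g\big)=|a|^{\lambda_1+\frac12}|d|^{\lambda_2-\frac12}u(g)$, and for $r\in\mathbb{C}$ let $L_r$ be the space of $f\in C^\infty(G)$ with $f\big(\begin{pmatrix}a&b\\0&d\end{pmatrix}g\big)=|a/d|^{r+\frac12}f(g)$ (for all $a,d\in\mathbb{R}^\times$, $b\in\mathbb{R}$, $g\in G$). $\phi_\lambda\in I_\lambda$ and $f_r\in L_r$ are the unique right $K_G$-invariant elements with value $1$ at the identity. Model period. For $\lambda,\nu\in\mathbb{C}^2$ with $\lambda_1+\lambda_2+\nu_1+\nu_2=0$ and $s\in\mathbb{C}$ let $$\ell^{\mathrm{mod}}_{\lambda,\nu,s}(v\otimes w\otimes u)=\int_{K_G^3}K_{\lambda,\nu,s}(g_1,g_2,g_3)v(g_1)w(g_2)u(g_3)\,d(g_1,g_2,g_3)\qquad(v\in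 I_\lambda,\ w\in I_\nu,\ u\in L_{s-\frac12}),$$ where for $g_1,g_2,g_3\in G$, writing $x_{21}$ for the lower left entry of a matrix $x$, $$K_{\lambda,\nu,s}(g_1,g_2,g_3)=|\det(g_1g_2)|^{-\frac{s-1}{2}}|\det g_3|^{s-1}|\det(g_1g_2^{-1})|^{-\lambda_1+\frac s2}\,|(g_1g_2^{-1})_{21}|^{-\lambda_2-\nu_2-s}|(g_1g_3^{-1})_{21}|^{\lambda_1+\nu_2+s-1}|(g_2g_3^{-1})_{21}|^{\lambda_2+\nu_1+s-1}.$$ The integral is an ordinary integral when the last three exponents have real part $\ge0$, and is defined in general by meromorphic continuation in $(\lambda,\nu,s)$. Archimedean factor. For $z\in G$ written (Iwasawa decomposition) as $z=\begin{pmatrix}1&x\\0&1\end{pmatrix}\begin{pmatrix}y&0\\0&1\end{pmatrix}ck$ with $x\in\mathbb{R}$, $y>0$, $c\in\mathbb{R}^\times$ (scalar matrix), $k\in\mathrm{O}(2)$, and $\alpha\in\mathbb{C}$, put $I_\alpha(z)=y^\alpha$. For a character $\theta$ of the group $N$ of unipotent upper triangular matrices, Jacquet's Whittaker function is $$W_J(z;\alpha,\theta)=\int_{\mathbb{R}}I_\alpha\Big(\begin{pmatrix}0&1\\1&0\end{pmatrix}\begin{pmatrix}1&t\\0&1\end{pmatrix}z\Big)\overline{\theta\begin{pmatrix}1&t\\0&1\end{pmatrix}}\,dt$$ for $\mathrm{Re}\,\alpha>\frac12$, extended holomorphically to $\alpha\in\mathbb{C}$. Let $\psi\begin{pmatrix}1&t\\0&1\end{pmatrix}=e^{2\pi\sqrt{-1}\,t}$.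 For $\lambda,\nu$ with $\lambda_1+\lambda_2=\nu_1+\nu_2=0$ put $\alpha=\frac12(\lambda_1-\lambda_2+1)$, $\alpha'=\frac12(\nu_1-\nu_2+1)$, and $$G_{\lambda,\nu}(s)=\int_0^\infty W_J\Big(\begin{pmatrix}y&0\\0&1\end{pmatrix};\alpha,\psi\Big)W_J\Big(\begin{pmatrix}y&0\\0&1\end{pmatrix};\alpha',\overline\psi\Big)\,y^{s}\,\frac{dy}{y^2}.$$ *)

theory Defs
  imports "HOL-Probability.Probability"
begin

section \<open>The groups\<close>

definition mat2 :: "real \<Rightarrow> real \<Rightarrow> real \<Rightarrow> real \<Rightarrow> real^2^2" where
  "mat2 a b c d = vector [vector [a, b], vector [c, d]]"

definition GL2 :: "(real^2^2) set" where
  "GL2 = {g. invertible g}"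

definition O2 :: "(real^2^2) set" where
  "O2 = {k. orthogonal_matrix k}"

text \<open>A Borel probability measure on a compact matrix group invariant under left translations
  exists and is unique, so the description below determines the Haar measure.\<close>

definition haar_prob :: "(real^2^2) set \<Rightarrow> (real^2^2) measure" where
  "haar_prob K = (THE M. sets M = sets (restrict_space borel K) \<and> prob_space M \<and>
     (\<forall>k\<in>K. distr M M (\<lambda>x. k ** x) = M))"


section \<open>Smooth functions and the representation spaces\<close>

fun Ck_on :: "nat \<Rightarrow> 'a::real_normed_vector set \<Rightarrow> ('a \<Rightarrow> 'b::real_normed_vector) \<Rightarrow> bool" where
  "Ck_on 0 S f \<longleftrightarrow> continuous_on S f"
| "Ck_on (Suc k) S f \<longleftrightarrow> (\<forall>x\<in>S. f differentiable (at x)) \<and>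
     (\<forall>v. Ck_on k S (\<lambda>x. frechet_derivative f (at x) v))"

definition smooth_on :: "'a::real_normed_vector set \<Rightarrow> ('a \<Rightarrow> 'b::real_normed_vector) \<Rightarrow> bool" where
  "smooth_on S f \<longleftrightarrow> (\<forall>k. Ck_on k S f)"

text \<open>Functions on \<open>GL2\<close> are total functions on all matrices that are \<open>extensional\<close>, so that
  equality of such functions is equality on the group.\<close>

definition I_space :: "complex^2 \<Rightarrow> (real^2^2 \<Rightarrow> complex) set" where
  "I_space \<Lambda> = {u \<in> extensional GL2. smooth_on GL2 u \<and>
     (\<forall>a b d. \<forall>g\<in>GL2. a \<noteq> 0 \<longrightarrow> d \<noteq> 0 \<longrightarrow>
        u (mat2 a b 0 d ** g) =
          of_real \<bar>a\<bar> powr (\<Lambda>$1 + 1/2) * of_real \<bar>d\<bar> powr (\<Lambda>$2 - 1/2) * u g)}"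

definition L_space :: "complex \<Rightarrow> (real^2^2 \<Rightarrow> complex) set" where
  "L_space r = {f \<in> extensional GL2. smooth_on GL2 f \<and>
     (\<forall>a b d. \<forall>g\<in>GL2. a \<noteq> 0 \<longrightarrow> d \<noteq> 0 \<longrightarrow>
        f (mat2 a b 0 d ** g) = of_real \<bar>a / d\<bar> powr (r + 1/2) * f g)}"

definition right_O2_invariant :: "(real^2^2 \<Rightarrow> complex) \<Rightarrow> bool" where
  "right_O2_invariant u \<longleftrightarrow> (\<forall>g\<in>GL2. \<forall>k\<in>O2. u (g ** k) = u g)"

definition phi_sph :: "complex^2 \<Rightarrow> real^2^2 \<Rightarrow> complex" where
  "phi_sph \<Lambda> = (THE u. u \<in> I_space \<Lambda> \<and> right_O2_invariant u \<and> u (mat 1) = 1)"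

definition f_sph :: "complex \<Rightarrow> real^2^2 \<Rightarrow> complex" where
  "f_sph r = (THE f. f \<in> L_space r \<and> right_O2_invariant f \<and> f (mat 1) = 1)"


section \<open>Meromorphic continuation in several variables\<close>

text \<open>The two predicates are meant for open sets \<open>S\<close>.\<close>

definition holomorphic_vec_on :: "(complex^'n \<Rightarrow> complex) \<Rightarrow> (complex^'n) set \<Rightarrow> bool" where
  "holomorphic_vec_on f S \<longleftrightarrow>
     (\<forall>z\<in>S. \<exists>D. (f has_derivative D) (at z) \<and> (\<forall>c v. D (c *s v) = c * D v))"

text \<open>Locally a quotient \<open>P / Q\<close> of holomorphic functions whose denominator does not vanish
  identically on any nonempty open set; values at zeros of the denominator are unconstrained.\<close>

definition meromorphic_vec_on :: "(complex^'n \<Rightarrow> complex) \<Rightarrow> (complex^'n) set \<Rightarrow> bool" where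
  "meromorphic_vec_on f S \<longleftrightarrow>
     (\<forall>p\<in>S. \<exists>V P Q. open V \<and> p \<in> V \<and> holomorphic_vec_on P V \<and> holomorphic_vec_on Q V \<and>
        (\<forall>W. open W \<and> W \<noteq> {} \<and> W \<subseteq> V \<longrightarrow> (\<exists>z\<in>W. Q z \<noteq> 0)) \<and>
        (\<forall>z\<in>V. Q z \<noteq> 0 \<longrightarrow> f z = P z / Q z))"

text \<open>The value at \<open>p\<close> of the meromorphic continuation to the whole space of a function \<open>f\<close> given
  on a set \<open>D\<close> with nonempty interior, at points \<open>p\<close> where the continuation is holomorphic.\<close>

definition meromorphic_continuation ::
    "(complex^'n \<Rightarrow> complex) \<Rightarrow> (complex^'n) set \<Rightarrow> complex^'n \<Rightarrow> complex" where
  "meromorphic_continuation f D p =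
     (THE c. \<exists>F V. meromorphic_vec_on F UNIV \<and> (\<forall>z\<in>D. F z = f z) \<and>
        open V \<and> p \<in> V \<and> holomorphic_vec_on F V \<and> F p = c)"


section \<open>The model period\<close>

definition period_kernel ::
    "complex^2 \<Rightarrow> complex^2 \<Rightarrow> complex \<Rightarrow> real^2^2 \<Rightarrow> real^2^2 \<Rightarrow> real^2^2 \<Rightarrow> complex" where
  "period_kernel \<Lambda> \<nu> s g1 g2 g3 =
     of_real \<bar>det (g1 ** g2)\<bar> powr (- ((s - 1) / 2)) *
     of_real \<bar>det g3\<bar> powr (s - 1) *
     of_real \<bar>det (g1 ** matrix_inv g2)\<bar> powr (- \<Lambda>$1 + s / 2) *
     of_real \<bar>(g1 ** matrix_inv g2)$2$1\<bar> powr (- \<Lambda>$2 - \<nu>$2 - s) *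
     of_real \<bar>(g1 ** matrix_inv g3)$2$1\<bar> powr (\<Lambda>$1 + \<nu>$2 + s - 1) *
     of_real \<bar>(g2 ** matrix_inv g3)$2$1\<bar> powr (\<Lambda>$2 + \<nu>$1 + s - 1)"

definition period_integral ::
    "complex^2 \<Rightarrow> complex^2 \<Rightarrow> complex \<Rightarrow>
     (real^2^2 \<Rightarrow> complex) \<Rightarrow> (real^2^2 \<Rightarrow> complex) \<Rightarrow> (real^2^2 \<Rightarrow> complex) \<Rightarrow> complex" where
  "period_integral \<Lambda> \<nu> s v w u =
     (LINT (g1, g2, g3) | (haar_prob O2 \<Otimes>\<^sub>M (haar_prob O2 \<Otimes>\<^sub>M haar_prob O2)).
        period_kernel \<Lambda> \<nu> s g1 g2 g3 * v g1 * w g2 * u g3)"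

text \<open>Coordinates \<open>(\<Lambda>$1, \<Lambda>$2, \<nu>$1, s)\<close> on the hyperplane \<open>\<Lambda>$1 + \<Lambda>$2 + \<nu>$1 + \<nu>$2 = 0\<close>.\<close>

definition Lam_of :: "complex^4 \<Rightarrow> complex^2" where
  "Lam_of z = vector [z$1, z$2]"

definition nu_of :: "complex^4 \<Rightarrow> complex^2" where
  "nu_of z = vector [z$3, - z$1 - z$2 - z$3]"

definition convergence_region :: "(complex^4) set" where
  "convergence_region =
     {z. Re (- Lam_of z$2 - nu_of z$2 - z$4) \<ge> 0 \<and>
         Re (Lam_of z$1 + nu_of z$2 + z$4 - 1) \<ge> 0 \<and>
         Re (Lam_of z$2 + nu_of z$1 + z$4 - 1) \<ge> 0}"

text \<open>Intended for \<open>\<Lambda>$1 + \<Lambda>$2 + \<nu>$1 + \<nu>$2 = 0\<close>, \<open>v \<in> I_space \<Lambda>\<close>, \<open>w \<in> I_space \<nu>\<close>,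
  \<open>u \<in> L_space (s - 1/2)\<close>. Only the restrictions of \<open>v\<close>, \<open>w\<close>, \<open>u\<close> to \<open>O2\<close> enter. Restriction to \<open>O2\<close>
  identifies all the spaces \<open>I_space \<Lambda>\<close> and \<open>L_space r\<close> with one space independent of the
  parameters, and the continuation is taken with these restrictions held fixed.\<close>

definition l_mod ::
    "complex^2 \<Rightarrow> complex^2 \<Rightarrow> complex \<Rightarrow>
     (real^2^2 \<Rightarrow> complex) \<Rightarrow> (real^2^2 \<Rightarrow> complex) \<Rightarrow> (real^2^2 \<Rightarrow> complex) \<Rightarrow> complex" where
  "l_mod \<Lambda> \<nu> s v w u =
     meromorphic_continuation (\<lambda>z. period_integral (Lam_of z) (nu_of z) (z$4) v w u)
       convergence_region (vector [\<Lambda>$1, \<Lambda>$2, \<nu>$1, s])"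


section \<open>Whittaker functions and the archimedean factor\<close>

definition iwasawa_y :: "real^2^2 \<Rightarrow> real" where
  "iwasawa_y z = (THE y. y > 0 \<and>
     (\<exists>x c k. c \<noteq> 0 \<and> k \<in> O2 \<and> z = mat2 1 x 0 1 ** mat2 y 0 0 1 ** mat c ** k))"

definition I_fun :: "complex \<Rightarrow> real^2^2 \<Rightarrow> complex" where
  "I_fun \<alpha> z = of_real (iwasawa_y z) powr \<alpha>"

definition jacquet_integral :: "real^2^2 \<Rightarrow> complex \<Rightarrow> (real^2^2 \<Rightarrow> complex) \<Rightarrow> complex" where
  "jacquet_integral z \<alpha> \<theta> =
     (LINT t | lborel. I_fun \<alpha> (mat2 0 1 1 0 ** mat2 1 t 0 1 ** z) * cnj (\<theta> (mat2 1 t 0 1)))"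

definition W_J :: "real^2^2 \<Rightarrow> complex \<Rightarrow> (real^2^2 \<Rightarrow> complex) \<Rightarrow> complex" where
  "W_J z \<alpha> \<theta> =
     (THE F. F holomorphic_on UNIV \<and> (\<forall>\<beta>. Re \<beta> > 1/2 \<longrightarrow> F \<beta> = jacquet_integral z \<beta> \<theta>)) \<alpha>"

text \<open>A character of the unipotent upper triangular group, written as a function of the matrix.\<close>

definition psi :: "real^2^2 \<Rightarrow> complex" where
  "psi n = exp (2 * of_real pi * \<i> * of_real (n$1$2))"

definition G_arch :: "complex^2 \<Rightarrow> complex^2 \<Rightarrow> complex \<Rightarrow> complex" where
  "G_arch \<Lambda> \<nu> s =
     (LINT y : {0<..} | lborel.
        W_J (mat2 y 0 0 1) ((\<Lambda>$1 - \<Lambda>$2 + 1) / 2) psi *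
        W_J (mat2 y 0 0 1) ((\<nu>$1 - \<nu>$2 + 1) / 2) (\<lambda>n. cnj (psi n)) *
        of_real y powr s / of_real (y\<^sup>2))"

end

theory Submission
  imports Defs "HOL-Complex_Analysis.Conformal_Mappings"
begin

text \<open>Both sides are computed explicitly. Jacquet's integral is a Bessel integral, and the Mellin transform
  of a product of two of them is a product of four Gamma factors over \<open>Gamma s\<close>. The model period on the
  spherical vectors becomes, in the coordinate \<open>t = tan x\<close> on \<open>O2\<close>, an integral of
  \<open>\<bar>p - q\<bar> powr c * (1 + p\<^sup>2) powr - u * (1 + q\<^sup>2) powr - v\<close>, which is again a quotient of Gamma
  factors; this quotient is meromorphic in all parameters and gives the continuation. The two results differ
  by a constant and by \<open>Gamma ((1 + \<Lambda>$1 + \<nu>$1 - s) / 2)\<close> in place of \<open>Gamma ((s - \<Lambda>$1 - \<nu>$1) / 2)\<close>,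
  and on the unitary axis these are complex conjugate. All Gamma integrals are taken over the whole line in
  logarithmic coordinates.\<close>

section \<open>Gamma integrals in logarithmic coordinates\<close>

text \<open>On the unitary axis all three exponents of \<open>wedge\<close> in the period have real
  part -1/2, so the theorem never concerns a point where the period is by definition an ordinary
  integral. The closed form is therefore proved for exponents of nonnegative real part and carried
  over by the identity theorem in four complex variables. Haar measure, spherical vectors, Jacquet's
  function and the continuation are all given by \<open>THE\<close>; each evaluation needs an
  explicit witness and a uniqueness argument. Logarithmic coordinates pay off threefold: powers
  become exponentials of linear forms and combine by adding exponents; the homogeneous changes of
  variables become translations and shears of the line and plane, under which Lebesgue measure is
  invariant; and the norm of an integrand is the same integrand at the real parts of the parameters,
  so the absolute convergence needed for Fubini is another instance of the formula being
  proved.\<close>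

lemma borel_measurable_complex_of_real [measurable]:
  "f \<in> borel_measurable M \<Longrightarrow> (\<lambda>x. complex_of_real (f x)) \<in> borel_measurable M"
  using borel_measurable_of_real by (rule measurable_compose_rev)

lemma borel_measurable_complex_exp [measurable]:
  fixes f :: "'a \<Rightarrow> complex"
  shows "f \<in> borel_measurable M \<Longrightarrow> (\<lambda>x. exp (f x)) \<in> borel_measurable M"
  by (rule measurable_compose_rev[OF borel_measurable_continuous_onI]) (intro continuous_intros)

lemma borel_measurable_of_real_powr [measurable]:
  assumes [measurable]: "f \<in> borel_measurable M"
  shows "(\<lambda>x. complex_of_real (f x) powr z) \<in> borel_measurable M"
proof -
  have "complex_of_real t powr z = (if t = 0 then 0 else if t > 0 then exp (z * of_real (ln t))
      else exp (z * (of_real (ln (- t)) + \<i> * pi)))" for t :: real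
    by (auto simp: powr_def Ln_of_real Ln_of_real' mult.commute)
  then show ?thesis by simp
qed

section \<open>Change of variables and Fubini for Bochner integrals\<close>

text \<open>Substitution is known on compact intervals; exhausting the line by the intervals from
  \<open>- n\<close> to \<open>n\<close> and monotone convergence on both sides give it for the
  whole line. The range of \<open>g\<close> may be a proper subset, such as the positive half line
  for \<open>exp\<close>, which is why its indicator appears as a density.\<close>

lemma distr_density_deriv:
  fixes g g' :: "real \<Rightarrow> real"
  assumes der: "\<And>x. (g has_real_derivative g' x) (at x)"
    and cont: "continuous_on UNIV g'" and pos: "\<And>x. 0 < g' x"
  shows "distr (density lborel (\<lambda>x. ennreal (g' x))) borel g = density lborel (indicator (range g))"
proof (rule measure_eqI)
  have [measurable]: "g' \<in> borel_measurable borel" using cont by (rule borel_measurable_continuous_onI)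
  have cg: "continuous_on UNIV g" using der by (meson DERIV_isCont continuous_at_imp_continuous_on)
  then have [measurable]: "g \<in> borel_measurable borel" by (rule borel_measurable_continuous_onI)
  have mono: "strict_mono g"
    by (rule strict_monoI) (use der pos in \<open>meson DERIV_pos_imp_increasing\<close>)
  have rg: "range g = (\<Union>n::nat. {g (- real n)..g (real n)})"
  proof safe
    fix x obtain n :: nat where "\<bar>x\<bar> \<le> real n" using real_arch_simple by blast
    then show "g x \<in> (\<Union>n::nat. {g (- real n)..g (real n)})"
      by (auto intro!: exI[of _ n] simp: strict_mono_less_eq[OF mono])
  next
    fix y and n :: nat assume "y \<in> {g (- real n)..g (real n)}"
    moreover have "continuous_on {- real n..real n} g" using cg continuous_on_subset by blast
    ultimately show "y \<in> range g" using IVT'[of g "- real n" y "real n"] by auto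
  qed
  have [measurable]: "range g \<in> sets borel" unfolding rg by measurable
  show "sets (distr (density lborel (\<lambda>x. ennreal (g' x))) borel g) = sets (density lborel (indicator (range g)))"
    by simp
  fix A assume "A \<in> sets (distr (density lborel (\<lambda>x. ennreal (g' x))) borel g)"
  then have [measurable]: "A \<in> sets borel" by simp
  have "emeasure (distr (density lborel (\<lambda>x. ennreal (g' x))) borel g) A
      = (\<integral>\<^sup>+x. ennreal (g' x) * indicator A (g x) \<partial>lborel)"
    using measurable_sets_borel[of g borel A]
    by (subst emeasure_distr; simp add: emeasure_density)
       (auto simp: comp_def intro!: nn_integral_cong split: split_indicator)
  also have "\<dots> = (\<integral>\<^sup>+x. (SUP n. indicator A (g x) * ennreal (g' x) * indicator {- real n..real n} x) \<partial>lborel)"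
  proof (intro nn_integral_cong)
    fix x :: real
    obtain n :: nat where n: "\<bar>x\<bar> \<le> real n" using real_arch_simple by blast
    show "ennreal (g' x) * indicator A (g x) =
        (SUP n. indicator A (g x) * ennreal (g' x) * indicator {- real n..real n} x)"
      by (rule antisym, rule SUP_upper2[of n])
         (use n in \<open>auto simp: mult.commute indicator_def intro!: SUP_least\<close>)
  qed
  also have "\<dots> = (SUP n. \<integral>\<^sup>+x. indicator A (g x) * ennreal (g' x) * indicator {- real n..real n} x \<partial>lborel)"
    by (rule nn_integral_monotone_convergence_SUP)
       (auto simp: incseq_def le_fun_def split: split_indicator)
  also have "\<dots> = (SUP n. \<integral>\<^sup>+x. indicator A x * indicator {g (- real n)..g (real n)} x \<partial>lborel)"
  proof (intro SUP_cong refl)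
    fix n :: nat
    show "(\<integral>\<^sup>+x. indicator A (g x) * ennreal (g' x) * indicator {- real n..real n} x \<partial>lborel) =
          (\<integral>\<^sup>+x. indicator A x * indicator {g (- real n)..g (real n)} x \<partial>lborel)"
    \<comment> \<open>The compact substitution rule wants a nondegenerate interval. For
      \<open>n = 0\<close> both integrals live on a single point and vanish.\<close>
    proof (cases "n = 0")
      case True
      then have *: "{- real n..real n} = {0}" "{g (- real n)..g (real n)} = {g 0}" by auto
      have "AE x in lborel. indicator A (g x) * ennreal (g' x) * indicator {0} x = 0"
        using AE_lborel_singleton[of 0] by eventually_elim auto
      moreover have "AE x in lborel. indicator A x * indicator {g 0} x = (0::ennreal)"
        using AE_lborel_singleton[of "g 0"] by eventually_elim auto
      ultimately show ?thesis unfolding * by (simp cong: nn_integral_cong_AE)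
    next
      case False
      then show ?thesis
        by (intro nn_integral_substitution_aux[symmetric])
           (use der pos cont in \<open>auto simp: less_imp_le intro: continuous_on_subset\<close>)
    qed
  qed
  also have "\<dots> = (\<integral>\<^sup>+x. (SUP n. indicator A x * indicator {g (- real n)..g (real n)} x) \<partial>lborel)"
  proof (rule nn_integral_monotone_convergence_SUP[symmetric])
    have "{g (- real m)..g (real m)} \<subseteq> {g (- real n)..g (real n)}" if "m \<le> n" for m n :: nat
      using that by (simp add: strict_mono_less_eq[OF mono])
    then have "indicator {g (- real m)..g (real m)} x \<le> (indicator {g (- real n)..g (real n)} x :: ennreal)"
      if "m \<le> n" for m n :: nat and x using that unfolding indicator_def by (auto simp: subset_iff)
    then show "incseq (\<lambda>n x. indicator A x * indicator {g (- real n)..g (real n)} x :: ennreal)"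
      unfolding incseq_def le_fun_def by (auto intro!: mult_left_mono)
  qed auto
  also have "\<dots> = (\<integral>\<^sup>+x. indicator (range g) x * indicator A x \<partial>lborel)"
  proof (intro nn_integral_cong)
    fix x
    show "(SUP n. indicator A x * indicator {g (- real n)..g (real n)} x) = (indicator (range g) x * indicator A x :: ennreal)"
    proof (cases "x \<in> range g")
      case True
      then obtain n where "x \<in> {g (- real n)..g (real n)}" unfolding rg by blast
      then show ?thesis using True
        by (intro antisym, intro SUP_least, simp add: indicator_def, intro SUP_upper2[of n]) auto
    next
      case False
      then have "x \<notin> {g (- real n)..g (real n)}" for n unfolding rg by blast
      then show ?thesis using False by simp
    qed
  qed
  also have "\<dots> = emeasure (density lborel (indicator (range g))) A"
    by (simp add: emeasure_density)
  finally show "emeasure (distr (density lborel (\<lambda>x. ennreal (g' x))) borel g) A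
     = emeasure (density lborel (indicator (range g))) A" .
qed

text \<open>Stated as an equivalence so that integrability is transported together with the value,
  in whichever direction is needed.\<close>

lemma has_bochner_integral_range_subst:
  fixes g g' :: "real \<Rightarrow> real" and f :: "real \<Rightarrow> 'a :: {banach, second_countable_topology}"
  assumes der: "\<And>x. (g has_real_derivative g' x) (at x)"
    and cont: "continuous_on UNIV g'" and pos: "\<And>x. 0 < g' x" and rg: "range g = S"
    and S[measurable]: "S \<in> sets borel" and [measurable]: "f \<in> borel_measurable borel"
  shows "has_bochner_integral lborel (\<lambda>x. indicator S x *\<^sub>R f x) I \<longleftrightarrow>
    has_bochner_integral lborel (\<lambda>x. g' x *\<^sub>R f (g x)) I"
proof -
  have [measurable]: "g' \<in> borel_measurable borel" using cont by (rule borel_measurable_continuous_onI)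
  have "continuous_on UNIV g" using der by (meson DERIV_isCont continuous_at_imp_continuous_on)
  then have [measurable]: "g \<in> borel_measurable borel" by (rule borel_measurable_continuous_onI)
  note eq = distr_density_deriv[OF der cont pos, unfolded rg]
  have i: "(indicator S :: real \<Rightarrow> ennreal) = (\<lambda>x. ennreal (indicator S x))" by (auto split: split_indicator)
  have p: "AE x in lborel. 0 \<le> g' x" using pos by (simp add: less_imp_le)
  have "integrable (density lborel (indicator S)) f \<longleftrightarrow> integrable lborel (\<lambda>x. indicator S x *\<^sub>R f x)"
       "integral\<^sup>L (density lborel (indicator S)) f = integral\<^sup>L lborel (\<lambda>x. indicator S x *\<^sub>R f x)"
    unfolding i by (subst integrable_density integral_density; simp)+
  moreover have "integrable (distr (density lborel (\<lambda>x. ennreal (g' x))) borel g) f \<longleftrightarrow>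
        integrable lborel (\<lambda>x. g' x *\<^sub>R f (g x))"
    using p by (subst integrable_distr_eq) (simp_all add: integrable_density)
  moreover have "integral\<^sup>L (distr (density lborel (\<lambda>x. ennreal (g' x))) borel g) f =
        integral\<^sup>L lborel (\<lambda>x. g' x *\<^sub>R f (g x))"
    using p by (subst integral_distr) (simp_all add: integral_density)
  ultimately show ?thesis unfolding has_bochner_integral_iff eq by simp
qed

text \<open>Fubini in the shape needed for explicit computation: the inner integrals of the function
  and of its norm are supplied in closed form as \<open>F\<close> and \<open>N\<close>, and joint
  integrability comes from Tonelli applied to \<open>N\<close>.\<close>

lemma has_bochner_integral_pair:
  fixes f :: "_ \<Rightarrow> _::{banach, second_countable_topology}"
  assumes "sigma_finite_measure M1" "sigma_finite_measure M2"
    and f[measurable]: "f \<in> borel_measurable (M1 \<Otimes>\<^sub>M M2)"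
    and inner: "\<And>x. x \<in> space M1 \<Longrightarrow> has_bochner_integral M2 (\<lambda>y. f (x, y)) (F x)"
    and norm: "\<And>x. x \<in> space M1 \<Longrightarrow> has_bochner_integral M2 (\<lambda>y. norm (f (x, y))) (N x)"
    and N: "integrable M1 N" and F: "has_bochner_integral M1 F I"
  shows "has_bochner_integral (M1 \<Otimes>\<^sub>M M2) f I"
proof -
  interpret sigma_finite_measure M1 by fact
  interpret M2: sigma_finite_measure M2 by fact
  interpret pair_sigma_finite M1 M2 by unfold_locales
  have int: "integrable (M1 \<Otimes>\<^sub>M M2) f"
  proof (rule Fubini_integrable)
    show "integrable M1 (\<lambda>x. \<integral>y. norm (f (x, y)) \<partial>M2)"
      using N norm by (subst Bochner_Integration.integrable_cong[where g=N, OF refl]) (auto simp: has_bochner_integral_iff)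
    show "AE x in M1. integrable M2 (\<lambda>y. f (x, y))" using inner by (auto simp: has_bochner_integral_iff)
  qed fact
  have "integral\<^sup>L (M1 \<Otimes>\<^sub>M M2) f = (\<integral>x. (\<integral>y. f (x, y) \<partial>M2) \<partial>M1)"
    using integral_fst'[OF int] by simp
  also have "\<dots> = (\<integral>x. F x \<partial>M1)"
    using inner by (intro Bochner_Integration.integral_cong) (auto simp: has_bochner_integral_iff)
  also have "\<dots> = I" using F by (simp add: has_bochner_integral_iff)
  finally show ?thesis using int by (simp add: has_bochner_integral_iff)
qed

lemma has_bochner_integral_pair_swap:
  fixes f :: "_ \<Rightarrow> _::{banach, second_countable_topology}"
  assumes "sigma_finite_measure M1" "sigma_finite_measure M2"
    and f: "has_bochner_integral (M2 \<Otimes>\<^sub>M M1) (\<lambda>(y, x). f (x, y)) I"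
  shows "has_bochner_integral (M1 \<Otimes>\<^sub>M M2) f I"
proof -
  interpret sigma_finite_measure M1 by fact
  interpret M2: sigma_finite_measure M2 by fact
  interpret pair_sigma_finite M1 M2 by unfold_locales
  have "integrable (M1 \<Otimes>\<^sub>M M2) f" using f integrable_product_swap_iff[of f]
    by (auto simp: has_bochner_integral_iff)
  moreover from this have "f \<in> borel_measurable (M1 \<Otimes>\<^sub>M M2)" by simp
  ultimately show ?thesis using f integral_product_swap[of f]
    by (auto simp: has_bochner_integral_iff)
qed

text \<open>The second half of an interchange of integrals. Once a double integral has been
  evaluated in one order, integrating in the other order yields both the value and the integrability
  of the single integral of \<open>G\<close>, with no separate estimate for
  \<open>G\<close>.\<close>

lemma has_bochner_integral_fst:
  fixes f :: "_ \<Rightarrow> _::{banach, second_countable_topology}"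
  assumes "sigma_finite_measure M1" "sigma_finite_measure M2"
    and f: "has_bochner_integral (M1 \<Otimes>\<^sub>M M2) f I"
    and G: "\<And>x. x \<in> space M1 \<Longrightarrow> (\<integral>y. f (x, y) \<partial>M2) = G x"
  shows "has_bochner_integral M1 G I"
proof -
  interpret sigma_finite_measure M1 by fact
  interpret M2: sigma_finite_measure M2 by fact
  interpret pair_sigma_finite M1 M2 by unfold_locales
  have "integrable M1 (\<lambda>x. \<integral>y. f (x, y) \<partial>M2)" "(\<integral>x. (\<integral>y. f (x, y) \<partial>M2) \<partial>M1) = I"
    using f integrable_fst'[of f] integral_fst'[of f] by (auto simp: has_bochner_integral_iff)
  then have "has_bochner_integral M1 (\<lambda>x. \<integral>y. f (x, y) \<partial>M2) I" by (simp add: has_bochner_integral_iff)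
  then show ?thesis by (rule has_bochner_integral_cong[THEN iffD1, rotated -1]) (auto simp: G)
qed

lemma has_bochner_integral_pair_mult:
  fixes f :: "_ \<Rightarrow> complex"
  assumes "sigma_finite_measure M1" "sigma_finite_measure M2"
    and f: "has_bochner_integral M1 f I" and g: "has_bochner_integral M2 g J"
  shows "has_bochner_integral (M1 \<Otimes>\<^sub>M M2) (\<lambda>(x, y). f x * g y) (I * J)"
proof -
  have [measurable]: "f \<in> borel_measurable M1" "g \<in> borel_measurable M2"
    using f g by (auto simp: has_bochner_integral_iff)
  have nf: "integrable M1 (\<lambda>x. norm (f x))" and ng: "integrable M2 (\<lambda>x. norm (g x))"
    using f g by (auto simp: has_bochner_integral_iff)
  show ?thesis
    by (rule has_bochner_integral_pair[OF assms(1,2), where F="\<lambda>x. f x * J" and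
          N="\<lambda>x. norm (f x) * (LINT y|M2. norm (g y))"])
       (use f g nf ng in \<open>auto intro: has_bochner_integral_mult_right has_bochner_integral_mult_left
          simp: has_bochner_integral_iff norm_mult\<close>)
qed

lemma has_bochner_integral_shift:
  fixes f :: "real \<Rightarrow> 'a::{banach, second_countable_topology}"
  shows "has_bochner_integral lborel (\<lambda>x. f (x + t)) I \<longleftrightarrow> has_bochner_integral lborel f I"
  using lborel_has_bochner_integral_real_affine_iff[of 1 f I t] by (simp add: add.commute)

section \<open>Euler's Gamma and Beta integrals on the whole line\<close>

text \<open>Euler's integral under the substitution \<open>t = exp x\<close>, followed by the
  translation by \<open>ln A\<close>. Read from right to left it represents the power
  \<open>A powr - z\<close> as an integral of exponentials, and this is how awkward powers are
  removed everywhere below.\<close>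

lemma Gamma_exp_integral:
  fixes z :: complex and A :: real
  assumes z: "Re z > 0" and A: "A > 0"
  shows "has_bochner_integral lborel (\<lambda>x::real. exp (z * of_real x - of_real (A * exp x))) (Gamma z * exp (- z * of_real (ln A)))"
proof -
  let ?f = "\<lambda>t::real. complex_of_real t powr (z - 1) / of_real (exp t)"
  have m[measurable]: "?f \<in> borel_measurable borel" by measurable
  have a: "?f absolutely_integrable_on {0<..}"
    by (rule absolutely_integrable_Gamma_integral'[OF z])
  have "set_integrable lborel {0<..} ?f"
    using a unfolding set_integrable_def by (subst (asm) integrable_completion) auto
  moreover have "set_lebesgue_integral lborel {0<..} ?f = Gamma z"
  proof -
    have "set_lebesgue_integral lborel {0<..} ?f = set_lebesgue_integral lebesgue {0<..} ?f"
      unfolding set_lebesgue_integral_def by (subst integral_completion) auto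
    also have "\<dots> = integral {0<..} ?f" by (rule set_lebesgue_integral_eq_integral(2)[OF a])
    also have "\<dots> = Gamma z" using Gamma_integral_complex'[OF z] by (rule integral_unique)
    finally show ?thesis .
  qed
  ultimately have "has_bochner_integral lborel (\<lambda>x. indicator {0<..} x *\<^sub>R ?f x) (Gamma z)"
    by (simp add: has_bochner_integral_iff set_integrable_def set_lebesgue_integral_def)
  then have "has_bochner_integral lborel (\<lambda>x. exp x *\<^sub>R ?f (exp x)) (Gamma z)"
    by (subst (asm) has_bochner_integral_range_subst[where g=exp and g'=exp])
       (auto intro!: derivative_eq_intros continuous_intros simp: image_iff, metis exp_ln)
  also have "(\<lambda>x. exp x *\<^sub>R ?f (exp x)) = (\<lambda>x::real. exp (z * x - exp x))"
    by (auto simp: powr_def scaleR_conv_of_real exp_of_real[symmetric] exp_diff exp_add[symmetric]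
          field_simps simp del: exp_of_real intro!: ext)
  finally have 1: "has_bochner_integral lborel (\<lambda>x::real. exp (z * x - exp x)) (Gamma z)" .
  define h where "h = (\<lambda>x::real. exp (z * of_real x - of_real (exp x)))"
  have "has_bochner_integral lborel h (Gamma z)" using 1 by (simp add: h_def exp_of_real)
  then have "has_bochner_integral lborel (\<lambda>x. h (x + ln A)) (Gamma z)"
    unfolding has_bochner_integral_shift .
  from has_bochner_integral_mult_right[OF this, of "exp (- z * of_real (ln A))"]
  have "has_bochner_integral lborel (\<lambda>x. exp (- z * of_real (ln A)) * h (x + ln A)) (exp (- z * of_real (ln A)) * Gamma z)"
    by simp
  also have "(\<lambda>x. exp (- z * of_real (ln A)) * h (x + ln A)) = (\<lambda>x::real. exp (z * of_real x - of_real (A * exp x)))"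
    unfolding exp_add[symmetric] h_def using A
    by (intro ext arg_cong[where f=exp]) (simp add: exp_add algebra_simps exp_of_real)
  finally show ?thesis by (simp add: mult.commute)
qed

lemma has_bochner_integral_of_real_iff:
  "has_bochner_integral M (\<lambda>x. complex_of_real (f x)) (of_real I) \<longleftrightarrow> has_bochner_integral M f I"
  by (simp add: has_bochner_integral_iff complex_of_real_integrable_eq)

lemma Gamma_exp_integral_norm:
  fixes z :: complex and A :: real
  assumes z: "Re z > 0" and A: "A > 0"
  shows "has_bochner_integral lborel (\<lambda>x::real. norm (exp (z * of_real x - of_real (A * exp x)))) (Gamma (Re z) * exp (- Re z * ln A))"
proof -
  have "has_bochner_integral lborel (\<lambda>x::real. complex_of_real (exp (Re z * x - A * exp x)))
     (of_real (Gamma (Re z) * exp (- Re z * ln A)))"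
    using Gamma_exp_integral[of "of_real (Re z)" A] assms
    by (simp add: Gamma_complex_of_real exp_of_real[symmetric])
  then show ?thesis unfolding has_bochner_integral_of_real_iff by (simp add: norm_exp_eq_Re) 
qed

lemma Gamma_nonzero_Re_pos: "Gamma z \<noteq> 0" if "Re z > 0" for z :: complex
  using that by (intro Gamma_nonzero) (auto elim!: nonpos_Ints_cases)

text \<open>The same double integral is computed in both orders.\<close>

lemma Beta_exp_integral:
  fixes b c :: complex
  assumes "Re b > 0" "Re c > 0"
  shows "has_bochner_integral lborel (\<lambda>t::real. exp (b * of_real t - (b + c) * of_real (ln (1 + exp t))))
    (Gamma b * Gamma c / Gamma (b + c))"
proof -
  \<comment> \<open>This is the integrand of \<open>Gamma b * Gamma c\<close> in the variables
    \<open>exp (t + y)\<close> and \<open>exp y\<close>. With \<open>t\<close> innermost it yields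
    that product; with \<open>y\<close> innermost it yields \<open>Gamma (b + c)\<close> times the
    Beta integrand.\<close>
  define f :: "real \<times> real \<Rightarrow> complex" where "f = (\<lambda>(t, y). exp (b * of_real t + (b + c) * of_real y - of_real (exp y * (1 + exp t))))"
  have [measurable]: "f \<in> borel_measurable (borel \<Otimes>\<^sub>M borel)" unfolding f_def by measurable
  have "has_bochner_integral (lborel \<Otimes>\<^sub>M lborel) f (Gamma b * Gamma c)"
  proof (rule has_bochner_integral_pair_swap[OF sigma_finite_lborel sigma_finite_lborel], rule has_bochner_integral_pair[OF sigma_finite_lborel sigma_finite_lborel,
        where F="\<lambda>y::real. Gamma b * exp (c * of_real y - of_real (exp y))" and N="\<lambda>y::real. norm (Gamma (Re b)) * norm (exp (c * of_real y - of_real (exp y)))"])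
    fix y :: real
    have eq: "f (t, y) = exp ((b + c) * of_real y - of_real (exp y)) * exp (b * of_real t - of_real (exp y * exp t))" for t
      unfolding f_def prod.case exp_add[symmetric] by (rule arg_cong[where f=exp]) (simp add: algebra_simps exp_add)
    have nn: "norm (exp ((b + c) * of_real y - of_real (exp y))) * (Gamma (Re b) * exp (- Re b * ln (exp y))) =
        norm (Gamma (Re b)) * norm (exp (c * of_real y - of_real (exp y)))"
      using assms Gamma_real_pos[of "Re b"]
      by (simp add: norm_exp_eq_Re mult.left_commute[of _ "Gamma (Re b)"] mult_exp_exp algebra_simps)
    have cc: "exp ((b + c) * of_real y - of_real (exp y)) * (Gamma b * exp (- b * of_real (ln (exp y)))) = Gamma b * exp (c * of_real y - of_real (exp y))"
      by (simp add: mult.left_commute[of _ "Gamma b"] mult_exp_exp algebra_simps)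
    show "has_bochner_integral lborel (\<lambda>t. case (y, t) of (y, x) \<Rightarrow> f (x, y)) (Gamma b * exp (c * of_real y - of_real (exp y)))"
      using has_bochner_integral_mult_right[OF Gamma_exp_integral[OF assms(1), of "exp y"], of "exp ((b + c) * of_real y - of_real (exp y))"]
      unfolding prod.case eq cc[symmetric] by simp
    show "has_bochner_integral lborel (\<lambda>t. norm (case (y, t) of (y, x) \<Rightarrow> f (x, y))) (norm (Gamma (Re b)) * norm (exp (c * of_real y - of_real (exp y))))"
      using has_bochner_integral_mult_right[OF Gamma_exp_integral_norm[OF assms(1), of "exp y"], of "norm (exp ((b + c) * of_real y - of_real (exp y)))"]
      unfolding prod.case eq norm_mult nn[symmetric] by simp
  next
    show "integrable lborel (\<lambda>y::real. norm (Gamma (Re b)) * norm (exp (c * of_real y - of_real (exp y))))"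
      using Gamma_exp_integral_norm[OF assms(2), of 1]
      by (intro integrable_mult_right) (simp add: has_bochner_integral_iff exp_of_real)
    show "has_bochner_integral lborel (\<lambda>y::real. Gamma b * exp (c * of_real y - of_real (exp y))) (Gamma b * Gamma c)"
      using Gamma_exp_integral[OF assms(2), of 1]
      by (intro has_bochner_integral_mult_right) (simp add: exp_of_real)
  qed auto
  then have "has_bochner_integral lborel (\<lambda>t::real. Gamma (b + c) * exp (b * of_real t - (b + c) * of_real (ln (1 + exp t)))) (Gamma b * Gamma c)"
  proof (rule has_bochner_integral_fst[OF sigma_finite_lborel sigma_finite_lborel])
    fix t :: real
    have pos: "1 + exp t > 0" by (simp add: add_pos_pos)
    have eq: "f (t, y) = exp (b * of_real t) * exp ((b + c) * of_real y - of_real ((1 + exp t) * exp y))" for y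
      unfolding f_def prod.case exp_add[symmetric] by (rule arg_cong[where f=exp]) (simp add: algebra_simps)
    have "has_bochner_integral lborel (\<lambda>y. f (t, y)) (exp (b * of_real t) * (Gamma (b + c) * exp (- (b + c) * of_real (ln (1 + exp t)))))"
      unfolding eq using assms by (intro has_bochner_integral_mult_right Gamma_exp_integral pos) auto
    then show "(\<integral>y. f (t, y) \<partial>lborel) = Gamma (b + c) * exp (b * of_real t - (b + c) * of_real (ln (1 + exp t)))"
      by (simp add: has_bochner_integral_iff mult.left_commute[of _ "Gamma (b + c)"] mult_exp_exp algebra_simps)
  qed
  note I = this
  have "Gamma (b + c) \<noteq> 0"
    using assms by (intro Gamma_nonzero_Re_pos) simp
  then have eq: "inverse (Gamma (b + c)) * (Gamma (b + c) * x) = x" for x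
    by (simp add: mult.assoc[symmetric])
  show ?thesis
    using has_bochner_integral_mult_right[OF I, of "inverse (Gamma (b + c))"]
    unfolding eq by (simp add: divide_inverse mult.commute)
qed

text \<open>For fixed \<open>y\<close> the map is a translation, so Tonelli reduces invariance of
  the plane measure to that of the line. In logarithmic coordinates it passes from the pair
  \<open>exp x\<close>, \<open>exp y\<close> to the ratio \<open>exp t\<close> and
  \<open>exp y\<close>.\<close>

lemma has_bochner_integral_shear:
  fixes f :: "real \<times> real \<Rightarrow> 'a::{banach, second_countable_topology}"
  assumes f[measurable]: "f \<in> borel_measurable (borel \<Otimes>\<^sub>M borel)"
  shows "has_bochner_integral (lborel \<Otimes>\<^sub>M lborel) (\<lambda>(t, y). f (t + y, y)) I \<longleftrightarrow>
    has_bochner_integral (lborel \<Otimes>\<^sub>M lborel) f I"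
proof -
  have m: "(\<lambda>(t, y). (t + y, y)) \<in> (lborel \<Otimes>\<^sub>M lborel :: (real \<times> real) measure) \<rightarrow>\<^sub>M (lborel \<Otimes>\<^sub>M lborel)"
    by measurable
  have "distr (lborel \<Otimes>\<^sub>M lborel) (lborel \<Otimes>\<^sub>M lborel) (\<lambda>(t, y). (t + y, y)) = (lborel \<Otimes>\<^sub>M lborel :: (real \<times> real) measure)"
  proof (rule measure_eqI)
    fix A :: "(real \<times> real) set"
    assume "A \<in> sets (distr (lborel \<Otimes>\<^sub>M lborel) (lborel \<Otimes>\<^sub>M lborel) (\<lambda>(t, y). (t + y, y)))"
    then have A: "A \<in> sets (lborel \<Otimes>\<^sub>M lborel)" by simp
    have A'[measurable]: "A \<in> sets (borel \<Otimes>\<^sub>M borel)" using A sets_lborel by (simp cong: sets_pair_measure_cong)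
    have "emeasure (distr (lborel \<Otimes>\<^sub>M lborel) (lborel \<Otimes>\<^sub>M lborel) (\<lambda>(t, y). (t + y, y))) A
       = (\<integral>\<^sup>+p. indicator A p \<partial>distr (lborel \<Otimes>\<^sub>M lborel) (lborel \<Otimes>\<^sub>M lborel) (\<lambda>(t, y). (t + y, y)))"
      by (rule nn_integral_indicator[symmetric]) simp
    also have "\<dots> = (\<integral>\<^sup>+p. indicator A (case p of (t, y) \<Rightarrow> (t + y, y)) \<partial>(lborel \<Otimes>\<^sub>M lborel))"
      by (rule nn_integral_distr[OF m]) simp
    also have "\<dots> = (\<integral>\<^sup>+y. \<integral>\<^sup>+t. indicator A (t + y, y) \<partial>lborel \<partial>lborel)"
      using lborel_pair.nn_integral_snd[OF measurable_compose[OF m borel_measurable_indicator[OF A]]]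
      by (simp only: prod.case)
    also have "\<dots> = (\<integral>\<^sup>+y. \<integral>\<^sup>+t. indicator A (t, y) \<partial>lborel \<partial>lborel)"
    proof (rule nn_integral_cong)
      fix y :: real
      show "(\<integral>\<^sup>+t. indicator A (t + y, y) \<partial>lborel) = (\<integral>\<^sup>+t. indicator A (t, y) \<partial>lborel)"
        using nn_integral_real_affine[of "\<lambda>t. indicator A (t, y)" 1 y]
        by (simp add: add.commute)
    qed
    also have "\<dots> = (\<integral>\<^sup>+p. indicator A p \<partial>(lborel \<Otimes>\<^sub>M lborel))"
      by (rule lborel_pair.nn_integral_snd[OF borel_measurable_indicator[OF A]])
    finally show "emeasure (distr (lborel \<Otimes>\<^sub>M lborel) (lborel \<Otimes>\<^sub>M lborel) (\<lambda>(t, y). (t + y, y))) A = emeasure (lborel \<Otimes>\<^sub>M lborel) A"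
      by (simp only: nn_integral_indicator[OF A])
  qed simp
  note eq = this
  have f': "f \<in> borel_measurable (lborel \<Otimes>\<^sub>M lborel)" by simp
  have "integrable (lborel \<Otimes>\<^sub>M lborel) f \<longleftrightarrow> integrable (lborel \<Otimes>\<^sub>M lborel) (\<lambda>(t, y). f (t + y, y))"
    using integrable_distr_eq[OF m f'] unfolding eq by (simp add: case_prod_beta')
  moreover have "integral\<^sup>L (lborel \<Otimes>\<^sub>M lborel) f = integral\<^sup>L (lborel \<Otimes>\<^sub>M lborel) (\<lambda>(t, y). f (t + y, y))"
    using integral_distr[OF m f'] unfolding eq by (simp add: case_prod_beta')
  ultimately show ?thesis by (simp add: has_bochner_integral_iff)
qed

lemma Beta_exp_integral_norm:
  fixes b c :: complex
  assumes "Re b > 0" "Re c > 0"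
  shows "integrable lborel (\<lambda>t::real. norm (exp (b * of_real t - (b + c) * of_real (ln (1 + exp t)))))"
  using Beta_exp_integral[OF assms] by (intro integrable_norm) (auto simp: has_bochner_integral_iff)

text \<open>With \<open>x = t + y\<close> the sum \<open>exp x + exp y\<close> becomes
  \<open>(1 + exp t) * exp y\<close>, so the integral over \<open>y\<close> is a Gamma integral and
  what it leaves in \<open>t\<close> is a Beta integral.\<close>

lemma two_variable_Gamma_integral:
  fixes b c d :: complex
  assumes b: "Re b > 0" and c: "Re c > 0" and d: "Re (b + c + d) > 0"
  shows "has_bochner_integral (lborel \<Otimes>\<^sub>M lborel)
    (\<lambda>(x::real, y::real). exp (b * of_real x + c * of_real y + d * of_real (ln (exp x + exp y)) - of_real (exp x + exp y)))
    (Gamma b * Gamma c * Gamma (b + c + d) / Gamma (b + c))"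
    (is "has_bochner_integral _ (\<lambda>(x, y). ?f x y) _")
proof -
  have eq: "?f (t + y) y = exp (b * of_real t + d * of_real (ln (1 + exp t))) *
      exp ((b + c + d) * of_real y - of_real ((1 + exp t) * exp y))" for t y :: real
  proof -
    have "exp (t + y) + exp y = (1 + exp t) * exp y" by (simp add: exp_add algebra_simps)
    moreover have "ln ((1 + exp t) * exp y) = ln (1 + exp t) + y"
      using exp_gt_zero[of t] by (subst ln_mult) (auto simp: add_eq_0_iff simp del: exp_gt_zero)
    ultimately show ?thesis unfolding mult_exp_exp
      by (intro arg_cong[where f=exp]) (simp add: algebra_simps)
  qed
  have pos: "1 + exp t > 0" for t :: real by (simp add: add_pos_pos)
  have "has_bochner_integral (lborel \<Otimes>\<^sub>M lborel) (\<lambda>(t, y). ?f (t + y) y)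
      (Gamma (b + c + d) * (Gamma b * Gamma c / Gamma (b + c)))"
  proof (rule has_bochner_integral_pair[OF sigma_finite_lborel sigma_finite_lborel, where
      F="\<lambda>t. Gamma (b + c + d) * exp (b * of_real t - (b + c) * of_real (ln (1 + exp t)))" and
      N="\<lambda>t. Gamma (Re (b + c + d)) * norm (exp (b * of_real t - (b + c) * of_real (ln (1 + exp t))))"])
    fix t :: real
    show "has_bochner_integral lborel (\<lambda>y. case (t, y) of (t, y) \<Rightarrow> ?f (t + y) y)
        (Gamma (b + c + d) * exp (b * of_real t - (b + c) * of_real (ln (1 + exp t))))"
    proof -
      have "Gamma (b + c + d) * exp (b * of_real t - (b + c) * of_real (ln (1 + exp t))) =
        exp (b * of_real t + d * of_real (ln (1 + exp t))) *
        (Gamma (b + c + d) * exp (- (b + c + d) * of_real (ln (1 + exp t))))"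
        by (simp add: mult.left_commute[of _ "Gamma (b + c + d)"] mult_exp_exp algebra_simps)
      then show ?thesis unfolding prod.case eq
        by (simp only:) (intro has_bochner_integral_mult_right Gamma_exp_integral pos d)
    qed
    show "has_bochner_integral lborel (\<lambda>y. norm (case (t, y) of (t, y) \<Rightarrow> ?f (t + y) y))
        (Gamma (Re (b + c + d)) * norm (exp (b * of_real t - (b + c) * of_real (ln (1 + exp t)))))"
    proof -
      have "Gamma (Re (b + c + d)) * norm (exp (b * of_real t - (b + c) * of_real (ln (1 + exp t)))) =
        norm (exp (b * of_real t + d * of_real (ln (1 + exp t)))) *
        (Gamma (Re (b + c + d)) * exp (- Re (b + c + d) * ln (1 + exp t)))"
        by (simp add: norm_exp_eq_Re mult.left_commute[of _ "Gamma (Re b + Re c + Re d)"] mult_exp_exp algebra_simps)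
      then show ?thesis unfolding prod.case eq norm_mult
        by (simp only:) (intro has_bochner_integral_mult_right Gamma_exp_integral_norm pos d)
    qed
  next
    show "integrable lborel (\<lambda>t. Gamma (Re (b + c + d)) * norm (exp (b * of_real t - (b + c) * of_real (ln (1 + exp t)))))"
      by (intro integrable_mult_right Beta_exp_integral_norm b c)
    show "has_bochner_integral lborel (\<lambda>t. Gamma (b + c + d) * exp (b * of_real t - (b + c) * of_real (ln (1 + exp t))))
       (Gamma (b + c + d) * (Gamma b * Gamma c / Gamma (b + c)))"
      by (intro has_bochner_integral_mult_right Beta_exp_integral b c)
  qed simp
  then show ?thesis
    using has_bochner_integral_shear[of "\<lambda>(x, y). ?f x y" "Gamma b * Gamma c * Gamma (b + c + d) / Gamma (b + c)"]
    by (simp add: mult.commute)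
qed

section \<open>Gaussian moments and the integral behind the period\<close>

lemma gaussian_integral:
  assumes "A > 0"
  shows "has_bochner_integral lborel (\<lambda>x::real. exp (- A * (x + m)\<^sup>2)) (sqrt pi * exp (- ln A / 2))"
proof -
  have "has_bochner_integral lborel (\<lambda>x. exp (- x\<^sup>2)) (sqrt pi)"
    using has_bochner_integral_even_function[OF gaussian_moment_0] by simp
  then have "has_bochner_integral lborel (\<lambda>x. exp (- (sqrt A * m + sqrt A * x)\<^sup>2)) (sqrt pi /\<^sub>R sqrt A)"
    using assms by (subst (asm) lborel_has_bochner_integral_real_affine_iff[of "sqrt A" _ _ "sqrt A * m"]) auto
  also have "(\<lambda>x. exp (- (sqrt A * m + sqrt A * x)\<^sup>2)) = (\<lambda>x. exp (- A * (x + m)\<^sup>2))"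
    using assms by (auto simp: power_mult_distrib distrib_left[symmetric] add.commute)
  also have "sqrt pi /\<^sub>R sqrt A = sqrt pi * exp (- ln A / 2)"
    using assms by (simp add: exp_minus ln_sqrt[symmetric] field_simps)
  finally show ?thesis .
qed

lemma exp_half_ln: "A > 0 \<Longrightarrow> exp (ln A / 2) = sqrt A"
  by (simp add: ln_sqrt[symmetric])

text \<open>By evenness this is twice the integral over the half line, where
  \<open>r = exp (x / 2)\<close> turns \<open>r\<^sup>2\<close> into \<open>exp x\<close> and the
  Gaussian into the Gamma integrand.\<close>

lemma abs_moment_gaussian:
  fixes a :: complex
  assumes a: "Re a > -1" and A: "A > 0"
  shows "has_bochner_integral lborel (\<lambda>r::real. of_real \<bar>r\<bar> powr a * of_real (exp (- A * r\<^sup>2)))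
     (Gamma ((a + 1) / 2) * exp (- ((a + 1) / 2) * of_real (ln A)))"
proof -
  let ?f = "\<lambda>r::real. of_real \<bar>r\<bar> powr a * of_real (exp (- A * r\<^sup>2)) :: complex"
  let ?I = "Gamma ((a + 1) / 2) * exp (- ((a + 1) / 2) * of_real (ln A))"
  have m[measurable]: "?f \<in> borel_measurable borel" by measurable
  have der: "((\<lambda>x::real. exp (x / 2)) has_real_derivative exp (x / 2) / 2) (at x)" for x :: real
    by (auto intro!: derivative_eq_intros)
  have rg: "range (\<lambda>x::real. exp (x / 2)) = {0<..}"
  proof safe
    fix x :: real assume "0 < x"
    then have "x = exp (2 * ln x / 2)" by simp
    then show "x \<in> range (\<lambda>x. exp (x / 2))" by blast
  qed simp
  have "has_bochner_integral lborel (\<lambda>x::real. 1/2 * exp ((a + 1) / 2 * of_real x - of_real (A * exp x))) (1/2 * ?I)"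
    using a A by (intro has_bochner_integral_mult_right Gamma_exp_integral) auto
  also have "(\<lambda>x::real. 1/2 * exp ((a + 1) / 2 * of_real x - of_real (A * exp x))) =
      (\<lambda>x. (exp (x / 2) / 2) *\<^sub>R ?f (exp (x / 2)))"
  proof
    fix x :: real
    have "(exp (x / 2))\<^sup>2 = exp x" by (simp add: power2_eq_square mult_exp_exp)
    moreover have "complex_of_real \<bar>exp (x / 2)\<bar> powr a = exp (a * of_real (x / 2))"
      by (simp add: powr_def Ln_of_real del: of_real_divide)
    moreover have "(exp t / 2) *\<^sub>R (P * of_real (exp w)) = 1/2 * (exp (of_real t) * (P * exp (of_real w)))"
      for t w and P :: complex
      by (simp add: scaleR_conv_of_real exp_of_real)
    ultimately have "(exp (x / 2) / 2) *\<^sub>R ?f (exp (x / 2)) =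
        1/2 * (exp (of_real (x / 2)) * (exp (a * of_real (x / 2)) * exp (of_real (- A * exp x))))"
      by (simp only:)
    then show "1/2 * exp ((a + 1) / 2 * of_real x - of_real (A * exp x)) = (exp (x / 2) / 2) *\<^sub>R ?f (exp (x / 2))"
      unfolding mult_exp_exp by (simp add: algebra_simps add_divide_distrib)
  qed
  finally have "has_bochner_integral lborel (\<lambda>x. indicator {0<..} x *\<^sub>R ?f x) (1/2 * ?I)"
    by (subst has_bochner_integral_range_subst[OF der _ _ rg _ m])
      (auto intro!: continuous_intros simp del: of_real_mult of_real_minus)
  also have "?this \<longleftrightarrow> has_bochner_integral lborel (\<lambda>x. indicator {0..} x *\<^sub>R ?f x) (1/2 * ?I)"
    by (rule has_bochner_integral_discrete_difference[where X="{0}"]) (auto simp: indicator_def)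
  finally have "has_bochner_integral lborel ?f (2 *\<^sub>R (1/2 * ?I))"
    by (rule has_bochner_integral_even_function) simp
  then show ?thesis by (simp add: scaleR_conv_of_real)
qed

text \<open>In the variables \<open>r = p - q\<close> and \<open>q\<close> the factor
  \<open>\<bar>p - q\<bar> powr a\<close> depends on \<open>r\<close> alone. Completing the square
  in \<open>q\<close> splits off a Gaussian integral and leaves a one-dimensional absolute
  moment.\<close>

lemma planar_gaussian_moment:
  fixes a :: complex
  assumes a: "Re a > -1" and X: "X > 0" and Y: "Y > 0"
  shows "has_bochner_integral (lborel \<Otimes>\<^sub>M lborel)
     (\<lambda>(p::real, q::real). of_real \<bar>p - q\<bar> powr a * of_real (exp (- X * p\<^sup>2 - Y * q\<^sup>2)))
     (sqrt pi * Gamma ((a + 1) / 2) * exp (- ((a + 1) / 2) * of_real (ln X + ln Y) + a / 2 * of_real (ln (X + Y))))"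
    (is "has_bochner_integral _ (\<lambda>(p, q). ?f p q) ?I")
proof -
  \<comment> \<open>The minimum over \<open>q\<close> of
    \<open>X * (r + q)\<^sup>2 + Y * q\<^sup>2\<close> is \<open>B * r\<^sup>2\<close>.\<close>
  define B where "B = X * Y / (X + Y)"
  define S where "S = sqrt pi * exp (- ln (X + Y) / 2)"
  have B: "B > 0" and XY: "X + Y > 0" using X Y by (auto simp: B_def)
  have lnB: "ln B = ln X + ln Y - ln (X + Y)"
    using X Y by (simp add: B_def ln_div ln_mult)
  have eq: "?f (r + q) q = (of_real \<bar>r\<bar> powr a * of_real (exp (- B * r\<^sup>2))) *
      of_real (exp (- (X + Y) * (q + X * r / (X + Y))\<^sup>2))" for r q
  proof -
    have "(X + Y) * (X * r / (X + Y)) = X * r" "B * r = Y * (X * r / (X + Y))"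
      using XY by (simp_all add: B_def)
    then have "- X * (r + q)\<^sup>2 - Y * q\<^sup>2 = (- B * r\<^sup>2) + (- (X + Y) * (q + X * r / (X + Y))\<^sup>2)"
      by algebra
    then show ?thesis by (simp only: exp_add) simp
  qed
  have I: "?I = (Gamma ((a + 1) / 2) * exp (- ((a + 1) / 2) * of_real (ln B))) * of_real S"
  proof -
    have "exp (- ((a + 1) / 2) * of_real (ln X + ln Y) + a / 2 * of_real (ln (X + Y))) =
       exp (- ((a + 1) / 2) * of_real (ln B)) * of_real (exp (- ln (X + Y) / 2))"
      unfolding lnB exp_of_real[symmetric] mult_exp_exp by (intro arg_cong[where f=exp]) (simp add: field_simps)
    then show ?thesis by (simp only: S_def of_real_mult ac_simps)
  qed
  have "has_bochner_integral (lborel \<Otimes>\<^sub>M lborel) (\<lambda>(r, q). ?f (r + q) q) ?I"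
  proof (rule has_bochner_integral_pair[OF sigma_finite_lborel sigma_finite_lborel, where
      F="\<lambda>r. (of_real \<bar>r\<bar> powr a * of_real (exp (- B * r\<^sup>2))) * of_real S" and
      N="\<lambda>r. norm (of_real \<bar>r\<bar> powr a * of_real (exp (- B * r\<^sup>2)) :: complex) * S"])
    fix r :: real
    note g = gaussian_integral[OF XY, of "X * r / (X + Y)", folded S_def]
    show "has_bochner_integral lborel (\<lambda>q. case (r, q) of (r, q) \<Rightarrow> ?f (r + q) q)
        ((of_real \<bar>r\<bar> powr a * of_real (exp (- B * r\<^sup>2))) * of_real S)"
      unfolding prod.case eq
      by (intro has_bochner_integral_mult_right) (use g in \<open>simp add: has_bochner_integral_of_real_iff\<close>)
    show "has_bochner_integral lborel (\<lambda>q. norm (case (r, q) of (r, q) \<Rightarrow> ?f (r + q) q))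
        (norm (of_real \<bar>r\<bar> powr a * of_real (exp (- B * r\<^sup>2)) :: complex) * S)"
      unfolding prod.case eq norm_mult[of "_ * _" "of_real _"]
      by (intro has_bochner_integral_mult_right) (use g in simp)
  next
    show "integrable lborel (\<lambda>r. norm (of_real \<bar>r\<bar> powr a * of_real (exp (- B * r\<^sup>2)) :: complex) * S)"
      using abs_moment_gaussian[OF a B]
      by (intro integrable_mult_left integrable_norm) (simp add: has_bochner_integral_iff)
    show "has_bochner_integral lborel (\<lambda>r. (of_real \<bar>r\<bar> powr a * of_real (exp (- B * r\<^sup>2))) * of_real S) ?I"
      unfolding I by (intro has_bochner_integral_mult_left abs_moment_gaussian a B)
  qed measurable
  then show ?thesis
    using has_bochner_integral_shear[of "\<lambda>(p, q). ?f p q" ?I] by simp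
qed

lemma planar_gaussian_moment_norm:
  fixes a :: complex
  assumes a: "Re a > -1" and X: "X > 0" and Y: "Y > 0"
  shows "has_bochner_integral (lborel \<Otimes>\<^sub>M lborel)
     (\<lambda>(p::real, q::real). norm (of_real \<bar>p - q\<bar> powr a * of_real (exp (- X * p\<^sup>2 - Y * q\<^sup>2)) :: complex))
     (sqrt pi * Gamma ((Re a + 1) / 2) * exp (- ((Re a + 1) / 2) * (ln X + ln Y) + Re a / 2 * ln (X + Y)))"
proof -
  have n: "complex_of_real (norm (of_real \<bar>p - q\<bar> powr a * of_real (exp (- X * p\<^sup>2 - Y * q\<^sup>2)) :: complex)) =
     of_real \<bar>p - q\<bar> powr (of_real (Re a)) * of_real (exp (- X * p\<^sup>2 - Y * q\<^sup>2))" for p q :: real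
    by (simp add: norm_mult norm_powr_real_powr powr_of_real)
  have G: "Gamma ((complex_of_real (Re a) + 1) / 2) = of_real (Gamma ((Re a + 1) / 2))"
    using Gamma_complex_of_real[of "(Re a + 1) / 2"] by simp
  have "has_bochner_integral (lborel \<Otimes>\<^sub>M lborel)
     (\<lambda>p. complex_of_real (case p of (p::real, q::real) \<Rightarrow> norm (of_real \<bar>p - q\<bar> powr a * of_real (exp (- X * p\<^sup>2 - Y * q\<^sup>2)) :: complex)))
     (of_real (sqrt pi * Gamma ((Re a + 1) / 2) * exp (- ((Re a + 1) / 2) * (ln X + ln Y) + Re a / 2 * ln (X + Y))))"
    using planar_gaussian_moment[of "of_real (Re a)" X Y] assms
    unfolding case_prod_beta n G
    by (simp add: case_prod_beta flip: exp_of_real)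
  then show ?thesis unfolding has_bochner_integral_of_real_iff .
qed

text \<open>Writing both powers as Gamma integrals turns the integral over \<open>(p, q)\<close> into a planar Gaussian moment.\<close>

lemma triple_product_integral:
  fixes a u v :: complex
  assumes a: "Re a > -1" and b: "Re (u - (a + 1) / 2) > 0" and c: "Re (v - (a + 1) / 2) > 0"
    and d: "Re (u + v - 1 - a / 2) > 0" and u: "Re u > 0" and v: "Re v > 0"
  shows "has_bochner_integral (lborel \<Otimes>\<^sub>M lborel)
     (\<lambda>(p::real, q::real). of_real \<bar>p - q\<bar> powr a * (exp (- u * of_real (ln (1 + p\<^sup>2))) * exp (- v * of_real (ln (1 + q\<^sup>2)))))
     (sqrt pi * Gamma ((a + 1) / 2) * Gamma (u - (a + 1) / 2) * Gamma (v - (a + 1) / 2) * Gamma (u + v - 1 - a / 2) /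
      (Gamma (u + v - a - 1) * Gamma u * Gamma v))"
proof -
  define f :: "(real \<times> real) \<times> (real \<times> real) \<Rightarrow> complex" where
    "f = (\<lambda>((p, q), (x, y)). of_real \<bar>p - q\<bar> powr a *
       (exp (u * of_real x - of_real ((1 + p\<^sup>2) * exp x)) * exp (v * of_real y - of_real ((1 + q\<^sup>2) * exp y))))"
  let ?L = "lborel \<Otimes>\<^sub>M lborel :: (real \<times> real) measure"
  \<comment> \<open>What remains in the Gamma variables \<open>x\<close>, \<open>y\<close> after the
    Gaussian integral over \<open>(p, q)\<close> with weights \<open>X = exp x\<close> and
    \<open>Y = exp y\<close>: the product \<open>X * Y\<close> lowers both exponents by
    \<open>(a + 1) / 2\<close>, and \<open>X + Y\<close> enters with exponent
    \<open>a / 2\<close>.\<close>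
  define H where "H = (\<lambda>(x::real, y::real). exp ((u - (a + 1) / 2) * of_real x + (v - (a + 1) / 2) * of_real y + a / 2 * of_real (ln (exp x + exp y)) - of_real (exp x + exp y)))"
  define I where "I = Gamma (u - (a + 1) / 2) * Gamma (v - (a + 1) / 2) * Gamma (u + v - 1 - a / 2) / Gamma (u + v - a - 1)"
  have sf: "sigma_finite_measure ?L" by (rule lborel_pair.sigma_finite_measure_axioms)
  have H: "has_bochner_integral ?L H I"
  proof -
    have e1: "u - (a + 1) / 2 + (v - (a + 1) / 2) = u + v - a - 1" by (simp add: field_simps)
    have e2: "u + v - a - 1 + a / 2 = u + v - 1 - a / 2" by (simp add: field_simps)
    show ?thesis unfolding H_def I_def
      by (rule two_variable_Gamma_integral[OF b c, of "a / 2", unfolded e1 e2, OF d])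
  qed
  have f[measurable]: "f \<in> borel_measurable (?L \<Otimes>\<^sub>M ?L)" unfolding f_def case_prod_beta by measurable
  have "has_bochner_integral (?L \<Otimes>\<^sub>M ?L) f (sqrt pi * Gamma ((a + 1) / 2) * I)"
  proof (rule has_bochner_integral_pair_swap[OF sf sf], rule has_bochner_integral_pair[OF sf sf, where
       F="\<lambda>z. sqrt pi * Gamma ((a + 1) / 2) * H z" and N="\<lambda>z. sqrt pi * Gamma ((Re a + 1) / 2) * norm (H z)"])
    fix z :: "real \<times> real"
    obtain x y where z: "z = (x, y)" by (cases z)
    define C where "C = exp (u * of_real x + v * of_real y - of_real (exp x + exp y))"
    have eq: "f (w, z) = C * (case w of (p, q) \<Rightarrow> of_real \<bar>p - q\<bar> powr a * of_real (exp (- exp x * p\<^sup>2 - exp y * q\<^sup>2)))" for w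
    proof -
      obtain p q where w: "w = (p, q)" by (cases w)
      have "exp (u * of_real x - of_real ((1 + p\<^sup>2) * exp x)) * exp (v * of_real y - of_real ((1 + q\<^sup>2) * exp y))
          = C * of_real (exp (- exp x * p\<^sup>2 - exp y * q\<^sup>2))"
        unfolding C_def exp_of_real[symmetric] mult_exp_exp by (intro arg_cong[where f=exp]) (simp add: algebra_simps)
      then show ?thesis by (simp only: w z f_def prod.case ac_simps)
    qed
    have HC: "H z = C * exp (- ((a + 1) / 2) * of_real (ln (exp x) + ln (exp y)) + a / 2 * of_real (ln (exp x + exp y)))"
      unfolding H_def z C_def prod.case mult_exp_exp by (intro arg_cong[where f=exp]) (simp add: field_simps)
    then have nHC: "norm (H z) = norm C * exp (- ((Re a + 1) / 2) * (ln (exp x) + ln (exp y)) + Re a / 2 * ln (exp x + exp y))"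
      by (simp add: norm_mult)
    show "has_bochner_integral ?L (\<lambda>w. case (z, w) of (y, x) \<Rightarrow> f (x, y)) (sqrt pi * Gamma ((a + 1) / 2) * H z)"
      unfolding prod.case eq HC
      using has_bochner_integral_mult_right[OF planar_gaussian_moment[OF a exp_gt_zero exp_gt_zero, of x y], of C]
      by (simp only: ac_simps)
    show "has_bochner_integral ?L (\<lambda>w. norm (case (z, w) of (y, x) \<Rightarrow> f (x, y))) (sqrt pi * Gamma ((Re a + 1) / 2) * norm (H z))"
      unfolding prod.case eq nHC norm_mult[of C]
      using has_bochner_integral_mult_right[OF planar_gaussian_moment_norm[OF a exp_gt_zero exp_gt_zero, of x y], of "norm C"]
      by (simp only: ac_simps case_prod_beta)
  next
    show "integrable ?L (\<lambda>z. sqrt pi * Gamma ((Re a + 1) / 2) * norm (H z))"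
      using H by (intro integrable_mult_right integrable_norm) (simp add: has_bochner_integral_iff)
    show "has_bochner_integral ?L (\<lambda>z. sqrt pi * Gamma ((a + 1) / 2) * H z) (sqrt pi * Gamma ((a + 1) / 2) * I)"
      by (intro has_bochner_integral_mult_right H)
  qed measurable
  then have *: "has_bochner_integral ?L
      (\<lambda>w. (Gamma u * Gamma v) * (case w of (p, q) \<Rightarrow> of_real \<bar>p - q\<bar> powr a * (exp (- u * of_real (ln (1 + p\<^sup>2))) * exp (- v * of_real (ln (1 + q\<^sup>2))))))
      (sqrt pi * Gamma ((a + 1) / 2) * I)"
  proof (rule has_bochner_integral_fst[OF sf sf])
    fix w :: "real \<times> real"
    obtain p q where w: "w = (p, q)" by (cases w)
    have pos: "1 + p\<^sup>2 > 0" "1 + q\<^sup>2 > 0" by (simp_all add: add_pos_nonneg)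
    have "f (w, z) = of_real \<bar>p - q\<bar> powr a * (case z of (x, y) \<Rightarrow>
       exp (u * of_real x - of_real ((1 + p\<^sup>2) * exp x)) * exp (v * of_real y - of_real ((1 + q\<^sup>2) * exp y)))" for z
      by (cases z) (simp add: f_def w)
    moreover have "has_bochner_integral ?L (\<lambda>z. of_real \<bar>p - q\<bar> powr a * (case z of (x, y) \<Rightarrow>
       exp (u * of_real x - of_real ((1 + p\<^sup>2) * exp x)) * exp (v * of_real y - of_real ((1 + q\<^sup>2) * exp y))))
       (of_real \<bar>p - q\<bar> powr a * ((Gamma u * exp (- u * of_real (ln (1 + p\<^sup>2)))) * (Gamma v * exp (- v * of_real (ln (1 + q\<^sup>2))))))"
      by (intro has_bochner_integral_mult_right has_bochner_integral_pair_mult sigma_finite_lborel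
            Gamma_exp_integral u v pos)
    ultimately show "(\<integral>z. f (w, z) \<partial>?L) = (Gamma u * Gamma v) * (case w of (p, q) \<Rightarrow> of_real \<bar>p - q\<bar> powr a * (exp (- u * of_real (ln (1 + p\<^sup>2))) * exp (- v * of_real (ln (1 + q\<^sup>2)))))"
      by (simp only: has_bochner_integral_iff w prod.case) (simp only: ac_simps)
  qed
  have nz: "Gamma u \<noteq> 0" "Gamma v \<noteq> 0" using u v by (auto simp: Gamma_nonzero_Re_pos)
  then have eq: "inverse (Gamma u * Gamma v) * (Gamma u * Gamma v * x) = x" for x
    by (simp add: field_simps)
  have aux: "inverse (x * y) * (s * g * (k * l * m / n)) = s * g * k * l * m / (n * x * y)"
    for x y s g k l m n :: complex by (simp add: field_simps)
  have val: "inverse (Gamma u * Gamma v) * (sqrt pi * Gamma ((a + 1) / 2) * I) =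
    sqrt pi * Gamma ((a + 1) / 2) * Gamma (u - (a + 1) / 2) * Gamma (v - (a + 1) / 2) * Gamma (u + v - 1 - a / 2) /
      (Gamma (u + v - a - 1) * Gamma u * Gamma v)"
    unfolding I_def by (rule aux)
  show ?thesis
    using has_bochner_integral_mult_right[OF *, of "inverse (Gamma u * Gamma v)"]
    unfolding eq val .
qed

section \<open>Whittaker functions as Bessel integrals\<close>

text \<open>The characteristic function of the standard normal distribution, rescaled by
  \<open>sqrt (2 * A)\<close>.\<close>

lemma gaussian_fourier:
  assumes A: "A > 0"
  shows "has_bochner_integral lborel (\<lambda>t::real. of_real (exp (- A * t\<^sup>2)) * exp (\<i> * of_real (c * t)))
     (of_real (sqrt pi * exp (- ln A / 2) * exp (- c\<^sup>2 / (4 * A))))"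
proof -
  let ?f = "\<lambda>t::real. of_real (exp (- A * t\<^sup>2)) * exp (\<i> * of_real (c * t)) :: complex"
  let ?s = "sqrt (2 * A)"
  have s: "?s > 0" using A by simp
  have norm: "norm (?f t) = exp (- A * t\<^sup>2)" for t by (simp add: norm_mult)
  have int: "integrable lborel ?f"
  proof (rule integrable_norm_cancel)
    show "integrable lborel (\<lambda>t. norm (?f t))" unfolding norm
      using gaussian_integral[OF A, of 0] by (simp add: has_bochner_integral_iff)
  qed measurable
  have sd: "std_normal_density (?s * t) = exp (- A * t\<^sup>2) / sqrt (2 * pi)" for t
    using A by (simp add: std_normal_density_def power_mult_distrib)
  have "complex_of_real (exp (- ((c / ?s)\<^sup>2) / 2)) = char std_normal_distribution (c / ?s)"
    by (simp add: char_std_normal_distribution)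
  also have "\<dots> = (\<integral>x. std_normal_density x *\<^sub>R iexp (c / ?s * x) \<partial>lborel)"
    unfolding char_def by (subst integral_density) auto
  also have "\<dots> = ?s *\<^sub>R (\<integral>t. std_normal_density (?s * t) *\<^sub>R iexp (c / ?s * (?s * t)) \<partial>lborel)"
    using s by (subst lborel_integral_real_affine[of ?s _ 0]) (auto simp del: real_sqrt_mult)
  also have "(\<lambda>t. std_normal_density (?s * t) *\<^sub>R iexp (c / ?s * (?s * t))) = (\<lambda>t. (1 / sqrt (2 * pi)) *\<^sub>R ?f t)"
    unfolding sd using s by (auto simp: scaleR_conv_of_real simp del: real_sqrt_mult)
  also have "(\<integral>t. (1 / sqrt (2 * pi)) *\<^sub>R ?f t \<partial>lborel) = (1 / sqrt (2 * pi)) *\<^sub>R integral\<^sup>L lborel ?f"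
    by simp
  finally have "complex_of_real (exp (- c\<^sup>2 / (4 * A))) = (?s / sqrt (2 * pi)) *\<^sub>R integral\<^sup>L lborel ?f"
    using A by (simp add: power_divide)
  moreover have "?s / sqrt (2 * pi) = 1 / (sqrt pi * exp (- ln A / 2))"
    using A by (simp add: real_sqrt_mult exp_minus exp_half_ln field_simps)
  ultimately have "complex_of_real (exp (- c\<^sup>2 / (4 * A))) = integral\<^sup>L lborel ?f / of_real (sqrt pi * exp (- ln A / 2))"
    by (simp only: scaleR_conv_of_real of_real_divide) simp
  then have "integral\<^sup>L lborel ?f = of_real (sqrt pi * exp (- ln A / 2) * exp (- c\<^sup>2 / (4 * A)))"
    by (simp add: field_simps)
  with int show ?thesis by (simp add: has_bochner_integral_iff)
qed

section \<open>The Bessel integral as an entire function of its order\<close>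

text \<open>A weight with all exponential moments has an entire two-sided Laplace transform:
  expanding \<open>exp (z * x)\<close> and integrating term by term exhibits the transform as a
  power series that converges everywhere.\<close>

lemma holomorphic_exp_transform:
  fixes w :: "real \<Rightarrow> real" and z :: complex
  assumes w[measurable]: "w \<in> borel_measurable borel" and nn: "\<And>x. w x \<ge> 0"
    and int: "\<And>r. integrable lborel (\<lambda>x. exp (r * x) * w x)"
  shows "(\<lambda>z. LBINT x. exp (z * of_real x) * of_real (w x)) holomorphic_on UNIV"
    and "integrable lborel (\<lambda>x. exp (z * of_real x) * of_real (w x))"
proof -
  \<comment> \<open>The norms of the terms of the series sum to
    \<open>exp (norm z * \<bar>x\<bar>) * w x\<close>. This is the majorant for the interchange,
    itself dominated by the sum of the moments for \<open>r\<close> and \<open>- r\<close>.\<close>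
  have intabs: "integrable lborel (\<lambda>x. exp (r * \<bar>x\<bar>) * w x)" for r
  proof (rule Bochner_Integration.integrable_bound)
    show "integrable lborel (\<lambda>x. exp (r * x) * w x + exp (- r * x) * w x)" by (intro Bochner_Integration.integrable_add int)
    show "AE x in lborel. norm (exp (r * \<bar>x\<bar>) * w x) \<le> norm (exp (r * x) * w x + exp (- r * x) * w x)"
    proof (rule AE_I2)
      fix x
      have "0 \<le> exp (r * x) * w x" "0 \<le> exp (- r * x) * w x" using nn by simp_all
      then show "norm (exp (r * \<bar>x\<bar>) * w x) \<le> norm (exp (r * x) * w x + exp (- r * x) * w x)"
        by (auto simp: abs_if)
    qed
  qed measurable
  define f where "f = (\<lambda>z n x. (z * of_real x) ^ n / fact n * of_real (w x) :: complex)"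
  define C where "C = (\<lambda>n. LBINT x. complex_of_real (x ^ n * w x / fact n))"
  have normf: "norm (f z n x) = (norm z * \<bar>x\<bar>) ^ n / fact n * w x" for z n x
    using nn by (simp add: f_def norm_mult norm_divide norm_power)
  have nsums: "(\<lambda>n. norm (f z n x)) sums (exp (norm z * \<bar>x\<bar>) * w x)" for z x
    unfolding normf using exp_converges[of "norm z * \<bar>x\<bar>"]
    by (intro sums_mult2) (simp add: divide_inverse mult.commute)
  have fsums: "(\<lambda>n. f z n x) sums (exp (z * of_real x) * of_real (w x))" for z x
    unfolding f_def using exp_converges[of "z * of_real x"]
    by (intro sums_mult2) (simp add: scaleR_conv_of_real divide_inverse mult.commute)
  have intf: "integrable lborel (f z n)" for z n
  proof (rule Bochner_Integration.integrable_bound[OF intabs[of "norm z"]])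
    show "AE x in lborel. norm (f z n x) \<le> norm (exp (norm z * \<bar>x\<bar>) * w x)"
    proof (rule AE_I2)
      fix x
      have "norm (f z n x) \<le> exp (norm z * \<bar>x\<bar>) * w x"
        using sum_le_suminf[of "\<lambda>n. norm (f z n x)" "{n}"] nsums[of z x] by (simp add: sums_iff)
      then show "norm (f z n x) \<le> norm (exp (norm z * \<bar>x\<bar>) * w x)" using nn by simp
    qed
  qed (unfold f_def, measurable)
  have sums: "(\<lambda>n. integral\<^sup>L lborel (f z n)) sums (LBINT x. \<Sum>n. f z n x)" for z
  proof (rule sums_integral)
    show "AE x in lborel. summable (\<lambda>i. norm (f z i x))" using nsums by (auto simp: sums_iff)
    show "summable (\<lambda>i. LBINT x. norm (f z i x))"
    proof (rule summableI_nonneg_bounded)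
      fix n
      have "(\<Sum>i<n. LBINT x. norm (f z i x)) = (LBINT x. \<Sum>i<n. norm (f z i x))"
        using intf by (subst Bochner_Integration.integral_sum) auto
      also have "\<dots> \<le> (LBINT x. exp (norm z * \<bar>x\<bar>) * w x)"
      proof (rule integral_mono)
        show "(\<Sum>i<n. norm (f z i x)) \<le> exp (norm z * \<bar>x\<bar>) * w x" for x
          using sum_le_suminf[of "\<lambda>n. norm (f z n x)" "{..<n}"] nsums[of z x] by (simp add: sums_iff)
      qed (use intf intabs in auto)
      finally show "(\<Sum>i<n. LBINT x. norm (f z i x)) \<le> (LBINT x. exp (norm z * \<bar>x\<bar>) * w x)" .
    qed simp
  qed (rule intf)
  have fC: "integral\<^sup>L lborel (f z n) = C n * z ^ n" for z n
  proof -
    have "f z n = (\<lambda>x. complex_of_real (x ^ n * w x / fact n) * z ^ n)"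
      by (auto simp: f_def power_mult_distrib)
    then show ?thesis by (simp only: C_def integral_mult_left_zero)
  qed
  have eq: "(\<Sum>n. f z n x) = exp (z * of_real x) * of_real (w x)" for z x
    using fsums[of z x] by (simp add: sums_iff)
  have *: "(\<lambda>n. C n * z ^ n) sums (LBINT x. exp (z * of_real x) * of_real (w x))" for z
    using sums[of z] unfolding fC eq .
  have summ: "summable (\<lambda>n. C n * z ^ n)" for z using * by (auto simp: sums_iff)
  have **: "(LBINT x. exp (z * of_real x) * of_real (w x)) = (\<Sum>n. C n * z ^ n)" for z
    using * by (simp add: sums_iff)
  show "(\<lambda>z. LBINT x. exp (z * of_real x) * of_real (w x)) holomorphic_on UNIV"
    unfolding ** using termdiffs_strong_converges_everywhere[of C] summ
    by (auto simp: holomorphic_on_def field_differentiable_def)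
  show "integrable lborel (\<lambda>x. exp (z * of_real x) * of_real (w x))"
  proof (rule Bochner_Integration.integrable_bound[OF int[of "Re z"]])
    show "AE x in lborel. norm (exp (z * of_real x) * of_real (w x)) \<le> norm (exp (Re z * x) * w x)"
      by (simp add: norm_mult)
  qed measurable
qed

text \<open>For \<open>r > 0\<close> the factor with \<open>exp (- x)\<close> is at most 1 and a
  Gamma integral remains; \<open>r < 0\<close> follows by reflection, and \<open>r = 0\<close> from
  \<open>1 \<le> exp x + exp (- x)\<close>.\<close>

lemma integrable_exp_two_sided:
  fixes A B r :: real
  assumes "A > 0" "B > 0"
  shows "integrable lborel (\<lambda>x. exp (r * x) * exp (- A * exp x - B * exp (- x)))"
proof -
  have pos: "integrable lborel (\<lambda>x. exp (r * x) * exp (- A * exp x))" if "r > 0" "A > 0" for r A :: real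
  proof -
    have "integrable lborel (\<lambda>x::real. norm (exp (of_real r * of_real x - of_real (A * exp x) :: complex)))"
      using Gamma_exp_integral_norm[of "of_real r" A] that by (simp add: has_bochner_integral_iff)
    then show ?thesis by (simp add: exp_add[symmetric])
  qed
  have 1: "integrable lborel (\<lambda>x. exp (r * x) * exp (- A * exp x - B * exp (- x)))"
    if "r > 0" "A > 0" "B > 0" for r A B :: real
  proof (rule Bochner_Integration.integrable_bound[OF pos[OF that(1,2)]])
    show "AE x in lborel. norm (exp (r * x) * exp (- A * exp x - B * exp (- x))) \<le> norm (exp (r * x) * exp (- A * exp x))"
      using that by (intro AE_I2) auto
  qed measurable
  have 2: "integrable lborel (\<lambda>x. exp (r * x) * exp (- A * exp x - B * exp (- x)))"
    if "r < 0" "A > 0" "B > 0" for r A B :: real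
    using 1[of "- r" B A] that
    by (subst lborel_integrable_real_affine_iff[of "-1" _ 0, symmetric]) (auto simp: algebra_simps minus_diff_commute)
  show ?thesis
  proof (cases r "0 :: real" rule: linorder_cases)
    case equal
    have "integrable lborel (\<lambda>x. exp (1 * x) * exp (- A * exp x - B * exp (- x)) + exp (- 1 * x) * exp (- A * exp x - B * exp (- x)))"
      by (intro Bochner_Integration.integrable_add 1 2) (use assms in auto)
    then show ?thesis
    proof (rule Bochner_Integration.integrable_bound)
      have "1 \<le> exp x + exp (- x)" for x :: real
        by (cases "x \<ge> 0") (auto intro: add_increasing add_increasing2)
      then show "AE x in lborel. norm (exp (r * x) * exp (- A * exp x - B * exp (- x))) \<le>
         norm (exp (1 * x) * exp (- A * exp x - B * exp (- x)) + exp (- 1 * x) * exp (- A * exp x - B * exp (- x)))"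
        by (intro AE_I2) (simp add: equal distrib_right[symmetric] mult_le_cancel_right1)
    qed measurable
  qed (use 1 2 assms in auto)
qed

text \<open>In classical notation this is 2 y^(-z) K_z(2 pi y), with K the modified Bessel function.
  The form that is not symmetric under \<open>x \<mapsto> - x\<close> is the one that the Gaussian
  Fourier transform produces, and it saves carrying the power of \<open>y\<close> along.\<close>

definition bessel_integral :: "real \<Rightarrow> complex \<Rightarrow> complex" where
  "bessel_integral y z = (LBINT x. exp (z * of_real x) * of_real (exp (- (pi * y\<^sup>2) * exp x - pi * exp (- x))))"

lemma bessel_integral_holomorphic:
  assumes "y > 0" shows "bessel_integral y holomorphic_on UNIV"
  unfolding bessel_integral_def[abs_def]
  by (intro holomorphic_exp_transform integrable_exp_two_sided) (use assms in auto)

lemma has_bochner_integral_bessel: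
  assumes "y > 0"
  shows "has_bochner_integral lborel (\<lambda>x. exp (z * of_real x) * of_real (exp (- (pi * y\<^sup>2) * exp x - pi * exp (- x)))) (bessel_integral y z)"
  unfolding bessel_integral_def has_bochner_integral_iff
  by (intro conjI refl holomorphic_exp_transform(2) integrable_exp_two_sided) (use assms in auto)

text \<open>Writing \<open>(y\<^sup>2 + t\<^sup>2) powr -z\<close> as a Gamma integral makes the integral over \<open>t\<close> a Gaussian one.\<close>

lemma whittaker_fourier_integral:
  assumes y: "y > 0" and z: "Re z > 1/2" and e: "e = 1 \<or> e = (-1::real)"
  shows "(LBINT t. exp (- z * of_real (ln (pi * (y\<^sup>2 + t\<^sup>2)))) * exp (\<i> * of_real (2 * pi * e * t))) =
     rGamma z * bessel_integral y (z - 1/2)"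
proof -
  define f :: "real \<times> real \<Rightarrow> complex" where
    "f = (\<lambda>(t, x). exp (\<i> * of_real (2 * pi * e * t)) * exp (z * of_real x - of_real (pi * (y\<^sup>2 + t\<^sup>2) * exp x)))"
  let ?E = "\<lambda>x. exp (z * of_real x - of_real ((pi * y\<^sup>2) * exp x))"
  \<comment> \<open>Only the square of the frequency survives the Gaussian Fourier transform, so a
    character and its conjugate give the same Bessel integral.\<close>
  have e2: "e\<^sup>2 = 1" using e by auto
  have f[measurable]: "f \<in> borel_measurable (lborel \<Otimes>\<^sub>M lborel)" unfolding f_def case_prod_beta by measurable
  have "has_bochner_integral (lborel \<Otimes>\<^sub>M lborel) f (bessel_integral y (z - 1/2))"
  proof (rule has_bochner_integral_pair_swap[OF sigma_finite_lborel sigma_finite_lborel],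
      rule has_bochner_integral_pair[OF sigma_finite_lborel sigma_finite_lborel, where
        F="\<lambda>x. exp ((z - 1/2) * of_real x) * of_real (exp (- (pi * y\<^sup>2) * exp x - pi * exp (- x)))" and
        N="\<lambda>x. norm (exp ((z - 1/2) * of_real x - of_real ((pi * y\<^sup>2) * exp x)))"])
    fix x :: real
    have A: "pi * exp x > 0" by simp
    have lnA: "sqrt pi * exp (- ln (pi * exp x) / 2) = exp (- x / 2)"
    proof -
      have "exp (- ln (pi * exp x) / 2) = exp (- (ln pi / 2)) * exp (- x / 2)"
        unfolding mult_exp_exp by (intro arg_cong[where f=exp]) (simp add: ln_mult field_simps)
      then show ?thesis by (simp add: exp_minus exp_half_ln)
    qed
    have cA: "- (2 * pi * e)\<^sup>2 / (4 * (pi * exp x)) = - pi * exp (- x)"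
      using e2 by (simp add: power_mult_distrib exp_minus field_simps power2_eq_square)
    have eq: "f (t, x) = ?E x * (of_real (exp (- (pi * exp x) * t\<^sup>2)) * exp (\<i> * of_real ((2 * pi * e) * t)))" for t
    proof -
      have "exp (z * of_real x - of_real (pi * (y\<^sup>2 + t\<^sup>2) * exp x)) = ?E x * of_real (exp (- (pi * exp x) * t\<^sup>2))"
        unfolding exp_of_real[symmetric] mult_exp_exp by (intro arg_cong[where f=exp]) (simp add: algebra_simps)
      then show ?thesis by (simp only: f_def prod.case ac_simps)
    qed
    have v: "exp ((z - 1/2) * of_real x) * of_real (exp (- (pi * y\<^sup>2) * exp x - pi * exp (- x))) =
       ?E x * of_real (exp (- x / 2) * exp (- pi * exp (- x)))"
      unfolding mult_exp_exp exp_of_real[symmetric] by (intro arg_cong[where f=exp]) (simp add: algebra_simps)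
    have v': "norm (exp ((z - 1/2) * of_real x - of_real ((pi * y\<^sup>2) * exp x))) = norm (?E x) * exp (- x / 2)"
      by (simp add: mult_exp_exp algebra_simps)
    show "has_bochner_integral lborel (\<lambda>t. case (x, t) of (y, x) \<Rightarrow> f (x, y))
        (exp ((z - 1/2) * of_real x) * of_real (exp (- (pi * y\<^sup>2) * exp x - pi * exp (- x))))"
      unfolding prod.case eq v
      using gaussian_fourier[OF A, of "2 * pi * e"] unfolding lnA cA
      by (intro has_bochner_integral_mult_right)
    have n: "norm (f (t, x)) = norm (?E x) * exp (- (pi * exp x) * t\<^sup>2)" for t
      unfolding eq norm_mult by (simp add: norm_mult)
    show "has_bochner_integral lborel (\<lambda>t. norm (case (x, t) of (y, x) \<Rightarrow> f (x, y)))
        (norm (exp ((z - 1/2) * of_real x - of_real ((pi * y\<^sup>2) * exp x))))"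
      unfolding prod.case n v'
      using gaussian_integral[OF A, of 0] unfolding lnA by (intro has_bochner_integral_mult_right) simp
  next
    show "integrable lborel (\<lambda>x. norm (exp ((z - 1/2) * of_real x - of_real ((pi * y\<^sup>2) * exp x))))"
      using Gamma_exp_integral_norm[of "z - 1/2" "pi * y\<^sup>2"] y z by (simp only: has_bochner_integral_iff) simp
    show "has_bochner_integral lborel (\<lambda>x. exp ((z - 1/2) * of_real x) * of_real (exp (- (pi * y\<^sup>2) * exp x - pi * exp (- x)))) (bessel_integral y (z - 1/2))"
      by (rule has_bochner_integral_bessel[OF y])
  qed measurable
  then have "has_bochner_integral lborel (\<lambda>t. Gamma z * (exp (- z * of_real (ln (pi * (y\<^sup>2 + t\<^sup>2)))) * exp (\<i> * of_real (2 * pi * e * t)))) (bessel_integral y (z - 1/2))"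
  proof (rule has_bochner_integral_fst[OF sigma_finite_lborel sigma_finite_lborel])
    fix t :: real
    have pos: "pi * (y\<^sup>2 + t\<^sup>2) > 0" using y by (simp add: add_pos_nonneg)
    have "has_bochner_integral lborel (\<lambda>x. f (t, x)) (exp (\<i> * of_real (2 * pi * e * t)) * (Gamma z * exp (- z * of_real (ln (pi * (y\<^sup>2 + t\<^sup>2))))))"
      unfolding f_def prod.case using z by (intro has_bochner_integral_mult_right Gamma_exp_integral pos) simp
    then show "(LBINT x. f (t, x)) = Gamma z * (exp (- z * of_real (ln (pi * (y\<^sup>2 + t\<^sup>2)))) * exp (\<i> * of_real (2 * pi * e * t)))"
      by (simp only: has_bochner_integral_iff ac_simps)
  qed
  then have "Gamma z * (LBINT t. exp (- z * of_real (ln (pi * (y\<^sup>2 + t\<^sup>2)))) * exp (\<i> * of_real (2 * pi * e * t))) = bessel_integral y (z - 1/2)"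
    unfolding has_bochner_integral_iff integral_mult_right_zero by blast
  moreover have "Gamma z \<noteq> 0" using z by (intro Gamma_nonzero_Re_pos) simp
  ultimately show ?thesis unfolding rGamma_inverse_Gamma by (simp add: field_simps)
qed

section \<open>Mellin transform of a product of two Bessel integrals\<close>

text \<open>The Beta integral with parameters \<open>(s + k) / 2\<close> and
  \<open>(s - k) / 2\<close>, made symmetric by
  \<open>1 + exp t = exp (t / 2) * (2 * cosh (t / 2))\<close>.\<close>

lemma has_bochner_integral_cosh_powr:
  fixes s k :: complex
  assumes "Re (s + k) > 0" "Re (s - k) > 0"
  shows "has_bochner_integral lborel (\<lambda>t::real. exp (k / 2 * of_real t - s * of_real (ln (2 * cosh (t / 2)))))
    (Gamma ((s + k) / 2) * Gamma ((s - k) / 2) / Gamma s)"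
proof -
  have "has_bochner_integral lborel (\<lambda>t::real. exp ((s + k) / 2 * of_real t - ((s + k) / 2 + (s - k) / 2) * of_real (ln (1 + exp t))))
    (Gamma ((s + k) / 2) * Gamma ((s - k) / 2) / Gamma ((s + k) / 2 + (s - k) / 2))"
    using assms by (intro Beta_exp_integral) auto
  also have "(s + k) / 2 + (s - k) / 2 = s" by (simp add: field_simps)
  also have "(\<lambda>t::real. exp ((s + k) / 2 * of_real t - s * of_real (ln (1 + exp t)))) =
     (\<lambda>t::real. exp (k / 2 * of_real t - s * of_real (ln (2 * cosh (t / 2)))))"
  proof
    fix t :: real
    have "1 + exp t = exp (t / 2) * (2 * cosh (t / 2))"
      by (simp add: cosh_def distrib_left mult_exp_exp)
    then have l: "ln (1 + exp t) = t / 2 + ln (2 * cosh (t / 2))"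
      by (simp only: ln_mult) (simp add: ln_mult)
    show "exp ((s + k) / 2 * of_real t - s * of_real (ln (1 + exp t))) =
      exp (k / 2 * of_real t - s * of_real (ln (2 * cosh (t / 2))))"
      unfolding l by (intro arg_cong[where f=exp]) (simp add: field_simps)
  qed
  finally show ?thesis .
qed

lemma has_bochner_integral_cosh_powr':
  fixes s k :: complex
  assumes "Re (s + k) > 0" "Re (s - k) > 0"
  shows "has_bochner_integral lborel (\<lambda>t::real. exp (k * of_real t - s * of_real (ln (2 * cosh t))))
    (1 / 2 * (Gamma ((s + k) / 2) * Gamma ((s - k) / 2) / Gamma s))"
proof -
  have "has_bochner_integral lborel (\<lambda>t::real. exp (k / 2 * of_real (0 + 2 * t) - s * of_real (ln (2 * cosh ((0 + 2 * t) / 2)))))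
    ((Gamma ((s + k) / 2) * Gamma ((s - k) / 2) / Gamma s) /\<^sub>R \<bar>2\<bar>)"
    by (subst lborel_has_bochner_integral_real_affine_iff[symmetric])
      (use has_bochner_integral_cosh_powr[OF assms] in auto)
  then show ?thesis by (simp add: scaleR_conv_of_real)
qed

text \<open>With \<open>x = t + y\<close> the addition theorem gives
  \<open>cosh x + cosh y = 2 * cosh (y + t / 2) * cosh (t / 2)\<close>. After a translation in
  \<open>y\<close> the integral is a product of two one-dimensional ones, with combined parameters
  \<open>m + n\<close> and \<open>m - n\<close>; each contributes two Gamma factors and one
  \<open>Gamma s\<close> below.\<close>

lemma cosh_sum_integral:
  fixes s m n :: complex
  assumes "Re (s + m + n) > 0" "Re (s - m - n) > 0" "Re (s + m - n) > 0" "Re (s - m + n) > 0"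
  shows "has_bochner_integral (lborel \<Otimes>\<^sub>M lborel)
     (\<lambda>(x::real, y::real). exp (m * of_real x + n * of_real y - s * of_real (ln (2 * pi * (cosh x + cosh y)))))
     (exp (- s * of_real (ln pi)) / 2 * (Gamma ((s + m + n) / 2) * Gamma ((s - m - n) / 2) *
        Gamma ((s + m - n) / 2) * Gamma ((s - m + n) / 2)) / (Gamma s)\<^sup>2)"
    (is "has_bochner_integral _ (\<lambda>(x, y). ?f x y) ?I")
proof -
  define P where "P = (\<lambda>y::real. exp ((m + n) * of_real y - s * of_real (ln (2 * cosh y))))"
  define Q where "Q = (\<lambda>t::real. exp ((m - n) / 2 * of_real t - s * of_real (ln (2 * cosh (t / 2)))))"
  define p where "p = 1 / 2 * (Gamma ((s + (m + n)) / 2) * Gamma ((s - (m + n)) / 2) / Gamma s)"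
  define q where "q = Gamma ((s + (m - n)) / 2) * Gamma ((s - (m - n)) / 2) / Gamma s"
  define c where "c = exp (- s * of_real (ln pi))"
  have P: "has_bochner_integral lborel P p"
    unfolding P_def p_def by (rule has_bochner_integral_cosh_powr') (use assms in auto)
  have Q: "has_bochner_integral lborel Q q"
    unfolding Q_def q_def by (rule has_bochner_integral_cosh_powr) (use assms in auto)
  have nP: "has_bochner_integral lborel (\<lambda>x. norm (P x)) (LBINT x. norm (P x))"
    and nQ: "integrable lborel (\<lambda>x. norm (Q x))"
    using P Q by (auto simp: has_bochner_integral_iff)
  have eq: "?f (t + y) y = c * Q t * P (y + t / 2)" for t y :: real
  proof -
    have "cosh (t + y) + cosh y = 2 * cosh (y + t / 2) * cosh (t / 2)"
    proof -
      have "t + y = (y + t / 2) + t / 2" "y = (y + t / 2) - t / 2" by auto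
      then have "cosh (t + y) + cosh y = cosh ((y + t / 2) + t / 2) + cosh ((y + t / 2) - t / 2)" by metis
      then show ?thesis by (simp only: cosh_add cosh_diff)
    qed
    then have e: "2 * pi * (cosh (t + y) + cosh y) = pi * (2 * cosh (y + t / 2)) * (2 * cosh (t / 2))" by simp
    have lm: "ln (pi * a * b) = ln pi + ln a + ln b" if "a > 0" "b > 0" for a b
      using that by (simp add: ln_mult)
    have l: "ln (2 * pi * (cosh (t + y) + cosh y)) = ln pi + ln (2 * cosh (y + t / 2)) + ln (2 * cosh (t / 2))"
      unfolding e by (rule lm) simp_all
    show ?thesis unfolding P_def Q_def c_def mult_exp_exp l
      by (intro arg_cong[where f=exp]) (simp add: field_simps)
  qed
  have "has_bochner_integral (lborel \<Otimes>\<^sub>M lborel) (\<lambda>(t, y). ?f (t + y) y) (c * q * p)"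
  proof (rule has_bochner_integral_pair[OF sigma_finite_lborel sigma_finite_lborel, where
      F="\<lambda>t. c * Q t * p" and N="\<lambda>t. norm c * norm (Q t) * (LBINT x. norm (P x))"])
    fix t :: real
    show "has_bochner_integral lborel (\<lambda>y. case (t, y) of (t, y) \<Rightarrow> ?f (t + y) y) (c * Q t * p)"
      unfolding prod.case eq using P
      by (intro has_bochner_integral_mult_right) (simp add: has_bochner_integral_shift)
    show "has_bochner_integral lborel (\<lambda>y. norm (case (t, y) of (t, y) \<Rightarrow> ?f (t + y) y)) (norm c * norm (Q t) * (LBINT x. norm (P x)))"
      unfolding prod.case eq norm_mult using nP
      by (intro has_bochner_integral_mult_right) (simp add: has_bochner_integral_shift[of "\<lambda>x. norm (P x)"])
  next
    show "integrable lborel (\<lambda>t. norm c * norm (Q t) * (LBINT x. norm (P x)))"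
      by (intro integrable_mult_left integrable_mult_right nQ)
    show "has_bochner_integral lborel (\<lambda>t. c * Q t * p) (c * q * p)"
      by (intro has_bochner_integral_mult_left has_bochner_integral_mult_right Q)
  qed (simp add: cosh_def)
  moreover have "c * q * p = ?I"
    by (simp add: c_def p_def q_def power2_eq_square field_simps)
  ultimately show ?thesis
    using has_bochner_integral_shear[of "\<lambda>(x, y). ?f x y" ?I] by (simp add: cosh_def)
qed

text \<open>Inserting both Bessel integrals and integrating over the Mellin variable first gives
  \<open>Gamma s\<close> times a power of \<open>cosh x + cosh y\<close>. This
  \<open>Gamma s\<close> cancels one of the two in the denominator of
  \<open>cosh_sum_integral\<close>.\<close>

lemma bessel_product_mellin:
  fixes s m n :: complex
  assumes cond: "Re (s + m + n) > 0" "Re (s - m - n) > 0" "Re (s + m - n) > 0" "Re (s - m + n) > 0"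
  shows "(LINT y : {0<..} | lborel. bessel_integral y m * bessel_integral y n * exp ((s + m + n - 1) * of_real (ln y))) =
     exp (- s * of_real (ln pi)) / 2 * (Gamma ((s + m + n) / 2) * Gamma ((s - m - n) / 2) *
        Gamma ((s + m - n) / 2) * Gamma ((s - m + n) / 2)) / Gamma s"
    (is "?lhs = ?I")
proof -
  let ?L = "lborel \<Otimes>\<^sub>M lborel :: (real \<times> real) measure"
  have sf: "sigma_finite_measure ?L" by (rule lborel_pair.sigma_finite_measure_axioms)
  have s: "Re s > 0" using cond by simp
  \<comment> \<open>The outer variable is the logarithm \<open>u\<close> of the Mellin variable, and
    both Bessel integrals are in symmetric form. Symmetrizing multiplies them by
    \<open>exp (m * u)\<close> and \<open>exp (n * u)\<close>, which explains the exponent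
    \<open>s + m + n - 1\<close> in the statement.\<close>
  define f :: "real \<times> (real \<times> real) \<Rightarrow> complex" where
    "f = (\<lambda>(u, (x, y)). exp (s * of_real u) *
       (exp (m * of_real x - of_real (pi * exp u * (exp x + exp (- x)))) *
        exp (n * of_real y - of_real (pi * exp u * (exp y + exp (- y))))))"
  define H where "H = (\<lambda>(x::real, y::real). exp (m * of_real x + n * of_real y - s * of_real (ln (2 * pi * (cosh x + cosh y)))))"
  define I where "I = exp (- s * of_real (ln pi)) / 2 * (Gamma ((s + m + n) / 2) * Gamma ((s - m - n) / 2) *
        Gamma ((s + m - n) / 2) * Gamma ((s - m + n) / 2)) / (Gamma s)\<^sup>2"
  have H: "has_bochner_integral ?L H I" unfolding H_def I_def by (rule cosh_sum_integral[OF cond])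
  have f[measurable]: "f \<in> borel_measurable (lborel \<Otimes>\<^sub>M ?L)" unfolding f_def case_prod_beta by measurable
  have "has_bochner_integral (lborel \<Otimes>\<^sub>M ?L) f (Gamma s * I)"
  proof (rule has_bochner_integral_pair_swap[OF sigma_finite_lborel sf],
      rule has_bochner_integral_pair[OF sf sigma_finite_lborel, where
        F="\<lambda>w. Gamma s * H w" and N="\<lambda>w. Gamma (Re s) * norm (H w)"])
    fix w :: "real \<times> real"
    obtain x y where w: "w = (x, y)" by (cases w)
    let ?A = "2 * pi * (cosh x + cosh y)" and ?E = "exp (m * of_real x + n * of_real y)"
    have A: "?A > 0" by (simp add: add_pos_pos)
    have c2: "exp t + exp (- t) = 2 * cosh t" for t :: real by (simp add: cosh_def)
    have eq: "f (u, w) = ?E * exp (s * of_real u - of_real (?A * exp u))" for u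
      unfolding f_def w prod.case mult_exp_exp c2 by (intro arg_cong[where f=exp]) (simp add: algebra_simps)
    have Hw: "H w = ?E * exp (- s * of_real (ln ?A))"
      unfolding H_def w prod.case mult_exp_exp by (intro arg_cong[where f=exp]) simp
    have nHw: "norm (H w) = norm ?E * exp (- Re s * ln ?A)"
      unfolding Hw norm_mult by simp
    show "has_bochner_integral lborel (\<lambda>u. case (w, u) of (y, x) \<Rightarrow> f (x, y)) (Gamma s * H w)"
      unfolding prod.case eq Hw mult.left_commute[of "Gamma s"]
      by (intro has_bochner_integral_mult_right Gamma_exp_integral s A)
    show "has_bochner_integral lborel (\<lambda>u. norm (case (w, u) of (y, x) \<Rightarrow> f (x, y))) (Gamma (Re s) * norm (H w))"
      unfolding prod.case eq norm_mult nHw mult.left_commute[of "Gamma (Re s)"]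
      by (intro has_bochner_integral_mult_right Gamma_exp_integral_norm s A)
  next
    show "integrable ?L (\<lambda>w. Gamma (Re s) * norm (H w))"
      using H by (intro integrable_mult_right integrable_norm) (simp add: has_bochner_integral_iff)
    show "has_bochner_integral ?L (\<lambda>w. Gamma s * H w) (Gamma s * I)"
      by (intro has_bochner_integral_mult_right H)
  qed measurable
  then have *: "has_bochner_integral lborel (\<lambda>u. exp (s * of_real u) *
      ((exp (m * of_real u) * bessel_integral (exp u) m) * (exp (n * of_real u) * bessel_integral (exp u) n))) (Gamma s * I)"
  proof (rule has_bochner_integral_fst[OF sigma_finite_lborel sf])
    fix u :: real
    have B: "has_bochner_integral lborel (\<lambda>x. exp (k * of_real x - of_real (pi * exp u * (exp x + exp (- x)))))
        (exp (k * of_real u) * bessel_integral (exp u) k)" for k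
    proof -
      define h where "h = (\<lambda>x. exp (k * of_real x) * of_real (exp (- (pi * (exp u)\<^sup>2) * exp x - pi * exp (- x))))"
      have "has_bochner_integral lborel h (bessel_integral (exp u) k)"
        unfolding h_def by (rule has_bochner_integral_bessel) simp
      \<comment> \<open>Translating by \<open>u\<close> balances the coefficients
        \<open>pi * (exp u)\<^sup>2\<close> and \<open>pi\<close> of the two exponentials: both
        become \<open>pi * exp u\<close>.\<close>
      then have "has_bochner_integral lborel (\<lambda>x. h (x + - u)) (bessel_integral (exp u) k)"
        unfolding has_bochner_integral_shift .
      then have "has_bochner_integral lborel (\<lambda>x. exp (k * of_real u) * h (x + - u)) (exp (k * of_real u) * bessel_integral (exp u) k)"
        by (rule has_bochner_integral_mult_right)
      moreover have "exp (k * of_real u) * h (x + - u) = exp (k * of_real x - of_real (pi * exp u * (exp x + exp (- x))))" for x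
      proof -
        have e: "(exp u)\<^sup>2 * exp (x + - u) = exp u * exp x" "exp (- (x + - u)) = exp u * exp (- x)"
          by (simp_all add: power2_eq_square mult_exp_exp)
        have "- (pi * (exp u)\<^sup>2) * exp (x + - u) - pi * exp (- (x + - u)) = - (pi * exp u * (exp x + exp (- x)))"
          using e by algebra
        then have h: "h (x + - u) = exp (k * of_real (x + - u)) * of_real (exp (- (pi * exp u * (exp x + exp (- x)))))"
          unfolding h_def by (simp only:)
        show ?thesis unfolding h exp_of_real[symmetric] mult_exp_exp
          by (intro arg_cong[where f=exp]) (simp add: algebra_simps)
      qed
      ultimately show ?thesis by simp
    qed
    have "f (u, w) = exp (s * of_real u) * (case w of (x, y) \<Rightarrow> exp (m * of_real x - of_real (pi * exp u * (exp x + exp (- x)))) *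
        exp (n * of_real y - of_real (pi * exp u * (exp y + exp (- y)))))" for w
      by (cases w) (simp add: f_def)
    moreover have "has_bochner_integral ?L (\<lambda>w. exp (s * of_real u) * (case w of (x, y) \<Rightarrow> exp (m * of_real x - of_real (pi * exp u * (exp x + exp (- x)))) *
        exp (n * of_real y - of_real (pi * exp u * (exp y + exp (- y))))))
        (exp (s * of_real u) * ((exp (m * of_real u) * bessel_integral (exp u) m) * (exp (n * of_real u) * bessel_integral (exp u) n)))"
      by (intro has_bochner_integral_mult_right has_bochner_integral_pair_mult sigma_finite_lborel B)
    ultimately show "(\<integral>w. f (u, w) \<partial>?L) = exp (s * of_real u) * ((exp (m * of_real u) * bessel_integral (exp u) m) * (exp (n * of_real u) * bessel_integral (exp u) n))"
      by (simp only: has_bochner_integral_iff)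
  qed
  define g where "g = (\<lambda>y. bessel_integral y m * bessel_integral y n * exp ((s + m + n - 1) * of_real (ln y)))"
  have bm[measurable]: "(\<lambda>y. bessel_integral y k) \<in> borel_measurable borel" for k
    unfolding bessel_integral_def by measurable
  have gm[measurable]: "g \<in> borel_measurable borel" unfolding g_def by measurable
  have eg: "exp u *\<^sub>R g (exp u) = exp (s * of_real u) *
      ((exp (m * of_real u) * bessel_integral (exp u) m) * (exp (n * of_real u) * bessel_integral (exp u) n))" for u :: real
  proof -
    have "complex_of_real (exp u) * exp ((s + m + n - 1) * of_real u) = exp (s * of_real u) * exp (m * of_real u) * exp (n * of_real u)"
      unfolding exp_of_real[symmetric] mult_exp_exp by (intro arg_cong[where f=exp]) (simp add: algebra_simps)
    then show ?thesis unfolding g_def scaleR_conv_of_real ln_exp by algebra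
  qed
  have rg: "range exp = {0::real<..}" by (auto simp: image_iff) (metis exp_ln)
  have "has_bochner_integral lborel (\<lambda>y. indicator {0<..} y *\<^sub>R g y) (Gamma s * I)"
    by (subst has_bochner_integral_range_subst[OF DERIV_exp _ _ rg _ gm])
       (auto simp only: eg * intro!: continuous_intros exp_gt_zero, simp)
  then have "?lhs = Gamma s * I"
    by (simp add: has_bochner_integral_iff set_lebesgue_integral_def g_def)
  also have "\<dots> = ?I"
    using Gamma_nonzero_Re_pos[OF s] by (simp add: I_def power2_eq_square)
  finally show ?thesis .
qed

section \<open>Iwasawa decomposition and spherical vectors\<close>

lemma mat2_nth [simp]:
  "mat2 a b c d $ 1 $ 1 = a" "mat2 a b c d $ 1 $ 2 = b" "mat2 a b c d $ 2 $ 1 = c" "mat2 a b c d $ 2 $ 2 = d"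
  by (simp_all add: mat2_def)

lemma mat2_eq_iff: "A = B \<longleftrightarrow> A $ 1 $ 1 = B $ 1 $ 1 \<and> A $ 1 $ 2 = B $ 1 $ 2 \<and> A $ 2 $ 1 = B $ 2 $ 1 \<and> A $ 2 $ 2 = B $ 2 $ 2"
  for A B :: "real^2^2"
  by (auto simp: vec_eq_iff forall_2)

lemma matrix_mult_2_nth:
  "((A :: real^2^2) ** B) $ i $ j = A $ i $ 1 * B $ 1 $ j + A $ i $ 2 * B $ 2 $ j"
  by (simp add: matrix_matrix_mult_def sum_2)

lemma mat2_mult: "mat2 a b c d ** mat2 e f g h = mat2 (a * e + b * g) (a * f + b * h) (c * e + d * g) (c * f + d * h)"
  by (simp add: mat2_eq_iff matrix_mult_2_nth)

lemma mat_eq_mat2: "mat c = mat2 c 0 0 c"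
  by (simp add: mat2_eq_iff mat_def)

lemma det_mat2 [simp]: "det (mat2 a b c d) = a * d - b * c"
  by (simp add: det_2)

lemma GL2_iff: "g \<in> GL2 \<longleftrightarrow> det g \<noteq> 0"
  by (simp add: GL2_def invertible_det_nz)

lemma O2_iff: "k \<in> O2 \<longleftrightarrow> (k$1$1)\<^sup>2 + (k$1$2)\<^sup>2 = 1 \<and> (k$2$1)\<^sup>2 + (k$2$2)\<^sup>2 = 1 \<and> k$1$1 * k$2$1 + k$1$2 * k$2$2 = 0"
proof -
  have "k \<in> O2 \<longleftrightarrow> k ** transpose k = mat 1"
    unfolding O2_def mem_Collect_eq orthogonal_matrix by (rule matrix_left_right_inverse)
  also have "\<dots> \<longleftrightarrow> (k$1$1)\<^sup>2 + (k$1$2)\<^sup>2 = 1 \<and> k$1$1 * k$2$1 + k$1$2 * k$2$2 = 0 \<and>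
      k$2$1 * k$1$1 + k$2$2 * k$1$2 = 0 \<and> (k$2$1)\<^sup>2 + (k$2$2)\<^sup>2 = 1"
    by (subst mat2_eq_iff) (simp add: matrix_mult_2_nth transpose_def mat_def power2_eq_square)
  finally show ?thesis by (auto simp: mult.commute)
qed

lemma O2_GL2: "k \<in> O2 \<Longrightarrow> k \<in> GL2"
  using det_orthogonal_matrix[of k] by (auto simp: O2_def GL2_iff)

lemma O2_abs_det: "k \<in> O2 \<Longrightarrow> \<bar>det k\<bar> = 1"
  using det_orthogonal_matrix[of k] by (auto simp: O2_def)

lemma mat_1_O2: "mat 1 \<in> O2"
  by (simp add: O2_def orthogonal_matrix_id)

text \<open>This and \<open>\<bar>det g\<bar>\<close> are unchanged under right translation by
  \<open>O2\<close>, and together they determine the absolute values of the diagonal entries of the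
  triangular part of \<open>g\<close>.\<close>

definition bottom_sq :: "real^2^2 \<Rightarrow> real" where
  "bottom_sq g = (g$2$1)\<^sup>2 + (g$2$2)\<^sup>2"

lemma bottom_sq_pos: "g \<in> GL2 \<Longrightarrow> bottom_sq g > 0"
  by (auto simp: bottom_sq_def GL2_iff det_2 sum_power2_gt_zero_iff)

lemma bottom_sq_upper_mult: "bottom_sq (mat2 a b 0 d ** g) = d\<^sup>2 * bottom_sq g"
  by (simp add: bottom_sq_def matrix_mult_2_nth power_mult_distrib distrib_left)

lemma bottom_sq_O2: "k \<in> O2 \<Longrightarrow> bottom_sq k = 1"
  by (simp add: bottom_sq_def O2_iff)

lemma bottom_sq_mult_O2:
  assumes "k \<in> O2" shows "bottom_sq (g ** k) = bottom_sq g"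
proof -
  have "transpose k \<in> O2" using assms by (simp add: O2_def orthogonal_matrix_transpose)
  then have "(k$1$1)\<^sup>2 + (k$2$1)\<^sup>2 = 1" "(k$1$2)\<^sup>2 + (k$2$2)\<^sup>2 = 1" "k$1$1 * k$1$2 + k$2$1 * k$2$2 = 0"
    by (simp_all add: O2_iff transpose_def)
  moreover have "(k$1$1)\<^sup>2 + (k$1$2)\<^sup>2 = 1" "(k$2$1)\<^sup>2 + (k$2$2)\<^sup>2 = 1" "k$1$1 * k$2$1 + k$1$2 * k$2$2 = 0"
    using assms by (simp_all add: O2_iff)
  ultimately show ?thesis unfolding bottom_sq_def matrix_mult_2_nth by algebra
qed

lemma iwasawa:
  assumes "g \<in> GL2"
  shows "\<exists>b k. k \<in> O2 \<and> g = mat2 (\<bar>det g\<bar> / sqrt (bottom_sq g)) b 0 (sqrt (bottom_sq g)) ** k"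
proof -
  define d where "d = sqrt (bottom_sq g)"
  have d: "d > 0" "d * d = bottom_sq g" using bottom_sq_pos[OF assms] by (auto simp: d_def)
  \<comment> \<open>The bottom row of \<open>k\<close> is the normalized bottom row of
    \<open>g\<close>. Its top row is an orthogonal unit vector, and the sign \<open>e\<close> makes
    the upper diagonal entry of the triangular factor positive.\<close>
  define e where "e = sgn (det g)"
  have e: "\<bar>det g\<bar> * e = det g" "e * e = 1" using assms by (auto simp: e_def abs_mult_sgn GL2_iff sgn_if)
  define k where "k = mat2 (e * (g$2$2 / d)) (- e * (g$2$1 / d)) (g$2$1 / d) (g$2$2 / d)"
  define b where "b = (g$1$1 * g$2$1 + g$1$2 * g$2$2) / d"
  have dd: "d * d = (g$2$1)\<^sup>2 + (g$2$2)\<^sup>2" using d(2) by (simp add: bottom_sq_def)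
  have "(g$2$1 / d)\<^sup>2 + (g$2$2 / d)\<^sup>2 = 1"
    using d(1) dd by (auto simp: power_divide add_divide_distrib[symmetric] power2_eq_square[symmetric])
  then have "k \<in> O2"
    using e(2) unfolding O2_iff k_def mat2_nth by algebra
  moreover have "g = mat2 (\<bar>det g\<bar> / d) b 0 d ** k"
  proof -
    have q: "A / d * (u * e * v / d) + (B / d) * (r / d) = (u * (A * e) * v + B * r) / (d * d)" for A B r u v
      by (simp add: add_divide_distrib mult_ac)
    have 1: "g$1$1 = \<bar>det g\<bar> / d * (e * g$2$2 / d) + b * (g$2$1 / d)"
    proof -
      have "\<bar>det g\<bar> / d * (e * g$2$2 / d) + b * (g$2$1 / d) = (det g * g$2$2 + (g$1$1 * g$2$1 + g$1$2 * g$2$2) * g$2$1) / (d * d)"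
        using q[of "\<bar>det g\<bar>" 1 "g$2$2" "g$1$1 * g$2$1 + g$1$2 * g$2$2" "g$2$1"] unfolding b_def e(1) by simp
      also have "det g * g$2$2 + (g$1$1 * g$2$1 + g$1$2 * g$2$2) * g$2$1 = g$1$1 * (d * d)"
        unfolding dd det_2 by algebra
      finally show ?thesis using d(1) by simp
    qed
    have 2: "g$1$2 = \<bar>det g\<bar> / d * (- e * g$2$1 / d) + b * (g$2$2 / d)"
    proof -
      have "\<bar>det g\<bar> / d * (- e * g$2$1 / d) + b * (g$2$2 / d) = (- det g * g$2$1 + (g$1$1 * g$2$1 + g$1$2 * g$2$2) * g$2$2) / (d * d)"
        using q[of "\<bar>det g\<bar>" "- 1" "g$2$1" "g$1$1 * g$2$1 + g$1$2 * g$2$2" "g$2$2"] unfolding b_def e(1) by simp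
      also have "- det g * g$2$1 + (g$1$1 * g$2$1 + g$1$2 * g$2$2) * g$2$2 = g$1$2 * (d * d)"
        unfolding dd det_2 by algebra
      finally show ?thesis using d(1) by simp
    qed
    show ?thesis unfolding k_def mat2_mult mat2_eq_iff mat2_nth using 1 2 d(1) by simp
  qed
  ultimately show ?thesis unfolding d_def by blast
qed

text \<open>The scalar \<open>c\<close> contributes \<open>c\<^sup>2\<close> both to
  \<open>\<bar>det z\<bar>\<close> and to \<open>bottom_sq z\<close>, so their quotient sees only
  \<open>y\<close>. This settles uniqueness in the decomposition; existence is
  \<open>iwasawa\<close>.\<close>

lemma iwasawa_y_eq:
  assumes "z \<in> GL2"
  shows "iwasawa_y z = \<bar>det z\<bar> / bottom_sq z"
  unfolding iwasawa_y_def
proof (rule the_equality)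
  obtain b k where k: "k \<in> O2" and z: "z = mat2 (\<bar>det z\<bar> / sqrt (bottom_sq z)) b 0 (sqrt (bottom_sq z)) ** k"
    using iwasawa[OF assms] by blast
  have c: "sqrt (bottom_sq z) > 0" "det z \<noteq> 0" using bottom_sq_pos[OF assms] assms by (simp_all add: GL2_iff)
  have eq: "mat2 (\<bar>det z\<bar> / sqrt (bottom_sq z)) b 0 (sqrt (bottom_sq z)) =
     mat2 1 (b / sqrt (bottom_sq z)) 0 1 ** mat2 (\<bar>det z\<bar> / bottom_sq z) 0 0 1 ** mat (sqrt (bottom_sq z))"
    using c by (simp add: mat_eq_mat2 mat2_mult) (simp add: mat2_eq_iff field_simps)
  show "\<bar>det z\<bar> / bottom_sq z > 0 \<and> (\<exists>x c k. c \<noteq> 0 \<and> k \<in> O2 \<and>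
     z = mat2 1 x 0 1 ** mat2 (\<bar>det z\<bar> / bottom_sq z) 0 0 1 ** mat c ** k)"
  proof (intro conjI exI)
    show "z = mat2 1 (b / sqrt (bottom_sq z)) 0 1 ** mat2 (\<bar>det z\<bar> / bottom_sq z) 0 0 1 ** mat (sqrt (bottom_sq z)) ** k"
      using z unfolding eq .
  qed (use c k in auto)
next
  fix y assume "y > 0 \<and> (\<exists>x c k. c \<noteq> 0 \<and> k \<in> O2 \<and> z = mat2 1 x 0 1 ** mat2 y 0 0 1 ** mat c ** k)"
  then obtain x c k where y: "y > 0" and c: "c \<noteq> 0" and k: "k \<in> O2" and z: "z = mat2 1 x 0 1 ** mat2 y 0 0 1 ** mat c ** k"
    by blast
  have z': "z = mat2 (y * c) (x * c) 0 c ** k" using z by (simp add: mat_eq_mat2 mat2_mult)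
  have "bottom_sq z = c\<^sup>2" unfolding z' bottom_sq_upper_mult by (simp add: bottom_sq_O2 k)
  moreover have "\<bar>det z\<bar> = y * c\<^sup>2"
    unfolding z' det_mul using O2_abs_det[OF k] y by (simp add: abs_mult power2_eq_square)
  ultimately show "y = \<bar>det z\<bar> / bottom_sq z" using c by simp
qed

section \<open>Smoothness and uniqueness of the spherical vectors\<close>

text \<open>On an open set derivatives are local, so the values off \<open>S\<close> do not matter.
  This permits the passage from an explicit formula to its \<open>extensional\<close> restriction to
  \<open>GL2\<close>.\<close>

lemma Ck_on_cong:
  assumes "open S" "\<And>x. x \<in> S \<Longrightarrow> f x = g x" "Ck_on k S f"
  shows "Ck_on k S g"
  using assms(2,3)
proof (induction k arbitrary: f g)
  case 0
  then show ?case using continuous_on_cong[of S S f g] by simp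
next
  case (Suc k)
  have hd: "(g has_derivative frechet_derivative f (at x)) (at x)" if "x \<in> S" for x
  proof -
    have "f differentiable (at x)" using Suc.prems that by simp
    then have "(f has_derivative frechet_derivative f (at x)) (at x)" using frechet_derivative_works by blast
    then show ?thesis
      by (rule has_derivative_transform_within_open[OF _ assms(1) that]) (use Suc.prems in auto)
  qed
  have eq: "frechet_derivative f (at x) = frechet_derivative g (at x)" if "x \<in> S" for x
    using frechet_derivative_at[OF hd[OF that]] .
  show ?case
  proof (simp, intro conjI ballI allI)
    show "g differentiable at x" if "x \<in> S" for x using hd[OF that] by (auto simp: differentiable_def)
    show "Ck_on k S (\<lambda>x. frechet_derivative g (at x) v)" for v
      by (rule Suc.IH[of "\<lambda>x. frechet_derivative f (at x) v"]) (use Suc.prems eq in auto)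
  qed
qed

text \<open>Smoothness without computing iterated derivatives: it suffices that the class
  \<open>P\<close> is closed under taking directional derivatives, and induction on the order does
  the rest.\<close>

lemma Ck_on_class:
  assumes S: "open S"
    and der: "\<And>f. P f \<Longrightarrow> \<exists>D. (\<forall>x\<in>S. (f has_derivative D x) (at x)) \<and> (\<forall>v. P (\<lambda>x. D x v))"
    and "P f"
  shows "Ck_on k S f"
  using \<open>P f\<close>
proof (induction k arbitrary: f)
  case 0
  then show ?case using der[OF 0] S
    by (auto intro!: continuous_at_imp_continuous_on intro: has_derivative_continuous)
next
  case (Suc k)
  obtain D where D: "\<And>x. x \<in> S \<Longrightarrow> (f has_derivative D x) (at x)" "\<And>v. P (\<lambda>x. D x v)"
    using der[OF Suc.prems] by blast
  show ?case
  proof (simp, intro conjI ballI allI)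
    show "f differentiable at x" if "x \<in> S" for x using D(1)[OF that] by (auto simp: differentiable_def)
    show "Ck_on k S (\<lambda>x. frechet_derivative f (at x) v)" for v
      by (rule Ck_on_cong[OF S _ Suc.IH[OF D(2)[of v]]]) (use frechet_derivative_at[OF D(1)] in auto)
  qed
qed

text \<open>A class of functions on \<open>GL2\<close> closed under differentiation that contains the spherical vectors.\<close>

inductive smooth_gen :: "(real^2^2 \<Rightarrow> complex) \<Rightarrow> bool" where
  const: "smooth_gen (\<lambda>g. c)"
| coord: "smooth_gen (\<lambda>g. of_real (g$i$j))"
| add: "smooth_gen f \<Longrightarrow> smooth_gen h \<Longrightarrow> smooth_gen (\<lambda>g. f g + h g)"
| mult: "smooth_gen f \<Longrightarrow> smooth_gen h \<Longrightarrow> smooth_gen (\<lambda>g. f g * h g)"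
| det_pow: "smooth_gen (\<lambda>g. exp (w * of_real (ln ((g$1$1 * g$2$2 - g$1$2 * g$2$1)\<^sup>2))))"
| row_pow: "smooth_gen (\<lambda>g. exp (w * of_real (ln ((g$2$1)\<^sup>2 + (g$2$2)\<^sup>2))))"

text \<open>The factor \<open>1 / h x\<close> is absorbed by lowering the exponent to
  \<open>w - 1\<close>, so the derivative is again a power of \<open>h\<close> times a derivative of
  \<open>h\<close> and stays inside \<open>smooth_gen\<close>.\<close>

lemma has_derivative_exp_ln:
  fixes h :: "'a::real_normed_vector \<Rightarrow> real"
  assumes "(h has_derivative D) (at x)" "h x > 0"
  shows "((\<lambda>g. exp (w * complex_of_real (ln (h g)))) has_derivative
    (\<lambda>v. w * of_real (D v) * exp ((w - 1) * of_real (ln (h x))))) (at x)"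
proof -
  have 1: "((\<lambda>g. ln (h g)) has_derivative (\<lambda>v. D v / h x)) (at x)"
    using has_derivative_ln[OF assms(2,1)] by (simp add: divide_inverse mult.commute)
  have 2: "((\<lambda>t::real. exp (w * of_real t)) has_derivative (\<lambda>v. of_real v * (w * exp (w * of_real (ln (h x)))))) (at (ln (h x)))"
  proof -
    have "((\<lambda>t::complex. exp (w * t)) has_field_derivative (w * exp (w * of_real (ln (h x))))) (at (of_real (ln (h x))))"
      by (auto intro!: derivative_eq_intros)
    moreover have "(complex_of_real has_vector_derivative 1) (at (ln (h x)))"
      using has_vector_derivative_of_real[OF DERIV_ident] by simp
    ultimately
    have "((\<lambda>t::real. exp (w * of_real t)) has_vector_derivative (w * exp (w * of_real (ln (h x))))) (at (ln (h x)))"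
      using field_vector_diff_chain_at[of of_real 1 "ln (h x)"] by (simp add: o_def)
    then show ?thesis by (simp add: has_vector_derivative_def scaleR_conv_of_real)
  qed
  have 3: "complex_of_real (h x) = exp (of_real (ln (h x)))" using assms(2) by (simp add: exp_of_real)
  have 4: "of_real (v / h x) * (w * exp (w * of_real (ln (h x)))) = w * of_real v * exp ((w - 1) * of_real (ln (h x)))" for v
    by (simp add: 3 left_diff_distrib exp_diff)
  show ?thesis using has_derivative_compose[OF 1 2] unfolding 4 .
qed

lemma smooth_gen_derivative:
  "smooth_gen f \<Longrightarrow> \<exists>D. (\<forall>x\<in>GL2. (f has_derivative D x) (at x)) \<and> (\<forall>v. smooth_gen (\<lambda>x. D x v))"
proof (induction rule: smooth_gen.induct)
  case (const c)
  show ?case by (rule exI[of _ "\<lambda>x v. 0"]) (auto intro: smooth_gen.const)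
next
  case (coord i j)
  show ?case by (rule exI[of _ "\<lambda>x v. of_real (v$i$j)"])
     (auto intro!: smooth_gen.const bounded_linear_imp_has_derivative bounded_linear_compose[OF bounded_linear_of_real]
        bounded_linear_compose[OF bounded_linear_vec_nth bounded_linear_vec_nth])
next
  case (add f h)
  then obtain D E where "\<forall>x\<in>GL2. (f has_derivative D x) (at x)" "\<forall>v. smooth_gen (\<lambda>x. D x v)"
    "\<forall>x\<in>GL2. (h has_derivative E x) (at x)" "\<forall>v. smooth_gen (\<lambda>x. E x v)" by blast
  then show ?case by (intro exI[of _ "\<lambda>x v. D x v + E x v"]) (auto intro!: smooth_gen.add has_derivative_add)
next
  case (mult f h)
  then obtain D E where "\<forall>x\<in>GL2. (f has_derivative D x) (at x)" "\<forall>v. smooth_gen (\<lambda>x. D x v)"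
    "\<forall>x\<in>GL2. (h has_derivative E x) (at x)" "\<forall>v. smooth_gen (\<lambda>x. E x v)" by blast
  with mult.hyps show ?case
    by (intro exI[of _ "\<lambda>x v. f x * E x v + D x v * h x"]) (auto intro!: smooth_gen.add smooth_gen.mult has_derivative_mult)
next
  case (det_pow w)
  \<comment> \<open>Differences are written as sums with \<open>-1\<close> as a coefficient, so that
    the closure rules of \<open>smooth_gen\<close> for sums and products suffice.\<close>
  let ?D = "\<lambda>x v. 2 * (x$1$1 * x$2$2 + (-1) * (x$1$2 * x$2$1)) * ((x$1$1 * v$2$2 + v$1$1 * x$2$2) + (-1) * (x$1$2 * v$2$1 + v$1$2 * x$2$1)) :: real"
  have d: "((\<lambda>g. (g$1$1 * g$2$2 - g$1$2 * g$2$1)\<^sup>2) has_derivative ?D x) (at x)" for x :: "real^2^2"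
    by (auto intro!: derivative_eq_intros bounded_linear_imp_has_derivative
        bounded_linear_compose[OF bounded_linear_vec_nth bounded_linear_vec_nth] simp: algebra_simps)
  have "smooth_gen (\<lambda>x. w * of_real (?D x v) * exp ((w - 1) * of_real (ln ((x$1$1 * x$2$2 - x$1$2 * x$2$1)\<^sup>2))))" for v
    unfolding of_real_mult of_real_add
    by (intro smooth_gen.intros)
  moreover have "(x$1$1 * x$2$2 - x$1$2 * x$2$1)\<^sup>2 > 0" if "x \<in> GL2" for x
    using that by (simp add: GL2_iff det_2)
  ultimately show ?case using has_derivative_exp_ln[OF d]
    by (intro exI[of _ "\<lambda>x v. w * of_real (?D x v) * exp ((w - 1) * of_real (ln ((x$1$1 * x$2$2 - x$1$2 * x$2$1)\<^sup>2)))"]) blast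
next
  case (row_pow w)
  let ?D = "\<lambda>x v. 2 * (x$2$1 * v$2$1 + x$2$2 * v$2$2) :: real"
  have d: "((\<lambda>g. (g$2$1)\<^sup>2 + (g$2$2)\<^sup>2) has_derivative ?D x) (at x)" for x :: "real^2^2"
    by (auto intro!: derivative_eq_intros bounded_linear_imp_has_derivative
        bounded_linear_compose[OF bounded_linear_vec_nth bounded_linear_vec_nth] simp: algebra_simps)
  have "smooth_gen (\<lambda>x. w * of_real (?D x v) * exp ((w - 1) * of_real (ln ((x$2$1)\<^sup>2 + (x$2$2)\<^sup>2))))" for v
    unfolding of_real_mult of_real_add by (intro smooth_gen.intros)
  moreover have "(x$2$1)\<^sup>2 + (x$2$2)\<^sup>2 > 0" if "x \<in> GL2" for x
    using bottom_sq_pos[OF that] by (simp add: bottom_sq_def)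
  ultimately show ?case using has_derivative_exp_ln[OF d]
    by (intro exI[of _ "\<lambda>x v. w * of_real (?D x v) * exp ((w - 1) * of_real (ln ((x$2$1)\<^sup>2 + (x$2$2)\<^sup>2)))"]) blast
qed

lemma open_GL2: "open GL2"
proof -
  have "continuous_on UNIV (\<lambda>g :: real^2^2. det g)" unfolding det_2 by (intro continuous_intros)
  then have "open ((\<lambda>g :: real^2^2. det g) -` (- {0}))" by (intro open_vimage) auto
  also have "(\<lambda>g :: real^2^2. det g) -` (- {0}) = GL2" by (auto simp: GL2_iff)
  finally show ?thesis .
qed

text \<open>In Iwasawa coordinates this is
  \<open>a powr (\<Lambda>$1 + 1/2) * d powr (\<Lambda>$2 - 1/2)\<close> with
  \<open>d = sqrt (bottom_sq g)\<close> and \<open>a = \<bar>det g\<bar> / d\<close>. Logarithms of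
  squares replace absolute values and square roots, so both factors are visibly generators of
  \<open>smooth_gen\<close>.\<close>

definition spherical :: "complex^2 \<Rightarrow> real^2^2 \<Rightarrow> complex" where
  "spherical \<Lambda> = (\<lambda>g\<in>GL2. exp ((\<Lambda>$1 + 1/2) / 2 * of_real (ln ((g$1$1 * g$2$2 - g$1$2 * g$2$1)\<^sup>2))) *
     exp ((\<Lambda>$2 - \<Lambda>$1 - 1) / 2 * of_real (ln ((g$2$1)\<^sup>2 + (g$2$2)\<^sup>2))))"

lemma smooth_on_spherical: "smooth_on GL2 (spherical \<Lambda>)"
  unfolding smooth_on_def
proof
  fix k
  have "Ck_on k GL2 (\<lambda>g. exp ((\<Lambda>$1 + 1/2) / 2 * of_real (ln ((g$1$1 * g$2$2 - g$1$2 * g$2$1)\<^sup>2))) *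
     exp ((\<Lambda>$2 - \<Lambda>$1 - 1) / 2 * of_real (ln ((g$2$1)\<^sup>2 + (g$2$2)\<^sup>2))))"
    by (rule Ck_on_class[where P=smooth_gen, OF open_GL2 smooth_gen_derivative]) (assumption | intro smooth_gen.intros)+
  then show "Ck_on k GL2 (spherical \<Lambda>)"
    by (rule Ck_on_cong[OF open_GL2, rotated]) (simp add: spherical_def)
qed

lemma spherical_eq: "g \<in> GL2 \<Longrightarrow> spherical \<Lambda> g = exp ((\<Lambda>$1 + 1/2) * of_real (ln \<bar>det g\<bar>)) *
     exp ((\<Lambda>$2 - \<Lambda>$1 - 1) / 2 * of_real (ln (bottom_sq g)))"
proof -
  assume g: "g \<in> GL2"
  have "ln ((det g)\<^sup>2) = 2 * ln \<bar>det g\<bar>"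
    using g ln_realpow[of "\<bar>det g\<bar>" 2] by (simp add: GL2_iff)
  then show ?thesis using g by (simp add: spherical_def bottom_sq_def det_2)
qed

lemma upper_GL2: "a \<noteq> 0 \<Longrightarrow> d \<noteq> 0 \<Longrightarrow> mat2 a b 0 d \<in> GL2"
  by (simp add: GL2_iff)

lemma GL2_mult: "g \<in> GL2 \<Longrightarrow> h \<in> GL2 \<Longrightarrow> g ** h \<in> GL2"
  by (simp add: GL2_iff det_mul)

lemma spherical_in_I_space: "spherical \<Lambda> \<in> I_space \<Lambda>"
  unfolding I_space_def
proof (intro CollectI conjI smooth_on_spherical allI ballI impI)
  show "spherical \<Lambda> \<in> extensional GL2" by (simp add: spherical_def)
  fix a b d :: real and g :: "real^2^2" assume g: "g \<in> GL2" and ad: "a \<noteq> 0" "d \<noteq> 0"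
  have nz: "\<bar>det g\<bar> > 0" "bottom_sq g > 0" using g bottom_sq_pos by (auto simp: GL2_iff)
  have l1: "ln \<bar>det (mat2 a b 0 d ** g)\<bar> = ln \<bar>a\<bar> + ln \<bar>d\<bar> + ln \<bar>det g\<bar>"
    using ad nz by (simp add: det_mul abs_mult ln_mult)
  have l2: "ln (bottom_sq (mat2 a b 0 d ** g)) = 2 * ln \<bar>d\<bar> + ln (bottom_sq g)"
    using ad nz ln_realpow[of "\<bar>d\<bar>" 2] by (simp add: bottom_sq_upper_mult ln_mult)
  have pw: "complex_of_real \<bar>x\<bar> powr w = exp (w * of_real (ln \<bar>x\<bar>))" if "x \<noteq> 0" for x w
    using that by (simp add: powr_def Ln_of_real)
  show "spherical \<Lambda> (mat2 a b 0 d ** g) = of_real \<bar>a\<bar> powr (\<Lambda>$1 + 1/2) * of_real \<bar>d\<bar> powr (\<Lambda>$2 - 1/2) * spherical \<Lambda> g"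
    unfolding spherical_eq[OF g] spherical_eq[OF GL2_mult[OF upper_GL2[OF ad] g]] l1 l2 pw[OF ad(1)] pw[OF ad(2)] mult_exp_exp
    by (intro arg_cong[where f=exp]) (simp add: field_simps)
qed

lemma spherical_O2_invariant: "right_O2_invariant (spherical \<Lambda>)"
  unfolding right_O2_invariant_def
  by (auto simp: spherical_eq GL2_mult O2_GL2 bottom_sq_mult_O2 det_mul abs_mult O2_abs_det)

lemma spherical_mat_1: "spherical \<Lambda> (mat 1) = 1"
  using O2_GL2[OF mat_1_O2] by (simp add: spherical_eq bottom_sq_O2 mat_1_O2)

text \<open>By \<open>iwasawa\<close>, right invariance and left equivariance express every
  candidate on \<open>GL2\<close> through its value at the identity; off \<open>GL2\<close>
  extensionality decides.\<close>

lemma phi_sph_eq: "phi_sph \<Lambda> = spherical \<Lambda>"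
  unfolding phi_sph_def
proof (rule the_equality)
  show "spherical \<Lambda> \<in> I_space \<Lambda> \<and> right_O2_invariant (spherical \<Lambda>) \<and> spherical \<Lambda> (mat 1) = 1"
    by (simp add: spherical_in_I_space spherical_O2_invariant spherical_mat_1)
  fix u assume u: "u \<in> I_space \<Lambda> \<and> right_O2_invariant u \<and> u (mat 1) = 1"
  have det: "v g = of_real \<bar>\<bar>det g\<bar> / sqrt (bottom_sq g)\<bar> powr (\<Lambda>$1 + 1/2) * of_real \<bar>sqrt (bottom_sq g)\<bar> powr (\<Lambda>$2 - 1/2)"
    if v: "v \<in> I_space \<Lambda>" "right_O2_invariant v" "v (mat 1) = 1" and g: "g \<in> GL2" for v g
  proof -
    define a d where "a = \<bar>det g\<bar> / sqrt (bottom_sq g)" and "d = sqrt (bottom_sq g)"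
    have nz: "a \<noteq> 0" "d \<noteq> 0" using g bottom_sq_pos[OF g] by (auto simp: a_def d_def GL2_iff)
    obtain b k where k: "k \<in> O2" and gk: "g = mat2 a b 0 d ** k"
      using iwasawa[OF g] unfolding a_def d_def by blast
    have "v g = v (mat2 a b 0 d)" using v(2) k upper_GL2[OF nz] unfolding right_O2_invariant_def gk by blast
    also have "\<dots> = v (mat2 a b 0 d ** mat 1)" by simp
    also have "\<dots> = of_real \<bar>a\<bar> powr (\<Lambda>$1 + 1/2) * of_real \<bar>d\<bar> powr (\<Lambda>$2 - 1/2) * v (mat 1)"
      using v(1) O2_GL2[OF mat_1_O2] nz unfolding I_space_def by blast
    finally show ?thesis using v(3) by (simp add: a_def d_def)
  qed
  show "u = spherical \<Lambda>"
  proof (rule extensionalityI[of _ GL2])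
    fix g assume g: "g \<in> GL2"
    show "u g = spherical \<Lambda> g"
      unfolding det[OF spherical_in_I_space spherical_O2_invariant spherical_mat_1 g] using u det[OF _ _ _ g] by blast
  qed (use u in \<open>auto simp: I_space_def spherical_def\<close>)
qed

text \<open>Splitting \<open>\<bar>a / d\<bar>\<close> into its two powers reduces
  \<open>f_sph\<close> to a case of \<open>phi_sph\<close>.\<close>

lemma L_space_eq_I_space: "L_space r = I_space (vector [r, - r])"
proof -
  have "complex_of_real \<bar>a / d\<bar> powr (r + 1/2) = of_real \<bar>a\<bar> powr (r + 1/2) * of_real \<bar>d\<bar> powr (- r - 1/2)"
    if "a \<noteq> 0" "d \<noteq> 0" for a d
    using that by (simp add: powr_def Ln_of_real ln_div mult_exp_exp del: of_real_divide) (simp add: algebra_simps)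
  then show ?thesis unfolding L_space_def I_space_def by (auto simp: vector_2)
qed

lemma phi_sph_O2: "k \<in> O2 \<Longrightarrow> phi_sph \<Lambda> k = 1"
  using O2_GL2 by (simp add: phi_sph_eq spherical_eq O2_abs_det bottom_sq_O2)

lemma f_sph_O2: "k \<in> O2 \<Longrightarrow> f_sph r k = 1"
  using phi_sph_O2 by (simp add: f_sph_def L_space_eq_I_space flip: phi_sph_def)

section \<open>The archimedean factor\<close>

text \<open>For \<open>Re a > 1/2\<close> this is \<open>whittaker_fourier_integral\<close>. Written
  with \<open>rGamma\<close> the right hand side is entire in \<open>a\<close>, so the identity
  theorem on the half plane makes it the only holomorphic extension. The sign \<open>e\<close> is -1
  for \<open>psi\<close> and 1 for its conjugate, because the integrand conjugates the
  character.\<close>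

lemma W_J_eq:
  assumes y: "y > 0" and e: "e = 1 \<or> e = (-1::real)"
    and th: "\<And>t. cnj (\<theta> (mat2 1 t 0 1)) = exp (\<i> * of_real (2 * pi * e * t))"
  shows "W_J (mat2 y 0 0 1) a \<theta> = exp (a * of_real (ln (pi * y))) * rGamma a * bessel_integral y (a - 1/2)"
proof -
  define F where "F = (\<lambda>a. exp (a * of_real (ln (pi * y))) * rGamma a * bessel_integral y (a - 1/2))"
  have F: "F holomorphic_on UNIV"
  proof -
    have "(\<lambda>a. a - 1/2 :: complex) holomorphic_on UNIV" by (intro holomorphic_intros)
    then have "(\<lambda>a. bessel_integral y (a - 1/2)) holomorphic_on UNIV"
      by (rule holomorphic_on_compose[unfolded o_def])
        (rule holomorphic_on_subset[OF bessel_integral_holomorphic[OF y]], simp)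
    then show ?thesis unfolding F_def by (auto intro!: holomorphic_intros)
  qed
  have jac: "jacquet_integral (mat2 y 0 0 1) b \<theta> = F b" if b: "Re b > 1/2" for b
  proof -
    have "I_fun b (mat2 0 1 1 0 ** mat2 1 t 0 1 ** mat2 y 0 0 1) * cnj (\<theta> (mat2 1 t 0 1)) =
       exp (b * of_real (ln (pi * y))) * (exp (- b * of_real (ln (pi * (y\<^sup>2 + t\<^sup>2)))) * exp (\<i> * of_real (2 * pi * e * t)))" for t
    proof -
      have m: "mat2 0 1 1 0 ** mat2 1 t 0 1 ** mat2 y 0 0 1 = mat2 0 1 y t" by (simp add: mat2_mult)
      have pos: "y\<^sup>2 + t\<^sup>2 > 0" using y by (simp add: add_pos_nonneg)
      have iw: "iwasawa_y (mat2 0 1 y t) = y / (y\<^sup>2 + t\<^sup>2)"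
        using y by (subst iwasawa_y_eq) (auto simp: GL2_iff bottom_sq_def)
      have "complex_of_real (y / (y\<^sup>2 + t\<^sup>2)) powr b = exp (b * of_real (ln (y / (y\<^sup>2 + t\<^sup>2))))"
        using y pos by (simp add: powr_def Ln_of_real del: of_real_divide of_real_add)
      \<comment> \<open>The factor \<open>pi\<close> is put into numerator and denominator to match
        the normalization in \<open>whittaker_fourier_integral\<close>.\<close>
      also have "ln (y / (y\<^sup>2 + t\<^sup>2)) = ln (pi * y) - ln (pi * (y\<^sup>2 + t\<^sup>2))"
        using y pos by (simp add: ln_div ln_mult)
      also have "exp (b * of_real (ln (pi * y) - ln (pi * (y\<^sup>2 + t\<^sup>2)))) = exp (b * of_real (ln (pi * y))) * exp (- b * of_real (ln (pi * (y\<^sup>2 + t\<^sup>2))))"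
        unfolding mult_exp_exp by (intro arg_cong[where f=exp]) (simp add: algebra_simps)
      finally show ?thesis unfolding I_fun_def m iw th by (simp only: mult.assoc)
    qed
    then show ?thesis unfolding jacquet_integral_def
      by (simp only: integral_mult_right_zero whittaker_fourier_integral[OF y b e]) (simp add: F_def)
  qed
  have "(THE F. F holomorphic_on UNIV \<and> (\<forall>\<beta>. Re \<beta> > 1/2 \<longrightarrow> F \<beta> = jacquet_integral (mat2 y 0 0 1) \<beta> \<theta>)) = F"
  proof (rule the_equality)
    show "F holomorphic_on UNIV \<and> (\<forall>\<beta>. Re \<beta> > 1/2 \<longrightarrow> F \<beta> = jacquet_integral (mat2 y 0 0 1) \<beta> \<theta>)"
      using F jac by auto
    fix H assume H: "H holomorphic_on UNIV \<and> (\<forall>\<beta>. Re \<beta> > 1/2 \<longrightarrow> H \<beta> = jacquet_integral (mat2 y 0 0 1) \<beta> \<theta>)"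
    have "H z = F z" for z
    proof (rule analytic_continuation_open[of "{b. Re b > 1/2}" UNIV H F z])
      show "{b. Re b > 1/2} \<noteq> {}" by (auto intro!: exI[of _ 1])
      show "open {b. Re b > 1/2}" by (rule open_halfspace_Re_gt)
    qed (use H F jac in auto)
    then show "H = F" by auto
  qed
  then show ?thesis unfolding W_J_def by (simp add: F_def)
qed

text \<open>The prefactors \<open>(pi * y) powr (m + 1/2)\<close> and
  \<open>(pi * y) powr (n + 1/2)\<close> of the Whittaker functions, times
  \<open>y powr (s - 2)\<close>, give a constant power of \<open>pi\<close> and exactly the power of
  \<open>y\<close> in \<open>bessel_product_mellin\<close>.\<close>

lemma G_arch_eq:
  assumes "Re s > 0" "Re (\<Lambda>$1) = 0" "Re (\<nu>$1) = 0" and L: "\<Lambda>$1 + \<Lambda>$2 = 0" "\<nu>$1 + \<nu>$2 = 0"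
  shows "G_arch \<Lambda> \<nu> s = exp ((\<Lambda>$1 + \<nu>$1 + 1 - s) * of_real (ln pi)) / 2 * rGamma (\<Lambda>$1 + 1/2) * rGamma (\<nu>$1 + 1/2) *
    (Gamma ((s + \<Lambda>$1 + \<nu>$1) / 2) * Gamma ((s - \<Lambda>$1 - \<nu>$1) / 2) *
        Gamma ((s + \<Lambda>$1 - \<nu>$1) / 2) * Gamma ((s - \<Lambda>$1 + \<nu>$1) / 2)) / Gamma s"
proof -
  define m n where "m = \<Lambda>$1" and "n = \<nu>$1"
  have L2: "(\<Lambda>$1 - \<Lambda>$2 + 1) / 2 = m + 1/2" "(\<nu>$1 - \<nu>$2 + 1) / 2 = n + 1/2"
    using L by (auto simp: m_def n_def add_eq_0_iff field_simps)
  let ?P = "Gamma ((s + m + n) / 2) * Gamma ((s - m - n) / 2) * Gamma ((s + m - n) / 2) * Gamma ((s - m + n) / 2)"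
  define c where "c = exp ((m + n + 1) * of_real (ln pi)) * rGamma (m + 1/2) * rGamma (n + 1/2)"
  have int: "W_J (mat2 y 0 0 1) (m + 1/2) psi * W_J (mat2 y 0 0 1) (n + 1/2) (\<lambda>n. cnj (psi n)) * of_real y powr s / of_real (y\<^sup>2) =
     c * (bessel_integral y m * bessel_integral y n * exp ((s + m + n - 1) * of_real (ln y)))" if y: "y > 0" for y
  proof -
    have W1: "W_J (mat2 y 0 0 1) (m + 1/2) psi = exp ((m + 1/2) * of_real (ln (pi * y))) * rGamma (m + 1/2) * bessel_integral y (m + 1/2 - 1/2)"
      by (rule W_J_eq[OF y, of "-1"]) (auto simp: psi_def exp_cnj mult_ac)
    have W2: "W_J (mat2 y 0 0 1) (n + 1/2) (\<lambda>n. cnj (psi n)) = exp ((n + 1/2) * of_real (ln (pi * y))) * rGamma (n + 1/2) * bessel_integral y (n + 1/2 - 1/2)"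
      by (rule W_J_eq[OF y, of 1]) (auto simp: psi_def exp_cnj mult_ac)
    have "complex_of_real (y\<^sup>2) = exp (2 * of_real (ln y))"
      using y by (simp add: exp_double exp_of_real)
    then have p: "of_real y powr s / of_real (y\<^sup>2) = exp ((s - 2) * of_real (ln y))"
      using y by (simp add: powr_def Ln_of_real left_diff_distrib exp_diff)
    have "exp ((m + 1/2) * of_real (ln (pi * y))) * exp ((n + 1/2) * of_real (ln (pi * y))) * exp ((s - 2) * of_real (ln y)) =
       exp ((m + n + 1) * of_real (ln pi)) * exp ((s + m + n - 1) * of_real (ln y))"
      unfolding mult_exp_exp using y by (intro arg_cong[where f=exp]) (simp add: ln_mult field_simps)
    then show ?thesis unfolding W1 W2 c_def times_divide_eq_right[symmetric] p add_diff_cancel_right'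
      by algebra
  qed
  have "G_arch \<Lambda> \<nu> s = (LINT y : {0<..} | lborel. c * (bessel_integral y m * bessel_integral y n * exp ((s + m + n - 1) * of_real (ln y))))"
    unfolding G_arch_def L2 by (rule set_lebesgue_integral_cong) (use int in auto)
  also have "\<dots> = c * (exp (- s * of_real (ln pi)) / 2 * ?P / Gamma s)"
    by (subst set_integral_mult_right, subst bessel_product_mellin) (use assms in \<open>auto simp: m_def n_def\<close>)
  also have "\<dots> = (exp ((m + n + 1) * of_real (ln pi)) * exp (- s * of_real (ln pi))) / 2 * rGamma (m + 1/2) * rGamma (n + 1/2) * ?P / Gamma s"
    by (simp add: c_def)
  also have "exp ((m + n + 1) * of_real (ln pi)) * exp (- s * of_real (ln pi)) = exp ((m + n + 1 - s) * of_real (ln pi))"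
    unfolding mult_exp_exp by (intro arg_cong[where f=exp]) (simp add: algebra_simps)
  finally show ?thesis unfolding m_def n_def .
qed

section \<open>Uniqueness of meromorphic continuation\<close>

lemma holomorphic_vec_on_subset: "holomorphic_vec_on f S \<Longrightarrow> T \<subseteq> S \<Longrightarrow> holomorphic_vec_on f T"
  unfolding holomorphic_vec_on_def by blast

lemma holomorphic_vec_on_continuous: "holomorphic_vec_on f S \<Longrightarrow> continuous_on S f"
  unfolding holomorphic_vec_on_def
  by (intro continuous_at_imp_continuous_on) (auto intro: has_derivative_continuous)

lemma holomorphic_vec_on_const: "holomorphic_vec_on (\<lambda>z. c) S"
  unfolding holomorphic_vec_on_def by (auto intro!: exI[of _ "\<lambda>v. 0"])

lemma holomorphic_vec_on_nth: "holomorphic_vec_on (\<lambda>z. z $ i) S"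
  unfolding holomorphic_vec_on_def
  by (intro ballI exI[of _ "\<lambda>v. v $ i"] conjI bounded_linear_imp_has_derivative bounded_linear_vec_nth) auto

lemma holomorphic_vec_on_add:
  "holomorphic_vec_on f S \<Longrightarrow> holomorphic_vec_on g S \<Longrightarrow> holomorphic_vec_on (\<lambda>z. f z + g z) S"
  unfolding holomorphic_vec_on_def
proof (intro ballI)
  fix z assume "\<forall>z\<in>S. \<exists>D. (f has_derivative D) (at z) \<and> (\<forall>c v. D (c *s v) = c * D v)"
    "\<forall>z\<in>S. \<exists>D. (g has_derivative D) (at z) \<and> (\<forall>c v. D (c *s v) = c * D v)" "z \<in> S"
  then obtain D E where "(f has_derivative D) (at z)" "\<forall>c v. D (c *s v) = c * D v"
    "(g has_derivative E) (at z)" "\<forall>c v. E (c *s v) = c * E v" by blast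
  then show "\<exists>D. ((\<lambda>z. f z + g z) has_derivative D) (at z) \<and> (\<forall>c v. D (c *s v) = c * D v)"
    by (intro exI[of _ "\<lambda>v. D v + E v"] conjI has_derivative_add) (auto simp: distrib_left)
qed

lemma holomorphic_vec_on_mult:
  "holomorphic_vec_on f S \<Longrightarrow> holomorphic_vec_on g S \<Longrightarrow> holomorphic_vec_on (\<lambda>z. f z * g z) S"
  unfolding holomorphic_vec_on_def
proof (intro ballI)
  fix z assume "\<forall>z\<in>S. \<exists>D. (f has_derivative D) (at z) \<and> (\<forall>c v. D (c *s v) = c * D v)"
    "\<forall>z\<in>S. \<exists>D. (g has_derivative D) (at z) \<and> (\<forall>c v. D (c *s v) = c * D v)" "z \<in> S"
  then obtain D E where "(f has_derivative D) (at z)" "\<forall>c v. D (c *s v) = c * D v"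
    "(g has_derivative E) (at z)" "\<forall>c v. E (c *s v) = c * E v" by blast
  then show "\<exists>D. ((\<lambda>z. f z * g z) has_derivative D) (at z) \<and> (\<forall>c v. D (c *s v) = c * D v)"
    by (intro exI[of _ "\<lambda>v. f z * E v + D v * g z"] conjI has_derivative_mult) (auto simp: algebra_simps)
qed

lemma holomorphic_vec_on_compose:
  assumes "holomorphic_vec_on f S" "\<And>z. z \<in> S \<Longrightarrow> g field_differentiable at (f z)"
  shows "holomorphic_vec_on (\<lambda>z. g (f z)) S"
  unfolding holomorphic_vec_on_def
proof (intro ballI)
  fix z assume z: "z \<in> S"
  obtain D where D: "(f has_derivative D) (at z)" "\<forall>c v. D (c *s v) = c * D v"
    using assms(1) z unfolding holomorphic_vec_on_def by blast
  obtain g' where "(g has_field_derivative g') (at (f z))" using assms(2)[OF z] unfolding field_differentiable_def ..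
  then have "(g has_derivative (*) g') (at (f z))" by (simp add: has_field_derivative_def)
  from has_derivative_compose[OF D(1) this] D(2)
  show "\<exists>D. ((\<lambda>z. g (f z)) has_derivative D) (at z) \<and> (\<forall>c v. D (c *s v) = c * D v)"
    by (intro exI[of _ "\<lambda>v. g' * D v"]) auto
qed

lemma holomorphic_vec_on_diff:
  assumes "holomorphic_vec_on f S" "holomorphic_vec_on g S"
  shows "holomorphic_vec_on (\<lambda>z. f z - g z) S"
  using holomorphic_vec_on_add[OF assms(1) holomorphic_vec_on_mult[OF holomorphic_vec_on_const assms(2), of "-1"]] by simp

lemmas holomorphic_vec_intros = holomorphic_vec_on_const holomorphic_vec_on_nth holomorphic_vec_on_add
  holomorphic_vec_on_diff holomorphic_vec_on_mult

text \<open>Reduction to one variable along the complex line from a point \<open>a\<close> of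
  \<open>T\<close> to \<open>z\<close>: the part of that line inside the ball is convex, hence
  connected, and \<open>h\<close> vanishes on it near \<open>a\<close>.\<close>

lemma holomorphic_vec_ball_identity:
  fixes h :: "complex^'n \<Rightarrow> complex"
  assumes h: "holomorphic_vec_on h (ball x r)" and T: "open T" "T \<noteq> {}" "T \<subseteq> ball x r"
    and 0: "\<And>z. z \<in> T \<Longrightarrow> h z = 0" and z: "z \<in> ball x r"
  shows "h z = 0"
proof -
  obtain a where a: "a \<in> T" using T by blast
  define w where "w = z - a"
  have lin: "linear (\<lambda>t::complex. t *s w)"
    by (rule linearI) (auto simp: vec_eq_iff distrib_right)
  then have bl: "bounded_linear (\<lambda>t::complex. t *s w)" by (simp add: linear_conv_bounded_linear)
  \<comment> \<open>The ball is recentred by \<open>a\<close> so that \<open>S\<close> is a preimage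
    under a linear rather than an affine map, which yields convexity at once.\<close>
  define S where "S = (\<lambda>t. t *s w) -` ball (x - a) r"
  have S: "t \<in> S \<longleftrightarrow> a + t *s w \<in> ball x r" for t
    by (simp add: S_def dist_norm algebra_simps)
  have cont: "continuous_on UNIV (\<lambda>t. a + t *s w)"
    by (intro continuous_intros linear_continuous_on bl)
  have "convex S" unfolding S_def by (intro convex_linear_vimage lin convex_ball)
  have "(\<lambda>t. h (a + t *s w)) 1 = 0"
  proof (rule analytic_continuation_open[of "(\<lambda>t. a + t *s w) -` T" S _ "\<lambda>t. 0" 1])
    show "open ((\<lambda>t. a + t *s w) -` T)" using T(1) cont by (rule open_vimage)
    show "open S" unfolding S_def by (intro open_vimage open_ball linear_continuous_on bl)
    show "(\<lambda>t. a + t *s w) -` T \<noteq> {}"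
    proof -
      have "0 \<in> (\<lambda>t. a + t *s w) -` T" using a by simp
      then show ?thesis by blast
    qed
    show "connected S" using \<open>convex S\<close> by (rule convex_connected)
    show "(\<lambda>t. a + t *s w) -` T \<subseteq> S" using T(3) S by auto
    show "(\<lambda>t. h (a + t *s w)) holomorphic_on S"
      unfolding holomorphic_on_def
    proof
      fix t assume "t \<in> S"
      then obtain D where D: "(h has_derivative D) (at (a + t *s w))" "\<forall>c v. D (c *s v) = c * D v"
        using h S unfolding holomorphic_vec_on_def by blast
      have "((\<lambda>t. a + t *s w) has_derivative (\<lambda>t. t *s w)) (at t)"
        using has_derivative_add[OF has_derivative_const bounded_linear_imp_has_derivative[OF bl]] by simp
      from has_derivative_compose[OF this D(1)] D(2)
      have "((\<lambda>t. h (a + t *s w)) has_derivative (\<lambda>t. t * D w)) (at t)" by simp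
      then have "((\<lambda>t. h (a + t *s w)) has_field_derivative D w) (at t)"
        by (simp add: has_field_derivative_def mult.commute[of _ "D w"])
      then show "(\<lambda>t. h (a + t *s w)) field_differentiable at t within S"
        by (meson field_differentiable_def field_differentiable_at_within)
    qed
    show "1 \<in> S" using z by (simp add: S w_def)
    show "h (a + t *s w) = 0" if "t \<in> (\<lambda>t. a + t *s w) -` T" for t using 0 that by auto
  qed auto
  then show ?thesis by (simp add: w_def)
qed

text \<open>The closure of the open set of agreement is shown to be open. Near one of its points
  both functions are quotients; the cross-multiplied difference is holomorphic and vanishes on an
  open set, hence on a whole ball, which forces agreement off the zeros of the denominators. Only
  density can be claimed, since values at those zeros are arbitrary.\<close>

lemma meromorphic_vec_eq_dense:
  fixes F G :: "complex^'n \<Rightarrow> complex"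
  assumes F: "meromorphic_vec_on F UNIV" and G: "meromorphic_vec_on G UNIV"
    and U: "open U" "U \<noteq> {}" "\<And>z. z \<in> U \<Longrightarrow> F z = G z"
  shows "closure (interior {z. F z = G z}) = UNIV"
proof -
  define E where "E = interior {z. F z = G z}"
  have E: "open E" "\<And>z. z \<in> E \<Longrightarrow> F z = G z" using interior_subset by (auto simp: E_def)
  have maxE: "W \<subseteq> E" if "open W" "\<And>z. z \<in> W \<Longrightarrow> F z = G z" for W
    unfolding E_def using that by (intro interior_maximal) auto
  have "\<exists>r>0. ball x r \<subseteq> closure E" if x: "x \<in> closure E" for x
  proof -
    obtain V P Q where V: "open V" "x \<in> V" "holomorphic_vec_on P V" "holomorphic_vec_on Q V"
      "\<And>W. open W \<Longrightarrow> W \<noteq> {} \<Longrightarrow> W \<subseteq> V \<Longrightarrow> \<exists>z\<in>W. Q z \<noteq> 0" "\<And>z. z \<in> V \<Longrightarrow> Q z \<noteq> 0 \<Longrightarrow> F z = P z / Q z"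
      using F unfolding meromorphic_vec_on_def by (metis UNIV_I)
    obtain V' P' Q' where V': "open V'" "x \<in> V'" "holomorphic_vec_on P' V'" "holomorphic_vec_on Q' V'"
      "\<And>W. open W \<Longrightarrow> W \<noteq> {} \<Longrightarrow> W \<subseteq> V' \<Longrightarrow> \<exists>z\<in>W. Q' z \<noteq> 0" "\<And>z. z \<in> V' \<Longrightarrow> Q' z \<noteq> 0 \<Longrightarrow> G z = P' z / Q' z"
      using G unfolding meromorphic_vec_on_def by (metis UNIV_I)
    obtain r where r: "r > 0" "ball x r \<subseteq> V \<inter> V'"
      using V(1,2) V'(1,2) open_contains_ball[of "V \<inter> V'"] by blast
    have hol: "holomorphic_vec_on P (ball x r)" "holomorphic_vec_on Q (ball x r)"
      "holomorphic_vec_on P' (ball x r)" "holomorphic_vec_on Q' (ball x r)"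
      using V(3,4) V'(3,4) r(2) by (auto intro: holomorphic_vec_on_subset)
    define N where "N = {z \<in> ball x r. Q z \<noteq> 0 \<and> Q' z \<noteq> 0}"
    have open_ne: "open {z \<in> W. q z \<noteq> 0}" if "continuous_on (ball x r) q" "open W" "W \<subseteq> ball x r" for q :: "complex^'n \<Rightarrow> complex" and W
      using continuous_open_preimage[OF continuous_on_subset[OF that(1,3)] that(2) open_Compl[OF closed_singleton[of 0]]]
      by (simp add: vimage_def Int_def)
    note cQ = holomorphic_vec_on_continuous[OF hol(2)] holomorphic_vec_on_continuous[OF hol(4)]
    have dense: "\<exists>z\<in>W. z \<in> N" if W: "open W" "W \<noteq> {}" "W \<subseteq> ball x r" for W
    proof -
      have "open {z \<in> W. Q z \<noteq> 0}" using open_ne[OF cQ(1) W(1,3)] .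
      moreover have "{z \<in> W. Q z \<noteq> 0} \<noteq> {}" using V(5)[OF W(1,2)] W(3) r(2) by blast
      ultimately have "\<exists>z\<in>{z \<in> W. Q z \<noteq> 0}. Q' z \<noteq> 0"
        by (rule V'(5)) (use W(3) r(2) in blast)
      then show ?thesis using W(3) unfolding N_def by blast
    qed
    have "open N"
    proof -
      have "open {z \<in> {z \<in> ball x r. Q z \<noteq> 0}. Q' z \<noteq> 0}"
        by (intro open_ne cQ open_ball) auto
      then show ?thesis by (simp add: N_def conj_assoc)
    qed
    have h: "P z * Q' z - P' z * Q z = 0" if "z \<in> ball x r" for z
    proof (rule holomorphic_vec_ball_identity[of "\<lambda>z. P z * Q' z - P' z * Q z" x r "E \<inter> N"])
      show "holomorphic_vec_on (\<lambda>z. P z * Q' z - P' z * Q z) (ball x r)" by (intro holomorphic_vec_intros hol)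
      show "open (E \<inter> N)" using E(1) \<open>open N\<close> by blast
      have "E \<inter> ball x r \<noteq> {}" using x r(1) by (meson centre_in_ball open_ball open_Int_closure_eq_empty disjoint_iff inf_commute)
      then show "E \<inter> N \<noteq> {}" using dense[of "E \<inter> ball x r"] E(1) by blast
      show "E \<inter> N \<subseteq> ball x r" by (auto simp: N_def)
      fix z assume "z \<in> E \<inter> N"
      then have z: "z \<in> ball x r" "z \<in> V" "z \<in> V'" "Q z \<noteq> 0" "Q' z \<noteq> 0" "F z = G z"
        using r(2) E(2) by (auto simp: N_def)
      then have "P z / Q z = P' z / Q' z" using V(6)[of z] V'(6)[of z] by simp
      with z show "P z * Q' z - P' z * Q z = 0" by (simp add: frac_eq_eq)
    qed (rule that)
    have "N \<subseteq> E"
    proof (rule maxE[OF \<open>open N\<close>])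
      fix z assume "z \<in> N"
      then have z: "z \<in> ball x r" "z \<in> V" "z \<in> V'" "Q z \<noteq> 0" "Q' z \<noteq> 0" using r(2) by (auto simp: N_def)
      have "P z * Q' z = P' z * Q z" using h[OF z(1)] by simp
      then show "F z = G z" using z V(6)[of z] V'(6)[of z] by (simp add: frac_eq_eq)
    qed
    have "ball x r \<subseteq> closure E"
    proof (rule ccontr)
      assume "\<not> ball x r \<subseteq> closure E"
      then obtain z where "z \<in> ball x r - closure E" by blast
      moreover have "open (ball x r - closure E)" by (intro open_Diff open_ball closed_closure)
      ultimately obtain y where "y \<in> ball x r - closure E" "y \<in> N"
        using dense[of "ball x r - closure E"] by blast
      then show False using \<open>N \<subseteq> E\<close> closure_subset[of E] by blast
    qed
    then show ?thesis using r(1) by blast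
  qed
  then have "open (closure E)" unfolding open_contains_ball by blast
  moreover have "U \<subseteq> E" using U by (intro maxE) auto
  then have "closure E \<noteq> {}" using U(2) closure_subset[of E] by blast
  ultimately show ?thesis using clopen[of "closure E"] unfolding E_def by simp
qed

text \<open>Two competitors agree on a dense set, and both are continuous at \<open>p\<close>, so
  their values there coincide. The set \<open>U\<close> provides the open start for the identity
  theorem, because \<open>D\<close> itself may fail to be open.\<close>

lemma meromorphic_continuation_eqI:
  fixes F f :: "complex^'n \<Rightarrow> complex"
  assumes F: "meromorphic_vec_on F UNIV" "\<And>z. z \<in> D \<Longrightarrow> F z = f z"
    and V: "open V" "p \<in> V" "holomorphic_vec_on F V" and U: "open U" "U \<noteq> {}" "U \<subseteq> D"
  shows "meromorphic_continuation f D p = F p"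
  unfolding meromorphic_continuation_def
proof (rule the_equality)
  show "\<exists>F' V. meromorphic_vec_on F' UNIV \<and> (\<forall>z\<in>D. F' z = f z) \<and> open V \<and> p \<in> V \<and> holomorphic_vec_on F' V \<and> F' p = F p"
    using F V by blast
  fix c assume "\<exists>F V. meromorphic_vec_on F UNIV \<and> (\<forall>z\<in>D. F z = f z) \<and> open V \<and> p \<in> V \<and> holomorphic_vec_on F V \<and> F p = c"
  then obtain G V' where G: "meromorphic_vec_on G UNIV" "\<And>z. z \<in> D \<Longrightarrow> G z = f z"
     "open V'" "p \<in> V'" "holomorphic_vec_on G V'" "G p = c" by blast
  let ?E = "interior {z. F z = G z}"
  have dense: "closure ?E = UNIV"
    by (rule meromorphic_vec_eq_dense[OF F(1) G(1) U(1,2)]) (use F(2) G(2) U(3) in auto)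
  have "F p = G p"
  proof (rule ccontr)
    assume ne: "F p \<noteq> G p"
    have "continuous_on (V \<inter> V') (\<lambda>z. F z - G z)"
      using V(3) G(5) by (intro continuous_on_diff holomorphic_vec_on_continuous) (auto intro: holomorphic_vec_on_subset)
    from continuous_open_preimage[OF this _ open_Compl[OF closed_singleton[of 0]]]
    have "open ((V \<inter> V') \<inter> (\<lambda>z. F z - G z) -` (- {0}))" using V(1) G(3) by blast
    moreover have "p \<in> (V \<inter> V') \<inter> (\<lambda>z. F z - G z) -` (- {0})" using ne V(2) G(4) by simp
    ultimately have "(V \<inter> V') \<inter> (\<lambda>z. F z - G z) -` (- {0}) \<inter> ?E \<noteq> {}"
      using open_Int_closure_eq_empty[of "(V \<inter> V') \<inter> (\<lambda>z. F z - G z) -` (- {0})" ?E] dense by blast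
    then show False using interior_subset[of "{z. F z = G z}"] by auto
  qed
  then show "c = F p" using G(6) by simp
qed

section \<open>Haar measure on the orthogonal group\<close>

text \<open>The shifted window is cut at \<open>c + 2 * pi\<close> and the overhanging piece is
  moved back by one period; the bounds on \<open>\<phi>\<close> make a single cut enough.\<close>

lemma nn_integral_periodic_shift:
  fixes h :: "real \<Rightarrow> ennreal"
  assumes h[measurable]: "h \<in> borel_measurable borel" and per: "\<And>x. h (x + 2 * pi) = h x"
    and phi: "0 \<le> \<phi>" "\<phi> \<le> 2 * pi"
  shows "(\<integral>\<^sup>+x. h x * indicator {c + \<phi>..<c + \<phi> + 2 * pi} x \<partial>lborel) = (\<integral>\<^sup>+x. h x * indicator {c..<c + 2 * pi} x \<partial>lborel)"
proof -
  have "(\<integral>\<^sup>+x. h x * indicator {c + \<phi>..<c + \<phi> + 2 * pi} x \<partial>lborel) =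
     (\<integral>\<^sup>+x. h x * indicator {c + \<phi>..<c + 2 * pi} x + h x * indicator {c + 2 * pi..<c + \<phi> + 2 * pi} x \<partial>lborel)"
    using phi by (intro nn_integral_cong) (auto split: split_indicator)
  also have "\<dots> = (\<integral>\<^sup>+x. h x * indicator {c + \<phi>..<c + 2 * pi} x \<partial>lborel) + (\<integral>\<^sup>+x. h x * indicator {c + 2 * pi..<c + \<phi> + 2 * pi} x \<partial>lborel)"
    by (rule nn_integral_add) auto
  also have "(\<integral>\<^sup>+x. h x * indicator {c + 2 * pi..<c + \<phi> + 2 * pi} x \<partial>lborel) = (\<integral>\<^sup>+x. h x * indicator {c..<c + \<phi>} x \<partial>lborel)"
    using per by (subst nn_integral_real_affine[where c=1 and t="2 * pi"])
      (auto simp: add.commute intro!: nn_integral_cong split: split_indicator)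
  also have "(\<integral>\<^sup>+x. h x * indicator {c + \<phi>..<c + 2 * pi} x \<partial>lborel) + (\<integral>\<^sup>+x. h x * indicator {c..<c + \<phi>} x \<partial>lborel) =
     (\<integral>\<^sup>+x. h x * indicator {c + \<phi>..<c + 2 * pi} x + h x * indicator {c..<c + \<phi>} x \<partial>lborel)"
    by (rule nn_integral_add[symmetric]) auto
  also have "\<dots> = (\<integral>\<^sup>+x. h x * indicator {c..<c + 2 * pi} x \<partial>lborel)"
    using phi by (intro nn_integral_cong) (auto split: split_indicator)
  finally show ?thesis .
qed

text \<open>The window starts at \<open>- (pi / 2)\<close> so that it consists of exactly two
  branches of the tangent.\<close>

definition circle_integral :: "(real \<Rightarrow> ennreal) \<Rightarrow> ennreal" where
  "circle_integral h = (\<integral>\<^sup>+x. h x * indicator {- (pi / 2)..<- (pi / 2) + 2 * pi} x \<partial>lborel)"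

lemma circle_integral_shift:
  assumes h[measurable]: "h \<in> borel_measurable borel" and per: "\<And>x. h (x + 2 * pi) = h x"
    and phi: "0 \<le> \<phi>" "\<phi> \<le> 2 * pi"
  shows "circle_integral (\<lambda>x. h (\<phi> + x)) = circle_integral h"
proof -
  have "(\<integral>\<^sup>+x. h x * indicator {- (pi / 2) + \<phi>..<- (pi / 2) + \<phi> + 2 * pi} x \<partial>lborel) = circle_integral (\<lambda>x. h (\<phi> + x))"
    unfolding circle_integral_def
    by (subst nn_integral_real_affine[where c=1 and t=\<phi>])
      (auto intro!: nn_integral_cong split: split_indicator)
  then show ?thesis using nn_integral_periodic_shift[OF assms, of "- (pi / 2)"] by (simp add: circle_integral_def)
qed

lemma circle_integral_reflect:
  assumes h[measurable]: "h \<in> borel_measurable borel" and per: "\<And>x. h (x + 2 * pi) = h x"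
  shows "circle_integral (\<lambda>x. h (- x)) = circle_integral h"
proof -
  \<comment> \<open>The window from \<open>- 3 * pi / 2\<close> to \<open>pi / 2\<close> is chosen
    because its mirror image is the standard window up to the two endpoints.\<close>
  have "circle_integral h = (\<integral>\<^sup>+x. h x * indicator {- 3 * pi / 2..<- 3 * pi / 2 + 2 * pi} x \<partial>lborel)"
    using nn_integral_periodic_shift[OF assms, of pi "- 3 * pi / 2"] by (simp add: circle_integral_def)
  also have "\<dots> = (\<integral>\<^sup>+x. h (- x) * indicator {- 3 * pi / 2..<- 3 * pi / 2 + 2 * pi} (- x) \<partial>lborel)"
    by (subst nn_integral_real_affine[where c="-1" and t=0]) auto
  also have "\<dots> = circle_integral (\<lambda>x. h (- x))"
    unfolding circle_integral_def
  proof (rule nn_integral_cong_AE)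
    show "AE x in lborel. h (- x) * indicator {- 3 * pi / 2..<- 3 * pi / 2 + 2 * pi} (- x) =
       h (- x) * indicator {- (pi / 2)..<- (pi / 2) + 2 * pi} x"
      using AE_lborel_singleton[of "- (pi / 2)"] AE_lborel_singleton[of "3 * pi / 2"]
      by eventually_elim (auto split: split_indicator)
  qed
  finally show ?thesis by simp
qed

text \<open>Each of the two branches of the tangent in the window is inverted by
  \<open>arctan\<close>, whose derivative is the density; this accounts for the factor 2.\<close>

lemma circle_integral_tan:
  fixes f :: "real \<Rightarrow> ennreal"
  assumes f[measurable]: "f \<in> borel_measurable borel"
  shows "circle_integral (\<lambda>x. f (tan x)) = 2 * (\<integral>\<^sup>+t. ennreal (1 / (1 + t\<^sup>2)) * f t \<partial>lborel)"
proof -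
  have [measurable]: "(tan :: real \<Rightarrow> real) \<in> borel_measurable borel" unfolding tan_def[abs_def] by measurable
  let ?I = "\<integral>\<^sup>+x. f (tan x) * indicator {- (pi / 2)..<pi / 2} x \<partial>lborel"
  have "circle_integral (\<lambda>x. f (tan x)) = (\<integral>\<^sup>+x. f (tan x) * indicator {- (pi / 2)..<pi / 2} x + f (tan x) * indicator {pi / 2..<pi / 2 + pi} x \<partial>lborel)"
    unfolding circle_integral_def by (intro nn_integral_cong) (auto split: split_indicator)
  also have "\<dots> = ?I + (\<integral>\<^sup>+x. f (tan x) * indicator {pi / 2..<pi / 2 + pi} x \<partial>lborel)"
    by (rule nn_integral_add) auto
  also have "(\<integral>\<^sup>+x. f (tan x) * indicator {pi / 2..<pi / 2 + pi} x \<partial>lborel) = ?I"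
    by (subst nn_integral_real_affine[where c=1 and t=pi])
      (auto simp: add.commute[of pi] intro!: nn_integral_cong split: split_indicator)
  also have "?I + ?I = 2 * ?I" by (simp add: mult_2)
  also have "?I = (\<integral>\<^sup>+x. indicator {- (pi / 2)<..<pi / 2} x * f (tan x) \<partial>lborel)"
    by (rule nn_integral_cong_AE, use AE_lborel_singleton[of "- (pi / 2)"] in eventually_elim)
      (auto split: split_indicator)
  also have "\<dots> = (\<integral>\<^sup>+x. f (tan x) \<partial>density lborel (indicator {- (pi / 2)<..<pi / 2}))"
    by (subst nn_integral_density) auto
  also have "density lborel (indicator {- (pi / 2)<..<pi / 2}) = distr (density lborel (\<lambda>x. ennreal (1 / (1 + x\<^sup>2)))) borel arctan"
  proof -
    have rg: "range arctan = {- (pi / 2)<..<pi / 2}"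
    proof (intro equalityI subsetI)
      fix x assume "x \<in> {- (pi / 2)<..<pi / 2}"
      then have "arctan (tan x) = x" by (intro arctan_tan) auto
      then show "x \<in> range arctan" by (metis rangeI)
    next
      fix x assume "x \<in> range arctan"
      then show "x \<in> {- (pi / 2)<..<pi / 2}" using arctan_bounded by auto
    qed
    have "continuous_on UNIV (\<lambda>x::real. 1 / (1 + x\<^sup>2))"
      by (intro continuous_intros) (auto simp: add_nonneg_eq_0_iff)
    moreover have "(arctan has_real_derivative 1 / (1 + x\<^sup>2)) (at x)" for x
      using DERIV_arctan[of x] by (simp add: divide_inverse)
    ultimately show ?thesis
      using distr_density_deriv[of arctan "\<lambda>x. 1 / (1 + x\<^sup>2)"] unfolding rg by (simp add: add_pos_nonneg)
  qed
  also have "(\<integral>\<^sup>+x. f (tan x) \<partial>\<dots>) = (\<integral>\<^sup>+t. ennreal (1 / (1 + t\<^sup>2)) * f t \<partial>lborel)"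
    by (subst nn_integral_distr) (auto simp: nn_integral_density tan_arctan)
  finally show ?thesis .
qed

section \<open>Parametrization of the orthogonal group and its invariant measure\<close>

definition rot :: "real \<Rightarrow> real^2^2" where
  "rot t = mat2 (cos t) (- sin t) (sin t) (cos t)"

text \<open>Of the possible reflections, this one acts from the left on the top row only. Hence
  \<open>rot t\<close> and \<open>refl2 ** rot t\<close> have the same bottom row, and functions of
  the bottom row look the same on both components.\<close>

definition refl2 :: "real^2^2" where
  "refl2 = mat2 (- 1) 0 0 1"

lemma rot_add: "rot a ** rot b = rot (a + b)"
  by (simp add: rot_def mat2_mult cos_add sin_add mat2_eq_iff)

lemma rot_refl2: "rot a ** refl2 = refl2 ** rot (- a)"
  by (simp add: rot_def refl2_def mat2_mult)

lemma refl2_refl2: "refl2 ** (refl2 ** x) = x"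
  by (simp add: matrix_mul_assoc refl2_def mat2_mult flip: mat_eq_mat2)

lemma rot_periodic: "rot (t + 2 * pi) = rot t"
  by (simp add: rot_def)

lemma rot_O2: "rot t \<in> O2" and refl2_O2: "refl2 \<in> O2"
  by (simp_all add: O2_iff rot_def refl2_def)

lemma O2_mult: "g \<in> O2 \<Longrightarrow> h \<in> O2 \<Longrightarrow> g ** h \<in> O2"
  by (simp add: O2_def orthogonal_matrix_mul)

lemma O2_cases:
  assumes "k \<in> O2"
  obtains t where "0 \<le> t" "t < 2 * pi" "k = rot t" | t where "0 \<le> t" "t < 2 * pi" "k = refl2 ** rot t"
proof -
  have k: "(k$1$1)\<^sup>2 + (k$1$2)\<^sup>2 = 1" "(k$2$1)\<^sup>2 + (k$2$2)\<^sup>2 = 1" "k$1$1 * k$2$1 + k$1$2 * k$2$2 = 0"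
    using assms by (auto simp: O2_iff)
  obtain t where t: "0 \<le> t" "t < 2 * pi" "k$2$2 = cos t" "k$2$1 = sin t"
    using sincos_total_2pi[of "k$2$2" "k$2$1"] k(2) by (metis add.commute)
  define e where "e = k$1$1 * k$2$2 - k$1$2 * k$2$1"
  have "e\<^sup>2 = 1" unfolding e_def using k by algebra
  then have e: "e = 1 \<or> e = -1" by (simp add: power2_eq_1_iff)
  have "k$1$1 = e * k$2$2" "k$1$2 = - e * k$2$1" unfolding e_def using k by algebra+
  then have "e = 1 \<Longrightarrow> k = rot t" "e = -1 \<Longrightarrow> k = refl2 ** rot t"
    using t(3,4) by (auto simp: rot_def refl2_def mat2_mult mat2_eq_iff)
  with e t(1,2) that show thesis by blast
qed

lemma measurable_matrix_mult [measurable]: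
  fixes f g :: "'a \<Rightarrow> real^2^2"
  assumes "f \<in> borel_measurable M" "g \<in> borel_measurable M"
  shows "(\<lambda>x. f x ** g x) \<in> borel_measurable M"
proof -
  have "continuous_on UNIV (\<lambda>p :: (real^2^2) \<times> (real^2^2). fst p ** snd p)"
    unfolding matrix_matrix_mult_def by (intro continuous_intros continuous_on_vec_lambda)
  then have "(\<lambda>p :: (real^2^2) \<times> (real^2^2). fst p ** snd p) \<in> borel_measurable borel"
    by (rule borel_measurable_continuous_onI)
  from measurable_compose[OF _ this, of "\<lambda>x. (f x, g x)"] show ?thesis
    using assms by (simp add: borel_measurable_Pair)
qed

lemma measurable_mat_nth [measurable]:
  fixes f :: "'a \<Rightarrow> real^2^2"
  assumes "f \<in> borel_measurable M"
  shows "(\<lambda>x. f x $ i $ j) \<in> borel_measurable M"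
proof -
  have "continuous_on UNIV (\<lambda>x :: real^2^2. x $ i $ j)" by (intro continuous_intros)
  from measurable_compose[OF assms borel_measurable_continuous_onI[OF this]] show ?thesis .
qed

lemma measurable_rot [measurable]: "rot \<in> borel_measurable borel"
proof -
  have "rot = (\<lambda>t. cos t *\<^sub>R mat2 1 0 0 1 + sin t *\<^sub>R mat2 0 (- 1) 1 0)"
    by (auto simp: rot_def mat2_eq_iff)
  moreover have "continuous_on UNIV (\<lambda>t::real. cos t *\<^sub>R mat2 1 0 0 1 + sin t *\<^sub>R mat2 0 (- 1) 1 0)"
    by (intro continuous_intros)
  ultimately show ?thesis by (simp only: borel_measurable_continuous_onI)
qed

abbreviation borel_O2 :: "(real^2^2) measure" where
  "borel_O2 \<equiv> restrict_space borel O2"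

lemma measurable_O2I: "f \<in> borel_measurable M \<Longrightarrow> (\<And>x. x \<in> space M \<Longrightarrow> f x \<in> O2) \<Longrightarrow> f \<in> M \<rightarrow>\<^sub>M borel_O2"
  by (intro measurable_restrict_space2) auto

lemma measurable_rot_O2: "rot \<in> borel \<rightarrow>\<^sub>M borel_O2" "(\<lambda>t. refl2 ** rot t) \<in> borel \<rightarrow>\<^sub>M borel_O2"
  by (auto intro!: measurable_O2I simp: rot_O2 refl2_O2 O2_mult)

lemma measurable_O2_mult: "k \<in> O2 \<Longrightarrow> (\<lambda>x. k ** x) \<in> borel_O2 \<rightarrow>\<^sub>M borel_O2" "k \<in> O2 \<Longrightarrow> (\<lambda>x. x ** k) \<in> borel_O2 \<rightarrow>\<^sub>M borel_O2"
  by (rule measurable_O2I; auto intro!: measurable_matrix_mult measurable_restrict_space1 simp: O2_mult space_restrict_space)+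

text \<open>The two halves of the parameter interval of length \<open>4 * pi\<close> sweep the two components of \<open>O2\<close>.\<close>

definition O2_measure :: "(real^2^2) measure" where
  "O2_measure = distr (density lborel (\<lambda>t. ennreal (1 / (4 * pi)) * indicator {- (pi / 2)..<- (pi / 2) + 4 * pi} t)) borel_O2
     (\<lambda>t. if t < - (pi / 2) + 2 * pi then rot t else refl2 ** rot t)"

lemma sets_O2_measure [simp, measurable_cong]: "sets O2_measure = sets borel_O2"
  by (simp add: O2_measure_def)

lemma space_O2_measure [simp]: "space O2_measure = O2"
  by (simp add: O2_measure_def space_restrict_space)

lemma nn_integral_O2_measure:
  assumes f: "f \<in> borel_measurable borel_O2"
  shows "(\<integral>\<^sup>+x. f x \<partial>O2_measure) = ennreal (1 / (4 * pi)) *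
     (circle_integral (\<lambda>t. f (rot t)) + circle_integral (\<lambda>t. f (refl2 ** rot t)))"
proof -
  have [measurable]: "(\<lambda>t. f (rot t)) \<in> borel_measurable borel" "(\<lambda>t. f (refl2 ** rot t)) \<in> borel_measurable borel"
    using measurable_compose[OF measurable_rot_O2(1) f] measurable_compose[OF measurable_rot_O2(2) f] by auto
  let ?K = "\<lambda>t. if t < - (pi / 2) + 2 * pi then rot t else refl2 ** rot t"
  have K: "?K \<in> borel \<rightarrow>\<^sub>M borel_O2"
    by (rule measurable_If[OF measurable_rot_O2]) measurable
  have [measurable]: "(\<lambda>t. f (?K t)) \<in> borel_measurable borel" using measurable_compose[OF K f] .
  have "(\<integral>\<^sup>+x. f x \<partial>O2_measure) = (\<integral>\<^sup>+t. (ennreal (1 / (4 * pi)) * indicator {- (pi / 2)..<- (pi / 2) + 4 * pi} t) * f (?K t) \<partial>lborel)"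
    unfolding O2_measure_def using K f by (subst nn_integral_distr) (simp_all add: nn_integral_density)
  also have "\<dots> = (\<integral>\<^sup>+t. ennreal (1 / (4 * pi)) * (f (rot t) * indicator {- (pi / 2)..<- (pi / 2) + 2 * pi} t +
      f (refl2 ** rot t) * indicator {- (pi / 2) + 2 * pi..<- (pi / 2) + 2 * pi + 2 * pi} t) \<partial>lborel)"
    by (intro nn_integral_cong) (auto split: split_indicator)
  also have "\<dots> = ennreal (1 / (4 * pi)) * ((\<integral>\<^sup>+t. f (rot t) * indicator {- (pi / 2)..<- (pi / 2) + 2 * pi} t \<partial>lborel) +
      (\<integral>\<^sup>+t. f (refl2 ** rot t) * indicator {- (pi / 2) + 2 * pi..<- (pi / 2) + 2 * pi + 2 * pi} t \<partial>lborel))"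
    by (subst nn_integral_cmult, simp) (subst nn_integral_add, auto)
  also have "(\<integral>\<^sup>+t. f (refl2 ** rot t) * indicator {- (pi / 2) + 2 * pi..<- (pi / 2) + 2 * pi + 2 * pi} t \<partial>lborel) = circle_integral (\<lambda>t. f (refl2 ** rot t))"
    unfolding circle_integral_def by (rule nn_integral_periodic_shift) (auto simp: rot_periodic)
  finally show ?thesis by (simp add: circle_integral_def)
qed

lemma prob_space_O2_measure: "prob_space O2_measure"
proof
  have c: "circle_integral (\<lambda>t. 1) = ennreal (2 * pi)" unfolding circle_integral_def by simp
  have "(\<integral>\<^sup>+x. 1 \<partial>O2_measure) = ennreal (1 / (4 * pi)) * (ennreal (2 * pi) + ennreal (2 * pi))"
    by (subst nn_integral_O2_measure) (auto simp: c)
  also have "\<dots> = 1" by (simp flip: ennreal_plus ennreal_mult)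
  finally show "emeasure O2_measure (space O2_measure) = 1" by simp
qed

text \<open>Rotations and \<open>refl2\<close> suffice, by \<open>O2_cases\<close>. Rotations shift
  the two circles, \<open>refl2\<close> on the left exchanges them, and \<open>refl2\<close> on the
  right exchanges and reflects them. Right invariance is used for the uniqueness of Haar measure and
  again to eliminate a variable of the period.\<close>

lemma nn_integral_O2_invariant:
  assumes f: "f \<in> borel_measurable borel_O2" and k: "k \<in> O2"
  shows "(\<integral>\<^sup>+x. f (k ** x) \<partial>O2_measure) = (\<integral>\<^sup>+x. f x \<partial>O2_measure)"
    and "(\<integral>\<^sup>+x. f (x ** k) \<partial>O2_measure) = (\<integral>\<^sup>+x. f x \<partial>O2_measure)"
proof -
  have m: "(\<lambda>t. f (rot t)) \<in> borel_measurable borel" "(\<lambda>t. f (refl2 ** rot t)) \<in> borel_measurable borel" if "f \<in> borel_measurable borel_O2" for f :: "real^2^2 \<Rightarrow> ennreal"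
    using measurable_compose[OF measurable_rot_O2(1) that] measurable_compose[OF measurable_rot_O2(2) that] by auto
  have mk: "(\<lambda>x. f (k ** x)) \<in> borel_measurable borel_O2" "(\<lambda>x. f (x ** k)) \<in> borel_measurable borel_O2"
    if "f \<in> borel_measurable borel_O2" "k \<in> O2" for f :: "real^2^2 \<Rightarrow> ennreal" and k
    using measurable_compose[OF measurable_O2_mult(1)[OF that(2)] that(1)] measurable_compose[OF measurable_O2_mult(2)[OF that(2)] that(1)] by auto
  have lD: "(\<integral>\<^sup>+x. f (refl2 ** x) \<partial>O2_measure) = (\<integral>\<^sup>+x. f x \<partial>O2_measure)"
    if f: "f \<in> borel_measurable borel_O2" for f
    using mk[OF f refl2_O2] f by (simp add: nn_integral_O2_measure refl2_refl2 add.commute)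
  have rD: "(\<integral>\<^sup>+x. f (x ** refl2) \<partial>O2_measure) = (\<integral>\<^sup>+x. f x \<partial>O2_measure)"
    if f: "f \<in> borel_measurable borel_O2" for f
    using mk[OF f refl2_O2] f circle_integral_reflect[OF m(1)[OF f]] circle_integral_reflect[OF m(2)[OF f]]
    by (simp add: nn_integral_O2_measure refl2_refl2 add.commute rot_refl2 rot_periodic matrix_mul_assoc[symmetric])
  have rR: "(\<integral>\<^sup>+x. f (x ** rot a) \<partial>O2_measure) = (\<integral>\<^sup>+x. f x \<partial>O2_measure)"
    if f: "f \<in> borel_measurable borel_O2" and a: "0 \<le> a" "a < 2 * pi" for f a
    using mk[OF f rot_O2] f circle_integral_shift[OF m(1)[OF f] _ a(1)] circle_integral_shift[OF m(2)[OF f] _ a(1)] a(2)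
    by (simp add: nn_integral_O2_measure rot_add rot_periodic matrix_mul_assoc[symmetric] add.commute[of _ a])
  have lR: "(\<integral>\<^sup>+x. f (rot a ** x) \<partial>O2_measure) = (\<integral>\<^sup>+x. f x \<partial>O2_measure)"
    if f: "f \<in> borel_measurable borel_O2" and a: "0 \<le> a" "a < 2 * pi" for f a
  proof -
    \<comment> \<open>On the reflected component a left rotation runs backwards;
      \<open>2 * pi - a\<close> replaces \<open>- a\<close> to stay in the range allowed for
      \<open>circle_integral_shift\<close>.\<close>
    have e: "rot a ** (refl2 ** rot t) = refl2 ** rot ((2 * pi - a) + t)" for t
    proof -
      have "rot a ** (refl2 ** rot t) = refl2 ** rot (- a + t)"
        by (simp add: matrix_mul_assoc rot_refl2) (simp add: rot_add matrix_mul_assoc[symmetric])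
      also have "rot (- a + t) = rot ((2 * pi - a) + t)" using rot_periodic[of "- a + t"] by (simp add: algebra_simps)
      finally show ?thesis .
    qed
    show ?thesis
      using mk[OF f rot_O2] f circle_integral_shift[OF m(1)[OF f] _ a(1)]
        circle_integral_shift[OF m(2)[OF f], of "2 * pi - a"] a
      by (simp add: nn_integral_O2_measure rot_add e rot_periodic)
  qed
  show "(\<integral>\<^sup>+x. f (k ** x) \<partial>O2_measure) = (\<integral>\<^sup>+x. f x \<partial>O2_measure)"
    using k
  proof (cases rule: O2_cases)
    case (2 t)
    then show ?thesis using lR[OF mk(1)[OF f refl2_O2] 2(1,2)] lD[OF f] by (simp add: matrix_mul_assoc[symmetric])
  qed (use lR[OF f] in auto)
  show "(\<integral>\<^sup>+x. f (x ** k) \<partial>O2_measure) = (\<integral>\<^sup>+x. f x \<partial>O2_measure)"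
    using k
  proof (cases rule: O2_cases)
    case (2 t)
    then show ?thesis using rD[OF mk(2)[OF f rot_O2]] rR[OF f 2(1,2)] by (simp add: matrix_mul_assoc)
  qed (use rR[OF f] in auto)
qed

lemma distr_O2_measure:
  assumes k: "k \<in> O2"
  shows "distr O2_measure O2_measure (\<lambda>x. k ** x) = O2_measure" "distr O2_measure O2_measure (\<lambda>x. x ** k) = O2_measure"
proof -
  have *: "distr O2_measure O2_measure T = O2_measure"
    if T: "T \<in> borel_O2 \<rightarrow>\<^sub>M borel_O2"
      and inv: "\<And>f. f \<in> borel_measurable borel_O2 \<Longrightarrow> (\<integral>\<^sup>+x. f (T x) \<partial>O2_measure) = (\<integral>\<^sup>+x. f x \<partial>O2_measure)" for T
  proof (rule measure_eqI)
    fix A assume "A \<in> sets (distr O2_measure O2_measure T)"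
    then have A: "A \<in> sets borel_O2" by simp
    have T': "T \<in> O2_measure \<rightarrow>\<^sub>M O2_measure" using T by (simp cong: measurable_cong_sets)
    have "emeasure (distr O2_measure O2_measure T) A = (\<integral>\<^sup>+x. indicator A x \<partial>distr O2_measure O2_measure T)"
      using A by simp
    also have "\<dots> = (\<integral>\<^sup>+x. indicator A (T x) \<partial>O2_measure)"
      using A by (intro nn_integral_distr[OF T']) simp
    also have "\<dots> = (\<integral>\<^sup>+x. indicator A x \<partial>O2_measure)" using A by (intro inv) simp
    finally show "emeasure (distr O2_measure O2_measure T) A = emeasure O2_measure A" using A by simp
  qed simp
  show "distr O2_measure O2_measure (\<lambda>x. k ** x) = O2_measure" "distr O2_measure O2_measure (\<lambda>x. x ** k) = O2_measure"
    using measurable_O2_mult[OF k] nn_integral_O2_invariant[OF _ k] by (auto intro!: *)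
qed

text \<open>Uniqueness by integrating the indicator of \<open>A\<close> at \<open>x ** y\<close>
  over the product of the two measures: left invariance of \<open>N\<close> gives \<open>N\<close>
  of \<open>A\<close> in one order, right invariance of \<open>O2_measure\<close> gives its own
  value of \<open>A\<close> in the other.\<close>

lemma haar_prob_O2: "haar_prob O2 = O2_measure"
  unfolding haar_prob_def
proof (rule the_equality)
  show "sets O2_measure = sets (restrict_space borel O2) \<and> prob_space O2_measure \<and> (\<forall>k\<in>O2. distr O2_measure O2_measure (\<lambda>x. k ** x) = O2_measure)"
    by (simp add: prob_space_O2_measure distr_O2_measure)
  fix N assume N: "sets N = sets (restrict_space borel O2) \<and> prob_space N \<and> (\<forall>k\<in>O2. distr N N (\<lambda>x. k ** x) = N)"
  interpret N: prob_space N using N by blast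
  interpret O: prob_space O2_measure by (rule prob_space_O2_measure)
  interpret P: pair_sigma_finite O2_measure N by unfold_locales
  have sN[measurable_cong]: "sets N = sets borel_O2" using N by simp
  then have spN: "space N = O2" using sets_eq_imp_space_eq[OF sN] by (simp add: space_restrict_space)
  show "N = O2_measure"
  proof (rule measure_eqI)
    fix A assume "A \<in> sets N"
    then have A[measurable]: "A \<in> sets borel_O2" using sN by simp
    have mm: "(\<lambda>p. fst p ** snd p) \<in> (O2_measure \<Otimes>\<^sub>M N) \<rightarrow>\<^sub>M borel_O2"
    proof (rule measurable_O2I)
      have id: "(\<lambda>x. x) \<in> borel_measurable O2_measure" "(\<lambda>x. x) \<in> borel_measurable N"
        by (simp_all add: measurable_cong_sets[OF sets_O2_measure refl] measurable_cong_sets[OF sN refl] measurable_restrict_space1)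
      show "(\<lambda>p. fst p ** snd p) \<in> borel_measurable (O2_measure \<Otimes>\<^sub>M N)"
        using measurable_compose[OF measurable_fst id(1)] measurable_compose[OF measurable_snd id(2)] by (rule measurable_matrix_mult)
    qed (auto simp: space_pair_measure spN O2_mult)
    then have fm: "(\<lambda>p. indicator A (fst p ** snd p) :: ennreal) \<in> borel_measurable (O2_measure \<Otimes>\<^sub>M N)"
      using measurable_compose[OF mm borel_measurable_indicator[OF A]] by simp
    have inv: "(\<integral>\<^sup>+y. indicator A (x ** y) \<partial>N) = emeasure N A" if x: "x \<in> O2" for x
    proof -
      have T: "(\<lambda>y. x ** y) \<in> N \<rightarrow>\<^sub>M N" using measurable_O2_mult(1)[OF x] sN by (simp cong: measurable_cong_sets)
      have "emeasure N A = (\<integral>\<^sup>+y. indicator A y \<partial>distr N N (\<lambda>y. x ** y))" using N x A sN by simp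
      also have "\<dots> = (\<integral>\<^sup>+y. indicator A (x ** y) \<partial>N)" using A sN by (intro nn_integral_distr[OF T]) simp
      finally show ?thesis by simp
    qed
    have "emeasure N A = (\<integral>\<^sup>+x. emeasure N A \<partial>O2_measure)" using O.emeasure_space_1 by simp
    also have "\<dots> = (\<integral>\<^sup>+x. \<integral>\<^sup>+y. indicator A (x ** y) \<partial>N \<partial>O2_measure)"
      by (intro nn_integral_cong) (simp add: inv)
    also have "\<dots> = (\<integral>\<^sup>+y. \<integral>\<^sup>+x. indicator A (x ** y) \<partial>O2_measure \<partial>N)"
      using P.Fubini'[of "\<lambda>x y. indicator A (x ** y)"] fm by (simp add: case_prod_beta)
    also have "\<dots> = (\<integral>\<^sup>+y. emeasure O2_measure A \<partial>N)"
    proof (intro nn_integral_cong)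
      fix y assume "y \<in> space N"
      then have "(\<integral>\<^sup>+x. indicator A (x ** y) \<partial>O2_measure) = (\<integral>\<^sup>+x. indicator A x \<partial>O2_measure)"
        using A by (intro nn_integral_O2_invariant(2)) (auto simp: spN)
      then show "(\<integral>\<^sup>+x. indicator A (x ** y) \<partial>O2_measure) = emeasure O2_measure A" using A by simp
    qed
    also have "\<dots> = emeasure O2_measure A" using N.emeasure_space_1 by simp
    finally show "emeasure N A = emeasure O2_measure A" .
  qed (simp add: sN)
qed

text \<open>On both components the bottom row is \<open>(sin t, cos t)\<close> with a uniform angle,
  so the quotient of its entries has the Cauchy distribution. Two circles with two branches each
  turn \<open>1 / (4 * pi)\<close> into \<open>1 / pi\<close>.\<close>

lemma distr_tan_O2:
  "distr O2_measure borel (\<lambda>g. g$2$1 / g$2$2) = density lborel (\<lambda>t. ennreal (1 / (pi * (1 + t\<^sup>2))))"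
proof (rule measure_eqI)
  have [measurable]: "(\<lambda>g :: real^2^2. g$2$1 / g$2$2) \<in> borel_measurable borel" by measurable
  then have m: "(\<lambda>g :: real^2^2. g$2$1 / g$2$2) \<in> borel_measurable borel_O2" by (rule measurable_restrict_space1)
  fix A assume "A \<in> sets (distr O2_measure borel (\<lambda>g. g$2$1 / g$2$2))"
  then have A[measurable]: "A \<in> sets borel" by simp
  have "emeasure (distr O2_measure borel (\<lambda>g. g$2$1 / g$2$2)) A = (\<integral>\<^sup>+x. indicator A x \<partial>distr O2_measure borel (\<lambda>g. g$2$1 / g$2$2))"
    by simp
  also have "\<dots> = (\<integral>\<^sup>+g. indicator A (g$2$1 / g$2$2) \<partial>O2_measure)"
    using m by (intro nn_integral_distr) auto
  also have "\<dots> = ennreal (1 / (4 * pi)) * (circle_integral (\<lambda>t. indicator A (tan t)) + circle_integral (\<lambda>t. indicator A (tan t)))"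
    using measurable_compose[OF m borel_measurable_indicator[OF A]]
    by (subst nn_integral_O2_measure) (auto simp: rot_def refl2_def mat2_mult tan_def)
  also have "\<dots> = ennreal (1 / pi) * (\<integral>\<^sup>+t. ennreal (1 / (1 + t\<^sup>2)) * indicator A t \<partial>lborel)"
  proof -
    have "ennreal (1 / (4 * pi)) * (2 * x + 2 * x) = ennreal (1 / pi) * x" for x :: ennreal
    proof -
      have "2 * x + 2 * x = ennreal 4 * x" by (simp flip: distrib_right)
      then have "ennreal (1 / (4 * pi)) * (2 * x + 2 * x) = (ennreal (1 / (4 * pi)) * ennreal 4) * x" by (simp add: mult.assoc)
      also have "ennreal (1 / (4 * pi)) * ennreal 4 = ennreal (1 / pi)" by (subst ennreal_mult[symmetric]) auto
      finally show ?thesis .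
    qed
    then show ?thesis by (simp add: circle_integral_tan)
  qed
  also have "\<dots> = (\<integral>\<^sup>+t. ennreal (1 / (pi * (1 + t\<^sup>2))) * indicator A t \<partial>lborel)"
    by (subst nn_integral_cmult[symmetric]) (auto simp: mult.assoc[symmetric] ennreal_mult[symmetric] intro!: nn_integral_cong)
  also have "\<dots> = emeasure (density lborel (\<lambda>t. ennreal (1 / (pi * (1 + t\<^sup>2))))) A"
    by (simp add: emeasure_density)
  finally show "emeasure (distr O2_measure borel (\<lambda>g. g$2$1 / g$2$2)) A = emeasure (density lborel (\<lambda>t. ennreal (1 / (pi * (1 + t\<^sup>2))))) A" .
qed simp

text \<open>This removes the points where the tangent coordinate breaks down: division by 0 gives 0
  there, and \<open>wedge\<close> no longer factors through the quotient of the bottom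
  entries.\<close>

lemma AE_O2_nth_nonzero: "AE g in O2_measure. g$2$2 \<noteq> 0"
proof -
  have m: "(\<lambda>g :: real^2^2. indicator {0::real} (g$2$2) :: ennreal) \<in> borel_measurable borel_O2"
    by (intro measurable_restrict_space1) measurable
  have "circle_integral (\<lambda>t. indicator {0} (cos t)) = 0"
  proof -
    have fin: "{t. \<bar>t\<bar> \<le> 2 * pi \<and> cos t = 0} \<subseteq> {- (3 * pi / 2), - (pi / 2), pi / 2, 3 * pi / 2}"
    proof
      fix t assume "t \<in> {t. \<bar>t\<bar> \<le> 2 * pi \<and> cos t = 0}"
      then have t: "\<bar>t\<bar> \<le> 2 * pi" "cos t = 0" by auto
      obtain n :: int where n: "odd n" "t = of_int n * (pi / 2)" using t(2) unfolding cos_zero_iff_int by blast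
      have "\<bar>real_of_int n\<bar> * (pi / 2) \<le> 4 * (pi / 2)" using t(1) n(2) by (simp add: abs_mult)
      then have "\<bar>n\<bar> \<le> 4" by (simp only: mult_le_cancel_right) (simp add: not_less)
      then have "n \<in> {-4..4}" by auto
      also have "{-4..4} = {-4, -3, -2, -1, 0, 1, 2, 3, 4 :: int}" by auto
      finally show "t \<in> {- (3 * pi / 2), - (pi / 2), pi / 2, 3 * pi / 2}" using n by auto
    qed
    have "AE t in lborel. indicator {0} (cos t) * indicator {- (pi / 2)..<- (pi / 2) + 2 * pi} t = (0 :: ennreal)"
      using AE_lborel_singleton[of "- (3 * pi / 2)"] AE_lborel_singleton[of "- (pi / 2)"]
        AE_lborel_singleton[of "pi / 2"] AE_lborel_singleton[of "3 * pi / 2"]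
    proof eventually_elim
      case (elim t)
      have "cos t \<noteq> 0" if "t \<in> {- (pi / 2)..<- (pi / 2) + 2 * pi}"
      proof -
        have "- (pi / 2) \<le> t" "t < 3 * pi / 2" using that by auto
        then have "\<bar>t\<bar> \<le> 2 * pi" using pi_gt_zero by linarith
        then show ?thesis using subsetD[OF fin, of t] elim that by auto
      qed
      then show ?case by (auto split: split_indicator)
    qed
    from nn_integral_cong_AE[OF this] show ?thesis unfolding circle_integral_def by simp
  qed
  then have "(\<integral>\<^sup>+g. indicator {0} (g$2$2) \<partial>O2_measure) = 0"
    by (subst nn_integral_O2_measure[OF m]) (simp add: rot_def refl2_def mat2_mult)
  then have "AE g in O2_measure. indicator {0} (g$2$2) = (0 :: ennreal)"
    using m by (subst (asm) nn_integral_0_iff_AE) (simp_all cong: measurable_cong_sets)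
  then show ?thesis by eventually_elim (auto split: split_indicator_asm)
qed

section \<open>The model period\<close>

lemma matrix_inv_O2: "k \<in> O2 \<Longrightarrow> matrix_inv k = transpose k"
proof -
  assume k: "k \<in> O2"
  then have t: "k ** transpose k = mat 1" "transpose k ** k = mat 1" by (simp_all add: O2_def orthogonal_matrix_def)
  have "k ** matrix_inv k = mat 1 \<and> matrix_inv k ** k = mat 1"
    unfolding matrix_inv_def by (rule someI[of _ "transpose k"]) (simp add: t)
  then have "transpose k ** (k ** matrix_inv k) = transpose k" by simp
  then show ?thesis by (simp add: matrix_mul_assoc t)
qed

text \<open>The determinant of the two bottom rows. On \<open>O2\<close> it is, up to sign, the
  lower left entry of \<open>g ** matrix_inv h\<close>, and it scales by \<open>det k\<close> under
  simultaneous right translation by \<open>k\<close>.\<close>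

definition wedge :: "real^2^2 \<Rightarrow> real^2^2 \<Rightarrow> real" where
  "wedge g h = g$2$1 * h$2$2 - g$2$2 * h$2$1"

lemma wedge_mult: "wedge (g ** k) (h ** k) = wedge g h * det k"
  unfolding wedge_def matrix_mult_2_nth det_2 by algebra

lemma O2_top_row:
  assumes "k \<in> O2" shows "k$1$1 = det k * k$2$2" "k$1$2 = - det k * k$2$1"
  using assms unfolding O2_iff det_2 by algebra+

lemma abs_quotient_nth_O2:
  assumes "g \<in> O2" "h \<in> O2"
  shows "\<bar>(g ** matrix_inv h)$2$1\<bar> = \<bar>wedge g h\<bar>"
proof -
  have "(g ** matrix_inv h)$2$1 = g$2$1 * h$1$1 + g$2$2 * h$1$2"
    using assms by (simp add: matrix_inv_O2 matrix_mult_2_nth transpose_def)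
  also have "\<dots> = det h * wedge g h"
    unfolding O2_top_row[OF assms(2)] wedge_def by (simp add: algebra_simps)
  finally show ?thesis using O2_abs_det[OF assms(2)] by (simp add: abs_mult)
qed

lemma period_kernel_O2:
  assumes "g1 \<in> O2" "g2 \<in> O2" "g3 \<in> O2"
  shows "period_kernel \<Lambda> \<nu> s g1 g2 g3 = of_real \<bar>wedge g1 g2\<bar> powr (- \<Lambda>$2 - \<nu>$2 - s) *
     of_real \<bar>wedge g1 g3\<bar> powr (\<Lambda>$1 + \<nu>$2 + s - 1) * of_real \<bar>wedge g2 g3\<bar> powr (\<Lambda>$2 + \<nu>$1 + s - 1)"
proof -
  have "transpose g2 \<in> O2" using assms by (simp add: O2_def orthogonal_matrix_transpose)
  then have "\<bar>det (g1 ** g2)\<bar> = 1" "\<bar>det (g1 ** matrix_inv g2)\<bar> = 1" "\<bar>det g3\<bar> = 1"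
    using assms by (auto intro!: O2_abs_det O2_mult simp: matrix_inv_O2)
  then show ?thesis
    unfolding period_kernel_def abs_quotient_nth_O2[OF assms(1,2)] abs_quotient_nth_O2[OF assms(1,3)]
      abs_quotient_nth_O2[OF assms(2,3)] by simp
qed

lemma measurable_O2_nth [measurable]:
  assumes "f \<in> M \<rightarrow>\<^sub>M O2_measure"
  shows "(\<lambda>x. f x $ i $ j) \<in> borel_measurable M"
proof -
  have "(\<lambda>x. x) \<in> borel_measurable O2_measure"
    by (simp add: measurable_cong_sets[OF sets_O2_measure refl] measurable_restrict_space1)
  from measurable_mat_nth[OF measurable_compose[OF assms this]] show ?thesis .
qed

lemma measurable_wedge [measurable]:
  assumes [measurable]: "f \<in> M \<rightarrow>\<^sub>M O2_measure" "g \<in> M \<rightarrow>\<^sub>M O2_measure"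
  shows "(\<lambda>x. wedge (f x) (g x)) \<in> borel_measurable M"
  unfolding wedge_def by measurable

text \<open>Lagrange's identity for two unit vectors. The bound makes the period kernel bounded when
  its exponents have nonnegative real part, hence integrable for the probability measure.\<close>

lemma abs_wedge_le_1:
  assumes "g \<in> O2" "h \<in> O2" shows "\<bar>wedge g h\<bar> \<le> 1"
proof -
  have 1: "(g$2$1)\<^sup>2 + (g$2$2)\<^sup>2 = 1" "(h$2$1)\<^sup>2 + (h$2$2)\<^sup>2 = 1" using assms by (auto simp: O2_iff)
  have "(wedge g h)\<^sup>2 + (g$2$1 * h$2$1 + g$2$2 * h$2$2)\<^sup>2 = 1" unfolding wedge_def using 1 by algebra
  then have "(wedge g h)\<^sup>2 \<le> 1" by (smt (verit) zero_le_power2)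
  then show ?thesis by (simp add: abs_square_le_1)
qed

lemma norm_powr_le_1: "0 \<le> x \<Longrightarrow> x \<le> 1 \<Longrightarrow> Re z \<ge> 0 \<Longrightarrow> norm (complex_of_real x powr z) \<le> 1"
  by (simp add: norm_powr_real_powr powr_le1)

lemma integral_O2_right_mult:
  fixes f :: "real^2^2 \<Rightarrow> complex"
  assumes "k \<in> O2" "f \<in> borel_measurable O2_measure"
  shows "(LINT g|O2_measure. f (g ** k)) = (LINT g|O2_measure. f g)"
proof -
  have "(\<lambda>x. x ** k) \<in> O2_measure \<rightarrow>\<^sub>M O2_measure"
    using measurable_O2_mult(2)[OF assms(1)] by (simp cong: measurable_cong_sets)
  from integral_distr[OF this assms(2)] show ?thesis by (simp add: distr_O2_measure[OF assms(1)])
qed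

lemma integral_O2_tan:
  fixes f :: "real \<Rightarrow> complex"
  assumes [measurable]: "f \<in> borel_measurable borel"
  shows "(LINT g|O2_measure. f (g$2$1 / g$2$2)) = (LBINT t. of_real (1 / pi) * (of_real (1 / (1 + t\<^sup>2)) * f t))"
proof -
  have m: "(\<lambda>g. g$2$1 / g$2$2) \<in> borel_measurable O2_measure" by measurable
  have "(LINT g|O2_measure. f (g$2$1 / g$2$2)) = (LINT t|density lborel (\<lambda>t. ennreal (1 / (pi * (1 + t\<^sup>2)))). f t)"
    unfolding distr_tan_O2[symmetric] using m assms by (rule integral_distr[symmetric])
  also have "\<dots> = (LBINT t. (1 / (pi * (1 + t\<^sup>2))) *\<^sub>R f t)"
    by (rule integral_density) (auto simp: add_nonneg_nonneg)
  also have "(\<lambda>t. (1 / (pi * (1 + t\<^sup>2))) *\<^sub>R f t) = (\<lambda>t. of_real (1 / pi) * (of_real (1 / (1 + t\<^sup>2)) * f t))"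
    by (auto simp: scaleR_conv_of_real)
  finally show ?thesis .
qed

text \<open>Symmetric in the three exponents of the kernel, as it should be. The factor
  \<open>1 / pi\<^sup>2\<close> comes from the two densities of the tangent coordinates,
  \<open>sqrt pi\<close> from the Gaussian integral in
  \<open>planar_gaussian_moment\<close>.\<close>

definition period_value :: "complex \<Rightarrow> complex \<Rightarrow> complex \<Rightarrow> complex" where
  "period_value a b c = of_real (1 / pi\<^sup>2) * (of_real (sqrt pi) * Gamma ((c + 1) / 2) * Gamma ((a + 1) / 2) * Gamma ((b + 1) / 2) * Gamma ((a + b + c + 2) / 2) /
      (Gamma ((a + b + 2) / 2) * Gamma ((a + c + 2) / 2) * Gamma ((b + c + 2) / 2)))"

text \<open>With tangent coordinates \<open>p\<close>, \<open>q\<close> of \<open>g\<close>,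
  \<open>h\<close> one has \<open>wedge g h = g$2$2 * h$2$2 * (p - q)\<close>, and
  \<open>\<bar>g$2$2\<bar>\<close> is the power -1/2 of \<open>1 + p\<^sup>2\<close>. The integral
  thereby becomes \<open>triple_product_integral\<close>.\<close>

lemma O2_double_integral:
  assumes abc: "Re a \<ge> 0" "Re b \<ge> 0" "Re c \<ge> 0"
  shows "(LINT g|O2_measure. LINT h|O2_measure.
     of_real \<bar>g$2$2\<bar> powr a * of_real \<bar>h$2$2\<bar> powr b * of_real \<bar>wedge g h\<bar> powr c) = period_value a b c"
proof -
  \<comment> \<open>The kernel contributes \<open>(a + c) / 2\<close> and
    \<open>(b + c) / 2\<close>, as in \<open>H\<close>; the density of the tangent coordinate adds 1
    to each, as in \<open>K\<close>.\<close>
  define u v where "u = (a + c + 2) / 2" and "v = (b + c + 2) / 2"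
  define K where "K = (\<lambda>(p::real, q::real). complex_of_real \<bar>p - q\<bar> powr c * (exp (- u * of_real (ln (1 + p\<^sup>2))) * exp (- v * of_real (ln (1 + q\<^sup>2)))))"
  define H where "H = (\<lambda>p q. complex_of_real \<bar>p - q\<bar> powr c * (exp (- (a + c) / 2 * of_real (ln (1 + p\<^sup>2))) * exp (- (b + c) / 2 * of_real (ln (1 + q\<^sup>2)))))"
  define t where "t = (\<lambda>g::real^2^2. g$2$1 / g$2$2)"
  have e: "u - (c + 1) / 2 = (a + 1) / 2" "v - (c + 1) / 2 = (b + 1) / 2" "u + v - 1 - c / 2 = (a + b + c + 2) / 2"
    "u + v - c - 1 = (a + b + 2) / 2" by (simp_all add: u_def v_def field_simps)
  have K: "has_bochner_integral (lborel \<Otimes>\<^sub>M lborel) K (of_real (sqrt pi) * Gamma ((c + 1) / 2) * Gamma ((a + 1) / 2) * Gamma ((b + 1) / 2) * Gamma ((a + b + c + 2) / 2) /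
      (Gamma ((a + b + 2) / 2) * Gamma u * Gamma v))"
    unfolding K_def using triple_product_integral[of c u v] abc unfolding e by (simp add: u_def v_def)
  have Hm1: "H p \<in> borel_measurable borel" for p unfolding H_def by measurable
  have KH: "K (p, q) = of_real (1 / (1 + p\<^sup>2)) * (of_real (1 / (1 + q\<^sup>2)) * H p q)" for p q
  proof -
    have e1: "complex_of_real (1 / (1 + x\<^sup>2)) = exp (- of_real (ln (1 + x\<^sup>2)))" for x
    proof -
      have "1 / (1 + x\<^sup>2) = exp (- ln (1 + x\<^sup>2))" by (simp add: exp_minus add_pos_nonneg inverse_eq_divide)
      then show ?thesis by (simp only: exp_of_real[symmetric] of_real_minus)
    qed
    have "exp (- u * of_real (ln (1 + p\<^sup>2))) = exp (- of_real (ln (1 + p\<^sup>2))) * exp (- (a + c) / 2 * of_real (ln (1 + p\<^sup>2)))"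
      "exp (- v * of_real (ln (1 + q\<^sup>2))) = exp (- of_real (ln (1 + q\<^sup>2))) * exp (- (b + c) / 2 * of_real (ln (1 + q\<^sup>2)))"
      unfolding mult_exp_exp u_def v_def by (intro arg_cong[where f=exp]; simp add: field_simps)+
    then show ?thesis unfolding K_def H_def prod.case e1 by (simp only: ac_simps)
  qed
  have eq: "of_real \<bar>g$2$2\<bar> powr a * of_real \<bar>h$2$2\<bar> powr b * of_real \<bar>wedge g h\<bar> powr c = H (t g) (t h)"
    if g: "g \<in> O2" "g$2$2 \<noteq> 0" and h: "h \<in> O2" "h$2$2 \<noteq> 0" for g h
  proof -
    have l: "ln (1 + (t k)\<^sup>2) = - 2 * ln \<bar>k$2$2\<bar>" if "k \<in> O2" "k$2$2 \<noteq> 0" for k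
    proof -
      have "1 + (t k)\<^sup>2 = ((k$2$1)\<^sup>2 + (k$2$2)\<^sup>2) / (k$2$2)\<^sup>2" using that(2) by (simp add: t_def field_simps)
      also have "\<dots> = inverse (\<bar>k$2$2\<bar>\<^sup>2)" using that(1) by (simp add: O2_iff inverse_eq_divide)
      finally have e: "1 + (t k)\<^sup>2 = inverse (\<bar>k$2$2\<bar>\<^sup>2)" .
      have l: "ln (inverse (x\<^sup>2)) = - 2 * ln x" if "x > 0" for x :: real
        using that by (simp add: ln_inverse ln_realpow)
      show ?thesis unfolding e by (rule l) (simp add: that(2))
    qed
    have p: "complex_of_real \<bar>x\<bar> powr z = exp (z * of_real (ln \<bar>x\<bar>))" if "x \<noteq> 0" for x z
      using that by (simp add: powr_def Ln_of_real)
    have "wedge g h = g$2$2 * h$2$2 * (t g - t h)"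
      using g(2) h(2) by (simp add: wedge_def t_def field_simps)
    then have "\<bar>wedge g h\<bar> = \<bar>g$2$2\<bar> * \<bar>h$2$2\<bar> * \<bar>t g - t h\<bar>" by (simp only: abs_mult)
    then have "complex_of_real \<bar>wedge g h\<bar> powr c = of_real \<bar>g$2$2\<bar> powr c * of_real \<bar>h$2$2\<bar> powr c * of_real \<bar>t g - t h\<bar> powr c"
      by (simp add: powr_times_real)
    moreover have "exp (- (a + c) / 2 * of_real (ln (1 + (t g)\<^sup>2))) = complex_of_real \<bar>g$2$2\<bar> powr a * of_real \<bar>g$2$2\<bar> powr c"
      unfolding l[OF g] p[OF g(2)] mult_exp_exp by (intro arg_cong[where f=exp]) (simp add: field_simps)
    moreover have "exp (- (b + c) / 2 * of_real (ln (1 + (t h)\<^sup>2))) = complex_of_real \<bar>h$2$2\<bar> powr b * of_real \<bar>h$2$2\<bar> powr c"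
      unfolding l[OF h] p[OF h(2)] mult_exp_exp by (intro arg_cong[where f=exp]) (simp add: field_simps)
    ultimately show ?thesis unfolding H_def by (simp only: ac_simps)
  qed
  interpret O: prob_space O2_measure by (rule prob_space_O2_measure)
  have AEO: "AE g in O2_measure. g \<in> O2 \<and> g$2$2 \<noteq> 0"
    using AE_O2_nth_nonzero AE_space[of O2_measure] by eventually_elim simp
  have "(LINT g|O2_measure. LINT h|O2_measure. of_real \<bar>g$2$2\<bar> powr a * of_real \<bar>h$2$2\<bar> powr b * of_real \<bar>wedge g h\<bar> powr c)
     = (LINT g|O2_measure. LINT h|O2_measure. H (t g) (t h))"
  proof (rule integral_cong_AE)
    show "AE g in O2_measure. (LINT h|O2_measure. of_real \<bar>g$2$2\<bar> powr a * of_real \<bar>h$2$2\<bar> powr b * of_real \<bar>wedge g h\<bar> powr c)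
     = (LINT h|O2_measure. H (t g) (t h))"
      using AEO
    proof eventually_elim
      case (elim g)
      then have [simp]: "g \<in> space O2_measure" by simp
      show ?case
      proof (rule integral_cong_AE)
        show "AE h in O2_measure. of_real \<bar>g$2$2\<bar> powr a * of_real \<bar>h$2$2\<bar> powr b * of_real \<bar>wedge g h\<bar> powr c = H (t g) (t h)"
          using AEO by eventually_elim (use eq elim in blast)
        show "(\<lambda>h. complex_of_real \<bar>g$2$2\<bar> powr a * of_real \<bar>h$2$2\<bar> powr b * of_real \<bar>wedge g h\<bar> powr c) \<in> borel_measurable O2_measure"
          unfolding wedge_def by measurable
        show "(\<lambda>h. H (t g) (t h)) \<in> borel_measurable O2_measure" unfolding H_def t_def by measurable
      qed
    qed
    show "(\<lambda>g. LINT h|O2_measure. complex_of_real \<bar>g$2$2\<bar> powr a * of_real \<bar>h$2$2\<bar> powr b * of_real \<bar>wedge g h\<bar> powr c) \<in> borel_measurable O2_measure"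
      unfolding wedge_def by measurable
    show "(\<lambda>g. LINT h|O2_measure. H (t g) (t h)) \<in> borel_measurable O2_measure" unfolding H_def t_def by measurable
  qed
  also have "\<dots> = (LINT g|O2_measure. (LBINT q. of_real (1 / pi) * (of_real (1 / (1 + q\<^sup>2)) * H (t g) q)))"
    unfolding t_def by (simp only: integral_O2_tan[OF Hm1])
  also have "\<dots> = (LBINT p. of_real (1 / pi) * (of_real (1 / (1 + p\<^sup>2)) * (LBINT q. of_real (1 / pi) * (of_real (1 / (1 + q\<^sup>2)) * H p q))))"
    unfolding t_def by (rule integral_O2_tan, unfold H_def, measurable)
  also have "\<dots> = (LBINT p. of_real (1 / pi\<^sup>2) * (LBINT q. K (p, q)))"
  proof (intro Bochner_Integration.integral_cong refl)
    fix p :: real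
    have "(LBINT q. K (p, q)) = of_real (1 / (1 + p\<^sup>2)) * (LBINT q. of_real (1 / (1 + q\<^sup>2)) * H p q)"
      unfolding KH by (rule integral_mult_right_zero)
    moreover have "(LBINT q. of_real (1 / pi) * (of_real (1 / (1 + q\<^sup>2)) * H p q)) = of_real (1 / pi) * (LBINT q. of_real (1 / (1 + q\<^sup>2)) * H p q)"
      by (rule integral_mult_right_zero)
    ultimately show "of_real (1 / pi) * (of_real (1 / (1 + p\<^sup>2)) * (LBINT q. of_real (1 / pi) * (of_real (1 / (1 + q\<^sup>2)) * H p q)))
       = of_real (1 / pi\<^sup>2) * (LBINT q. K (p, q))"
      by (simp add: power2_eq_square)
  qed
  also have "\<dots> = of_real (1 / pi\<^sup>2) * (LBINT p. (LBINT q. K (p, q)))" by (rule integral_mult_right_zero)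
  also have "(LBINT p. (LBINT q. K (p, q))) = integral\<^sup>L (lborel \<Otimes>\<^sub>M lborel) K"
    using K by (intro lborel_pair.integral_fst') (simp add: has_bochner_integral_iff)
  also have "of_real (1 / pi\<^sup>2) * \<dots> = period_value a b c"
    using K by (simp only: has_bochner_integral_iff period_value_def u_def v_def)
  finally show ?thesis .
qed

text \<open>The kernel is bounded by 1, so Fubini applies on the triple product. By invariance the
  inner double integral is independent of \<open>g1\<close>, and integrating it over a probability
  measure changes nothing.\<close>

lemma period_integral_eq:
  assumes vwu: "\<And>k. k \<in> O2 \<Longrightarrow> v k = 1" "\<And>k. k \<in> O2 \<Longrightarrow> w k = 1" "\<And>k. k \<in> O2 \<Longrightarrow> u k = 1"
    and a: "a = - \<Lambda>$2 - \<nu>$2 - s" and b: "b = \<Lambda>$1 + \<nu>$2 + s - 1" and c: "c = \<Lambda>$2 + \<nu>$1 + s - 1"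
    and abc: "Re a \<ge> 0" "Re b \<ge> 0" "Re c \<ge> 0"
  shows "period_integral \<Lambda> \<nu> s v w u = period_value a b c"
proof -
  interpret O: prob_space O2_measure by (rule prob_space_O2_measure)
  interpret OO: pair_prob_space O2_measure O2_measure by unfold_locales
  interpret OOO: pair_prob_space O2_measure "O2_measure \<Otimes>\<^sub>M O2_measure" by unfold_locales
  define f where "f = (\<lambda>(g1, g2, g3). complex_of_real \<bar>wedge g1 g2\<bar> powr a * of_real \<bar>wedge g1 g3\<bar> powr b * of_real \<bar>wedge g2 g3\<bar> powr c)"
  have f[measurable]: "f \<in> borel_measurable (O2_measure \<Otimes>\<^sub>M (O2_measure \<Otimes>\<^sub>M O2_measure))"
    unfolding f_def case_prod_beta by measurable
  have bound: "norm (f (g1, g2, g3)) \<le> 1" if "g1 \<in> O2" "g2 \<in> O2" "g3 \<in> O2" for g1 g2 g3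
    unfolding f_def prod.case norm_mult
    by (intro mult_le_one norm_powr_le_1 abs_wedge_le_1 abc mult_nonneg_nonneg that) auto
  have int: "integrable (O2_measure \<Otimes>\<^sub>M (O2_measure \<Otimes>\<^sub>M O2_measure)) f"
    by (rule OOO.integrable_const_bound[of _ 1]) (auto intro!: AE_I2 bound simp: space_pair_measure)
  have "period_integral \<Lambda> \<nu> s v w u = integral\<^sup>L (O2_measure \<Otimes>\<^sub>M (O2_measure \<Otimes>\<^sub>M O2_measure)) f"
    unfolding period_integral_def haar_prob_O2
    by (rule Bochner_Integration.integral_cong)
       (auto simp: space_pair_measure f_def period_kernel_O2 vwu a b c)
  also have "\<dots> = (LINT g1|O2_measure. LINT p|(O2_measure \<Otimes>\<^sub>M O2_measure). f (g1, p))"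
    using OOO.integral_fst'[OF int] by simp
  also have "\<dots> = (LINT g1|O2_measure. period_value a b c)"
  proof (rule Bochner_Integration.integral_cong[OF refl])
    fix g1 assume "g1 \<in> space O2_measure"
    then have g1: "g1 \<in> O2" by simp
    have g1s: "g1 \<in> space O2_measure" using g1 by simp
    have fm: "(\<lambda>p. f (g1, p)) \<in> borel_measurable (O2_measure \<Otimes>\<^sub>M O2_measure)"
      using f by (rule measurable_Pair2[OF _ g1s])
    have "integrable (O2_measure \<Otimes>\<^sub>M O2_measure) (\<lambda>p. f (g1, p))"
      using fm by (rule OO.integrable_const_bound[of _ 1, rotated]) (auto intro!: AE_I2 bound g1 simp: space_pair_measure)
    then have "(LINT p|(O2_measure \<Otimes>\<^sub>M O2_measure). f (g1, p)) = (LINT g2|O2_measure. LINT g3|O2_measure. f (g1, g2, g3))"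
      using OO.integral_fst'[of "\<lambda>p. f (g1, p)"] by simp
    also have "\<dots> = (LINT g2|O2_measure. LINT g3|O2_measure. of_real \<bar>g2$2$2\<bar> powr a * of_real \<bar>g3$2$2\<bar> powr b * of_real \<bar>wedge g2 g3\<bar> powr c)"
    proof -
      \<comment> \<open>Translating \<open>g2\<close> and \<open>g3\<close> on the right by \<open>k\<close> removes \<open>g1\<close> from the kernel; the factor \<open>r\<close>
        makes lower right entries appear, so that \<open>integral_O2_tan\<close> applies.\<close>
      define r where "r = mat2 0 1 1 0"
      define k where "k = r ** g1"
      have r: "r \<in> O2" "r ** r = mat 1" by (simp_all add: r_def O2_iff mat2_mult mat_eq_mat2)
      have k: "k \<in> O2" "r ** k = g1" using r g1 by (simp_all add: k_def O2_mult matrix_mul_assoc)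
      have w1: "\<bar>wedge g1 (g ** k)\<bar> = \<bar>g$2$2\<bar>" for g
        unfolding k(2)[symmetric] wedge_mult using O2_abs_det[OF k(1)] by (simp add: abs_mult wedge_def r_def)
      have w2: "\<bar>wedge (g ** k) (h ** k)\<bar> = \<bar>wedge g h\<bar>" for g h
        unfolding wedge_mult using O2_abs_det[OF k(1)] by (simp add: abs_mult)
      have "(LINT g2|O2_measure. LINT g3|O2_measure. f (g1, g2, g3)) = (LINT g2|O2_measure. LINT g3|O2_measure. f (g1, g2 ** k, g3))"
        by (rule integral_O2_right_mult[OF k(1), symmetric]) (use fm in measurable)
      also have "\<dots> = (LINT g2|O2_measure. LINT g3|O2_measure. f (g1, g2 ** k, g3 ** k))"
      proof (rule Bochner_Integration.integral_cong[OF refl])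
        fix g2 assume "g2 \<in> space O2_measure"
        then have "g2 ** k \<in> space O2_measure" using k(1) by (simp add: O2_mult)
        then have "(\<lambda>g3. f (g1, g2 ** k, g3)) \<in> borel_measurable O2_measure"
          using measurable_Pair2[OF fm] by simp
        then show "(LINT g3|O2_measure. f (g1, g2 ** k, g3)) = (LINT g3|O2_measure. f (g1, g2 ** k, g3 ** k))"
          by (rule integral_O2_right_mult[OF k(1), symmetric])
      qed
      finally show ?thesis by (simp add: f_def w1 w2)
    qed
    also have "\<dots> = period_value a b c" by (rule O2_double_integral[OF abc])
    finally show "(LINT p|(O2_measure \<Otimes>\<^sub>M O2_measure). f (g1, p)) = period_value a b c" .
  qed
  also have "\<dots> = period_value a b c" using O.prob_space by simp
  finally show ?thesis .
qed

section \<open>Continuation of the spherical period and comparison\<close>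

lemma vector_4:
  "(vector [a, b, c, d] :: 'a::zero^4) $ 1 = a" "(vector [a, b, c, d] :: 'a^4) $ 2 = b"
  "(vector [a, b, c, d] :: 'a^4) $ 3 = c" "(vector [a, b, c, d] :: 'a^4) $ 4 = d"
  unfolding vector_def by simp_all

text \<open>The arguments are the exponents of the kernel after \<open>\<nu>$2\<close> has been
  eliminated by the relation that all four parameters sum to 0.\<close>

definition period_continuation :: "complex^4 \<Rightarrow> complex" where
  "period_continuation z = period_value (z$1 + z$3 - z$4) (- z$2 - z$3 + z$4 - 1) (z$2 + z$3 + z$4 - 1)"

text \<open>Denominators are turned into the entire function \<open>rGamma\<close>. The shapes
  \<open>* (1 / 2)\<close> and \<open>0 - z$2\<close> avoid division and unary minus, so that
  \<open>holomorphic_vec_intros\<close> applies literally.\<close>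

lemma period_continuation_eq:
  "period_continuation z = of_real (1 / pi\<^sup>2) * of_real (sqrt pi) *
    (Gamma ((z$1 + z$3 - z$4 + 1) * (1 / 2)) * Gamma ((0 - z$2 - z$3 + z$4) * (1 / 2)) *
     Gamma ((z$2 + z$3 + z$4) * (1 / 2)) * Gamma ((z$1 + z$3 + z$4) * (1 / 2))) *
    (rGamma ((z$1 - z$2 + 1) * (1 / 2)) * rGamma ((z$1 + z$2 + 2 * z$3 + 1) * (1 / 2)) * rGamma (z$4))"
proof -
  have e: "(z$1 + z$3 - z$4 + 1) / 2 = (z$1 + z$3 - z$4 + 1) * (1 / 2)"
    "(z$1 + z$3 - z$4 + (- z$2 - z$3 + z$4 - 1) + 2) / 2 = (z$1 - z$2 + 1) * (1 / 2)"
    "(z$1 + z$3 - z$4 + (z$2 + z$3 + z$4 - 1) + 2) / 2 = (z$1 + z$2 + 2 * z$3 + 1) * (1 / 2)"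
    "(- z$2 - z$3 + z$4 - 1 + (z$2 + z$3 + z$4 - 1) + 2) / 2 = z$4"
    "(z$1 + z$3 - z$4 + (- z$2 - z$3 + z$4 - 1) + (z$2 + z$3 + z$4 - 1) + 2) / 2 = (z$1 + z$3 + z$4) * (1 / 2)"
    "(- z$2 - z$3 + z$4 - 1 + 1) / 2 = (0 - z$2 - z$3 + z$4) * (1 / 2)"
    "(z$2 + z$3 + z$4 - 1 + 1) / 2 = (z$2 + z$3 + z$4) * (1 / 2)"
    by (simp_all add: field_simps)
  have aux: "k * (s * c * a * b * d / (u * v * w)) = k * s * (a * b * c * d) * (inverse u * inverse v * inverse w)"
    for k s a b c d u v w :: complex
    by (simp add: divide_inverse)
  show ?thesis unfolding period_continuation_def period_value_def e rGamma_inverse_Gamma by (rule aux)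
qed

text \<open>One global quotient of entire functions serves at every point: each \<open>Gamma\<close>
  in the numerator is the inverse of an \<open>rGamma\<close>. The denominator vanishes only where
  one of four affine functions takes a real value.\<close>

lemma period_continuation_meromorphic: "meromorphic_vec_on period_continuation UNIV"
  unfolding meromorphic_vec_on_def
proof
  fix p :: "complex^4"
  let ?P = "\<lambda>z :: complex^4. of_real (1 / pi\<^sup>2) * of_real (sqrt pi) *
    (rGamma ((z$1 - z$2 + 1) * (1 / 2)) * rGamma ((z$1 + z$2 + 2 * z$3 + 1) * (1 / 2)) * rGamma (z$4))"
  let ?Q = "\<lambda>z :: complex^4. rGamma ((z$1 + z$3 - z$4 + 1) * (1 / 2)) * rGamma ((0 - z$2 - z$3 + z$4) * (1 / 2)) *
     rGamma ((z$2 + z$3 + z$4) * (1 / 2)) * rGamma ((z$1 + z$3 + z$4) * (1 / 2))"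
  have rG: "holomorphic_vec_on (\<lambda>z. rGamma (f z)) UNIV" if "holomorphic_vec_on f UNIV" for f :: "complex^4 \<Rightarrow> complex"
    using that by (rule holomorphic_vec_on_compose) (rule field_differentiable_rGamma)
  have hol: "holomorphic_vec_on ?P UNIV" "holomorphic_vec_on ?Q UNIV"
    by (intro holomorphic_vec_intros rG)+
  have nondeg: "\<exists>z\<in>W. ?Q z \<noteq> 0" if W: "open W" "W \<noteq> {}" for W
  proof -
    obtain x where x: "x \<in> W" using W(2) by blast
    \<comment> \<open>Moving the last coordinate in the imaginary direction changes the imaginary
      part of all four arguments, so only four values of \<open>r\<close> make one of them real.
      Infinitely many admissible \<open>r\<close> remain in the open set.\<close>
    define y where "y = (\<lambda>r::real. x + r *\<^sub>R axis 4 \<i>)"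
    have "continuous_on UNIV y" unfolding y_def by (intro continuous_intros)
    then have "open (y -` W)" using W(1) by (rule open_vimage[rotated])
    moreover have "y 0 = x" by (simp add: y_def)
    then have "0 \<in> y -` W" using x by simp
    ultimately have "infinite (y -` W)" using finite_imp_not_open[of "y -` W"] by blast
    then have "infinite (y -` W - {Im (x$1 + x$3 - x$4), Im (x$2 + x$3 - x$4), Im (- x$2 - x$3 - x$4), Im (- x$1 - x$3 - x$4)})"
      by simp
    from infinite_imp_nonempty[OF this]
    obtain r where r: "y r \<in> W" "r \<noteq> Im (x$1 + x$3 - x$4)" "r \<noteq> Im (x$2 + x$3 - x$4)" "r \<noteq> Im (- x$2 - x$3 - x$4)" "r \<noteq> Im (- x$1 - x$3 - x$4)"
      by blast
    have im: "rGamma c \<noteq> 0" if "Im c \<noteq> 0" for c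
      using that by (auto simp: rGamma_eq_zero_iff elim!: nonpos_Ints_cases)
    have yn: "y r $ 1 = x$1" "y r $ 2 = x$2" "y r $ 3 = x$3" "y r $ 4 = x$4 + \<i> * of_real r"
      by (simp_all add: y_def axis_def complex_eq_iff)
    have "?Q (y r) \<noteq> 0" unfolding mult_eq_0_iff de_Morgan_disj yn
      by (intro conjI im) (use r(2-) in auto)
    then show ?thesis using r(1) by blast
  qed
  have eq: "period_continuation z = ?P z / ?Q z" for z
  proof -
    have "k * (inverse a * inverse b * inverse c * inverse d) * p = k * p / (a * b * c * d)" for k a b c d p :: complex
      by (simp add: divide_inverse)
    then show ?thesis unfolding period_continuation_eq Gamma_def .
  qed
  show "\<exists>V P Q. open V \<and> p \<in> V \<and> holomorphic_vec_on P V \<and> holomorphic_vec_on Q V \<and>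
        (\<forall>W. open W \<and> W \<noteq> {} \<and> W \<subseteq> V \<longrightarrow> (\<exists>z\<in>W. Q z \<noteq> 0)) \<and>
        (\<forall>z\<in>V. Q z \<noteq> 0 \<longrightarrow> period_continuation z = P z / Q z)"
  proof (rule exI[of _ UNIV], rule exI[of _ ?P], rule exI[of _ ?Q], intro conjI hol allI impI ballI)
    show "\<exists>z\<in>W. ?Q z \<noteq> 0" if "open W \<and> W \<noteq> {} \<and> W \<subseteq> UNIV" for W using nondeg that by blast
    show "period_continuation z = ?P z / ?Q z" for z by (rule eq)
  qed auto
qed

text \<open>The region keeps the four numerator Gamma factors in the right half plane. It contains
  every point of the unitary axis: there all four real parts equal 1/2.\<close>

lemma period_continuation_holomorphic:
  "holomorphic_vec_on period_continuation
     {z. Re (z$1 + z$3 - z$4 + 1) > 0 \<and> Re (- z$2 - z$3 + z$4) > 0 \<and> Re (z$2 + z$3 + z$4) > 0 \<and> Re (z$1 + z$3 + z$4) > 0}"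
    (is "holomorphic_vec_on _ ?S")
proof -
  have rG: "holomorphic_vec_on (\<lambda>z. rGamma (f z)) ?S" if "holomorphic_vec_on f ?S" for f :: "complex^4 \<Rightarrow> complex"
    using that by (rule holomorphic_vec_on_compose) (rule field_differentiable_rGamma)
  have G: "holomorphic_vec_on (\<lambda>z. Gamma (f z)) ?S" if "holomorphic_vec_on f ?S" "\<And>z. z \<in> ?S \<Longrightarrow> Re (f z) > 0" for f :: "complex^4 \<Rightarrow> complex"
  proof (rule holomorphic_vec_on_compose[OF that(1)])
    fix z assume "z \<in> ?S"
    from that(2)[OF this] show "Gamma field_differentiable at (f z)"
      by (intro field_differentiable_Gamma) (auto elim!: nonpos_Ints_cases)
  qed
  show ?thesis unfolding period_continuation_eq[abs_def]
    by (intro holomorphic_vec_intros rG G) auto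
qed

lemma open_Re_pos: "continuous_on UNIV f \<Longrightarrow> open {z. Re (f z) > 0}"
  by (intro open_Collect_less continuous_intros)

text \<open>The spherical vectors equal 1 on \<open>O2\<close>, so the family to be continued is the
  same for all their parameters; in particular \<open>r\<close> may be arbitrary.\<close>

lemma l_mod_spherical:
  assumes "Re (\<Lambda>$1 + \<nu>$1 - s + 1) > 0" "Re (- \<Lambda>$2 - \<nu>$1 + s) > 0" "Re (\<Lambda>$2 + \<nu>$1 + s) > 0" "Re (\<Lambda>$1 + \<nu>$1 + s) > 0"
  shows "l_mod \<Lambda> \<nu> s (phi_sph \<Lambda>) (phi_sph \<nu>) (f_sph r) = period_continuation (vector [\<Lambda>$1, \<Lambda>$2, \<nu>$1, s])"
  unfolding l_mod_def
proof (rule meromorphic_continuation_eqI[OF period_continuation_meromorphic])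
  let ?S = "{z :: complex^4. Re (z$1 + z$3 - z$4 + 1) > 0 \<and> Re (- z$2 - z$3 + z$4) > 0 \<and> Re (z$2 + z$3 + z$4) > 0 \<and> Re (z$1 + z$3 + z$4) > 0}"
  show "holomorphic_vec_on period_continuation ?S" by (rule period_continuation_holomorphic)
  show "open ?S" unfolding Collect_conj_eq by (intro open_Int open_Re_pos continuous_intros)
  show "vector [\<Lambda>$1, \<Lambda>$2, \<nu>$1, s] \<in> ?S" using assms by (simp add: vector_4)
  let ?U = "{z :: complex^4. Re (z$1 + z$3 - z$4) > 0 \<and> Re (- z$2 - z$3 + z$4 - 1) > 0 \<and> Re (z$2 + z$3 + z$4 - 1) > 0}"
  show "open ?U" unfolding Collect_conj_eq by (intro open_Int open_Re_pos continuous_intros)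
  \<comment> \<open>An arbitrary interior point of the convergence region: the three exponents are
    1, 4 and 4.\<close>
  have "vector [6, 0, 0, 5] \<in> ?U" by (simp add: vector_4)
  then show "?U \<noteq> {}" by blast
  show "?U \<subseteq> convergence_region" by (auto simp: convergence_region_def Lam_of_def nu_of_def)
  fix z assume z: "z \<in> convergence_region"
  show "period_continuation z = period_integral (Lam_of z) (nu_of z) (z$4) (phi_sph \<Lambda>) (phi_sph \<nu>) (f_sph r)"
    unfolding period_continuation_def
    by (rule period_integral_eq[symmetric])
       (use z in \<open>auto simp: phi_sph_O2 f_sph_O2 convergence_region_def Lam_of_def nu_of_def algebra_simps\<close>)
qed

theorem mainTheorem3:
  shows "\<exists>C::real. C > 0 \<and>
    (\<forall>(\<Lambda>::complex^2) (\<nu>::complex^2) (s::complex).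
       Re (\<Lambda>$1) = 0 \<and> Re (\<Lambda>$2) = 0 \<and> Re (\<nu>$1) = 0 \<and> Re (\<nu>$2) = 0 \<and>
       \<Lambda>$1 + \<Lambda>$2 = 0 \<and> \<nu>$1 + \<nu>$2 = 0 \<and> Re s = 1/2 \<longrightarrow>
       cmod (G_arch \<Lambda> \<nu> s) =
         C * cmod (l_mod \<Lambda> \<nu> s (phi_sph \<Lambda>) (phi_sph \<nu>) (f_sph (s - 1/2))))"
\<comment> \<open>The constant is the quotient of \<open>sqrt pi / 2\<close>, the prefactor on the
  archimedean side, by \<open>sqrt pi / pi\<^sup>2\<close>, the prefactor of the period.\<close>
proof (intro exI[of _ "pi\<^sup>2 / 2"] conjI allI impI)
  fix \<Lambda> \<nu> :: "complex^2" and s :: complex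
  assume *: "Re (\<Lambda>$1) = 0 \<and> Re (\<Lambda>$2) = 0 \<and> Re (\<nu>$1) = 0 \<and> Re (\<nu>$2) = 0 \<and>
       \<Lambda>$1 + \<Lambda>$2 = 0 \<and> \<nu>$1 + \<nu>$2 = 0 \<and> Re s = 1/2"
  define m n where "m = \<Lambda>$1" and "n = \<nu>$1"
  have L2: "\<Lambda>$2 = - m" using * by (simp add: m_def add_eq_0_iff)
  have re: "Re m = 0" "Re n = 0" "Re s = 1/2" using * by (simp_all add: m_def n_def)
  \<comment> \<open>The Gamma factors shared by both sides; each side has exactly one further
    factor.\<close>
  define A where "A = rGamma (m + 1/2) * rGamma (n + 1/2) * rGamma s *
     (Gamma ((s + m + n) / 2) * Gamma ((s + m - n) / 2) * Gamma ((s - m + n) / 2))"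
  have "G_arch \<Lambda> \<nu> s = exp ((m + n + 1 - s) * of_real (ln pi)) / 2 * A * Gamma ((s - m - n) / 2)"
  proof -
    have G: "G_arch \<Lambda> \<nu> s = exp ((\<Lambda>$1 + \<nu>$1 + 1 - s) * of_real (ln pi)) / 2 * rGamma (\<Lambda>$1 + 1/2) * rGamma (\<nu>$1 + 1/2) *
      (Gamma ((s + \<Lambda>$1 + \<nu>$1) / 2) * Gamma ((s - \<Lambda>$1 - \<nu>$1) / 2) *
        Gamma ((s + \<Lambda>$1 - \<nu>$1) / 2) * Gamma ((s - \<Lambda>$1 + \<nu>$1) / 2)) / Gamma s"
      by (rule G_arch_eq) (simp_all add: *)
    have "k * u * v * (a * b * c * d) / g = k * (u * v * inverse g * (a * c * d)) * b" for k u v a b c d g :: complex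
      by (simp add: divide_inverse)
    then show ?thesis unfolding A_def rGamma_inverse_Gamma[of s] m_def n_def G .
  qed
  note G_eq = this
  \<comment> \<open>The exponent has real part \<open>1 - Re s = 1/2\<close>, independently of the
    parameters.\<close>
  have E: "cmod (exp ((m + n + 1 - s) * of_real (ln pi))) = sqrt pi"
    by (simp add: re exp_half_ln)
  have G: "cmod (G_arch \<Lambda> \<nu> s) = sqrt pi / 2 * cmod A * cmod (Gamma ((s - m - n) / 2))"
    unfolding G_eq norm_mult norm_divide E by simp
  have "l_mod \<Lambda> \<nu> s (phi_sph \<Lambda>) (phi_sph \<nu>) (f_sph (s - 1/2)) = period_continuation (vector [m, - m, n, s])"
    unfolding m_def n_def using l_mod_spherical[of \<Lambda> \<nu> s "s - 1/2"] re L2 by (simp add: m_def n_def)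
  also have "\<dots> = of_real (sqrt pi / pi\<^sup>2) * A * Gamma ((1 + m + n - s) / 2)"
  proof -
    have e: "(m + n - s + 1) * (1 / 2) = (1 + m + n - s) / 2" "(0 - - m - n + s) * (1 / 2) = (s + m - n) / 2"
      "(- m + n + s) * (1 / 2) = (s - m + n) / 2" "(m + n + s) * (1 / 2) = (s + m + n) / 2"
      "(m - - m + 1) * (1 / 2) = m + 1 / 2" "(m + - m + 2 * n + 1) * (1 / 2) = n + 1 / 2"
      by (simp_all add: field_simps)
    have aux: "of_real (1 / pi\<^sup>2) * of_real (sqrt pi) * (a * b * c * d) * (u * v * w) = of_real (sqrt pi / pi\<^sup>2) * (u * v * w * (d * b * c)) * a"
      for a b c d u v w :: complex by simp
    show ?thesis unfolding period_continuation_eq vector_4 e A_def by (rule aux)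
  qed
  finally have "cmod (l_mod \<Lambda> \<nu> s (phi_sph \<Lambda>) (phi_sph \<nu>) (f_sph (s - 1/2))) =
     sqrt pi / pi\<^sup>2 * cmod A * cmod (Gamma ((1 + m + n - s) / 2))"
    by (simp add: norm_mult norm_divide norm_power)
  also have "cmod (Gamma ((1 + m + n - s) / 2)) = cmod (Gamma ((s - m - n) / 2))"
  proof -
    \<comment> \<open>Here \<open>Re s = 1/2\<close> enters as \<open>1 - s = cnj s\<close>, and
      \<open>m\<close>, \<open>n\<close> purely imaginary as \<open>cnj m = - m\<close>,
      \<open>cnj n = - n\<close>.\<close>
    have "(1 + m + n - s) / 2 = cnj ((s - m - n) / 2)" by (simp add: complex_eq_iff re)
    then show ?thesis by (metis cnj_Gamma complex_mod_cnj)
  qed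
  finally show "cmod (G_arch \<Lambda> \<nu> s) = pi\<^sup>2 / 2 * cmod (l_mod \<Lambda> \<nu> s (phi_sph \<Lambda>) (phi_sph \<nu>) (f_sph (s - 1/2)))"
    using G by simp
qed simp

end
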